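(* Let $d \ge 3$ be odd and $k$ a positive integer. Then: (i) $\delta_d(k^{d-1}) = k^d$, and the space of $\mathrm{SL}(k^{d-1})^{\times d}$-invariant homogeneous polynomials of degree $k^d$ on $(\mathbb{C}^{k^{d-1}})^{\otimes d}$ is one-dimensional and spanned by the nonzero polynomial $F_{d,k} = \Delta_T$. (ii) If $k \ge 2$, then $\delta_d(k^{d-1}-1) = k^d - k$, and the space of $\mathrm{SL}(k^{d-1}-1)^{\times d}$-invariant homogeneous polynomials of degree $k^d-k$ on $(\mathbb{C}^{k^{d-1}-1})^{\otimes d}$ is one-dimensional and spanned by the nonzero polynomial $\widetilde F_{d,k} = \Delta_{\widetilde T}$.
   Context: For an integer $n\ge1$, $\delta_d(n)$ denotes the smallest positive degree of a nonzero $\mathrm{SL}(n)^{\times d}$-invariant homogeneous polynomial on $(\mathbb{C}^n)^{\otimes d}$ (factorwise action). Tensors $X \in (\mathbb{C}^n)^{\otimes d}$ are identified with hypermatrices $(X_{i_1,\ldots,i_d})_{i_j\in[n]}$. A $d \times M$ table $T = (T_{ij})$ with $M = nk'$ is called balanced (for $n$) if each row contains each element of $[k']$ exactly $n$ times. For a map $\sigma : [M] \to [n]$ and row $i$, set $\mathrm{sgn}_{T_i}(\sigma) := \prod_{b=1}^{k'} \mathrm{sgn}\big(\sigma(j_{b,1}),\ldots,\sigma(j_{b,n})\big)$, where $j_{b,1}<\cdots<j_{b,n}$ are the positions $j$ with $T_{ij} = b$, and $\mathrm{sgn}(a_1,\ldots,a_n)$ is the sign of $(a_1,\ldots,a_n)$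 if it is a permutation of $[n]$ and $0$ otherwise. Define the polynomial $$\Delta_T(X) := \sum_{\sigma_1,\ldots,\sigma_d : [M] \to [n]} \mathrm{sgn}_{T_1}(\sigma_1)\cdots\mathrm{sgn}_{T_d}(\sigma_d) \prod_{j=1}^M X_{\sigma_1(j),\ldots,\sigma_d(j)},$$ which is $\mathrm{SL}(n)^{\times d}$-invariant of degree $M$. Let $T$ be the $d\times k^d$ table whose columns are all the $k^d$ elements of $[k]^d$ listed in lexicographic order (so each row contains each element of $[k]$ exactly $k^{d-1}$ times), and let $\widetilde T$ be the $d\times(k^d-k)$ table obtained from $T$ by deleting the $k$ constant columns $(1,\ldots,1)^T,\ldots,(k,\ldots,k)^T$ (each row of $\widetilde T$ contains each element of $[k]$ exactly $k^{d-1}-1$ times). Set $F_{d,k} := \Delta_T$ (with $n = k^{d-1}$) and $\widetilde F_{d,k} := \Delta_{\widetilde T}$ (with $n = k^{d-1}-1$). *)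

theory Defs
  imports
    Complex_Main
    "HOL-Library.FuncSet"
    "HOL-Library.Function_Algebras"
    "HOL-Combinatorics.Permutations"
    "Jordan_Normal_Form.Determinant"
begin

text \<open>
  Both the coordinate range \<open>[n]\<close> and the table alphabet \<open>[k]\<close> are rendered zero-based,
  as \<open>{..<n}\<close> and \<open>{..<k}\<close>.
\<close>

section \<open>Hypermatrices and polynomials on them\<close>

definition multi_idx :: "nat \<Rightarrow> nat \<Rightarrow> nat list set" where
  "multi_idx n d = {I. length I = d \<and> set I \<subseteq> {..<n}}"

text \<open>
  A tensor in the \<open>d\<close>-th tensor power of \<open>\<complex>\<^sup>n\<close> is the family of its entries, indexed by
  \<^term>\<open>multi_idx n d\<close>. We represent it by a total function and ignore the values outside
  \<^term>\<open>multi_idx n d\<close>: the polynomials below involve only the coordinates in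
  \<^term>\<open>multi_idx n d\<close>, so that two of them agree as functions on \<open>hypermatrix\<close> iff they agree
  as polynomials on the tensor space.
\<close>

type_synonym hypermatrix = "nat list \<Rightarrow> complex"

definition exponents :: "nat \<Rightarrow> nat \<Rightarrow> nat \<Rightarrow> (nat list \<Rightarrow> nat) set" where
  "exponents n d m = {e \<in> multi_idx n d \<rightarrow>\<^sub>E {..m}. (\<Sum>I\<in>multi_idx n d. e I) = m}"

text \<open>The zero polynomial is homogeneous of every degree.\<close>

definition homogeneous_poly :: "nat \<Rightarrow> nat \<Rightarrow> nat \<Rightarrow> (hypermatrix \<Rightarrow> complex) \<Rightarrow> bool" where
  "homogeneous_poly n d m f \<longleftrightarrow>
     (\<exists>c. \<forall>X. f X = (\<Sum>e\<in>exponents n d m. c e * (\<Prod>I\<in>multi_idx n d. X I ^ e I)))"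

section \<open>Invariants\<close>

definition SL :: "nat \<Rightarrow> complex mat set" where
  "SL n = {A \<in> carrier_mat n n. det A = 1}"

definition tensor_act :: "nat \<Rightarrow> nat \<Rightarrow> (nat \<Rightarrow> complex mat) \<Rightarrow> hypermatrix \<Rightarrow> hypermatrix" where
  "tensor_act n d A X =
     (\<lambda>I. \<Sum>J\<in>multi_idx n d. (\<Prod>i<d. A i $$ (I ! i, J ! i)) * X J)"

definition invariants :: "nat \<Rightarrow> nat \<Rightarrow> nat \<Rightarrow> (hypermatrix \<Rightarrow> complex) set" where
  "invariants n d m =
     {f. homogeneous_poly n d m f \<and>
         (\<forall>A X. (\<forall>i<d. A i \<in> SL n) \<longrightarrow> f (tensor_act n d A X) = f X)}"

text \<open>\<open>min_degree d n\<close> is \<open>\<delta>\<^sub>d(n)\<close>; it is unspecified if no nonconstant invariant exists.\<close>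

definition min_degree :: "nat \<Rightarrow> nat \<Rightarrow> nat" where
  "min_degree d n = (LEAST m. 0 < m \<and> (\<exists>f\<in>invariants n d m. f \<noteq> 0))"

interpretation poly_space: vector_space
  "\<lambda>(c::complex) (f :: hypermatrix \<Rightarrow> complex) X. c * f X"
  by unfold_locales (auto simp: fun_eq_iff algebra_simps)

section \<open>Tables and the invariants attached to them\<close>

text \<open>
  A table is the list of its columns; \<open>T ! j ! i\<close> is its entry in row \<open>i\<close> and column \<open>j\<close>.
\<close>

type_synonym table = "nat list list"

definition tuple_sgn :: "nat \<Rightarrow> nat list \<Rightarrow> int" where
  "tuple_sgn n a =
     (if distinct a \<and> set a = {..<n} then sign (\<lambda>i. if i < n then a ! i else i) else 0)"

text \<open>
  For a table that is balanced for \<open>n\<close>, the number of distinct symbols is \<open>length T div n\<close>.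
\<close>

definition row_sgn :: "nat \<Rightarrow> table \<Rightarrow> nat \<Rightarrow> (nat \<Rightarrow> nat) \<Rightarrow> int" where
  "row_sgn n T i \<sigma> =
     (\<Prod>b<length T div n. tuple_sgn n (map \<sigma> (filter (\<lambda>j. T ! j ! i = b) [0..<length T])))"

text \<open>In \<open>Delta n d T\<close> the function \<open>s i\<close> is the map \<open>[M] \<rightarrow> [n]\<close> attached to row \<open>i\<close>.\<close>

definition Delta :: "nat \<Rightarrow> nat \<Rightarrow> table \<Rightarrow> hypermatrix \<Rightarrow> complex" where
  "Delta n d T X =
     (\<Sum>s \<in> {..<d} \<rightarrow>\<^sub>E ({..<length T} \<rightarrow>\<^sub>E {..<n}).
        of_int (\<Prod>i<d. row_sgn n T i (s i)) *
        (\<Prod>j<length T. X (map (\<lambda>i. s i j) [0..<d])))"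

definition full_table :: "nat \<Rightarrow> nat \<Rightarrow> table" where
  "full_table d k = product_lists (replicate d [0..<k])"

lemma set_full_table: "set (full_table d k) = multi_idx k d"
  unfolding full_table_def multi_idx_def product_lists_set
  by (auto simp: list_all2_conv_all_nth all_set_conv_all_nth subset_code(1) cong: conj_cong)

lemma full_table_lexicographic:
  "sorted_wrt (\<lambda>x y. (x, y) \<in> lexord {(a, b). a < b}) (full_table d k)"
proof (induction d)
  case 0
  then show ?case by (simp add: full_table_def)
next
  case (Suc d)
  have "sorted_wrt (\<lambda>x y. (x, y) \<in> lexord {(a, b). a < b})
          (concat (map (\<lambda>x. map (Cons x) (full_table d k)) xs))" if "sorted_wrt (<) xs" for xs
    using that by (induction xs) (auto simp: sorted_wrt_append sorted_wrt_map Suc.IH)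
  from this[of "[0..<k]"] show ?case by (simp add: full_table_def)
qed

definition reduced_table :: "nat \<Rightarrow> nat \<Rightarrow> table" where
  "reduced_table d k = filter (\<lambda>c. \<forall>a. c \<noteq> replicate d a) (full_table d k)"

definition F_full :: "nat \<Rightarrow> nat \<Rightarrow> hypermatrix \<Rightarrow> complex" where
  "F_full d k = Delta (k ^ (d - 1)) d (full_table d k)"

definition F_reduced :: "nat \<Rightarrow> nat \<Rightarrow> hypermatrix \<Rightarrow> complex" where
  "F_reduced d k = Delta (k ^ (d - 1) - 1) d (reduced_table d k)"

end

theory Submission
  imports Defs "Jordan_Normal_Form.Char_Poly"
begin

text \<open>
  Write \<open>M = n k\<close> and let \<open>eps s t\<close> be the sign of \<open>j \<mapsto> (s j, t j)\<close> as a bijection from \<open>[M]\<close> to \<open>[n] \<times> [k]\<close>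
  (zero if it is none). Up to a sign depending on the table only, the coefficient of \<open>Delta\<close> is
  \<open>\<Prod>\<^sub>i eps (s i) (T i)\<close>. A polarized identity \<open>c (g \<cdot> s) = det g ^ k \<cdot> c s\<close> shows that a multilinear
  SL-invariant \<open>c\<close> is determined by its pairings with the functions \<open>eps \<cdot> t\<close>, one row after the other.
  So an invariant of degree \<open>n k\<close> is determined by a function of tables. As \<open>d\<close> is odd, this function is
  alternating in the columns and vanishes unless the columns are distinct, which gives
  \<open>n \<le> k ^ (d - 1)\<close> and, in the two extremal cases, leaves a single table up to relabelling.

  For \<open>Delta \<noteq> 0\<close> exchange \<open>n\<close> and \<open>k\<close>: the top exterior power of the \<open>d\<close>-th tensor power of \<open>\<complex>\<^sup>k\<close>
  (contracted with one determinant in each row in the reduced case) is a nonzero alternating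
  SL-invariant \<open>u\<close> on tables. If \<open>Delta\<close> vanished, so would all its pairings, whence \<open>u = 0\<close>.
\<close>

text \<open>The pairing step stands in for the first fundamental theorem for SL: the forms
  \<open>eps n M s t\<close>, read as functions of s, detect every multilinear invariant, so no
  basis of the invariants and no straightening is required. Freezing all rows but one turns
  invariance under a product of d groups into d uses of a statement about a single group.

  The obstacle is that Delta is a signed sum, in which cancellation is hard to exclude coefficient
  by coefficient. Up to a constant \<open>eps\<close> is symmetric under exchanging (s, n) with (t,
  k), so the array of products of \<open>eps (s i) (T i)\<close> detects invariants from both sides.
  Nonvanishing thereby moves to a tensor where it is visible: a volume form evaluated at a basis, or
  a contraction of it in which all nonzero terms coincide.

  The degree is a multiple of n because scalar matrices given by n-th roots of unity lie in SL. In
  the reduced case minimality rests on (k - 1) ^ (d - 1) < k ^ (d - 1) - 1.\<close>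

abbreviation Maps :: "nat \<Rightarrow> nat \<Rightarrow> (nat \<Rightarrow> nat) set" where
  "Maps M n \<equiv> {..<M} \<rightarrow>\<^sub>E {..<n}"

lemma finite_Maps [simp]: "finite (Maps M n)"
  by (simp add: finite_PiE)

lemma Maps_comp_permutes:
  assumes "\<pi> permutes {..<M}" and "s \<in> {..<M} \<rightarrow>\<^sub>E I"
  shows "s \<circ> \<pi> \<in> {..<M} \<rightarrow>\<^sub>E I"
  using assms permutes_in_image[OF assms(1)] permutes_not_in[OF assms(1)]
  by (auto simp: PiE_iff extensional_def)

lemma sum_Maps_comp_permutes:
  assumes "\<pi> permutes {..<M}"
  shows "(\<Sum>s\<in>{..<M} \<rightarrow>\<^sub>E I. f (s \<circ> \<pi>)) = (\<Sum>s\<in>{..<M} \<rightarrow>\<^sub>E I. f s)"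
proof (rule sum.reindex_bij_witness[of _ "\<lambda>s. s \<circ> Hilbert_Choice.inv \<pi>" "\<lambda>s. s \<circ> \<pi>"])
  fix s assume s: "s \<in> {..<M} \<rightarrow>\<^sub>E I"
  show "s \<circ> \<pi> \<circ> Hilbert_Choice.inv \<pi> = s" "s \<circ> Hilbert_Choice.inv \<pi> \<circ> \<pi> = s"
    using permutes_inv_o[OF assms] by (simp_all add: o_assoc[symmetric])
  show "s \<circ> \<pi> \<in> {..<M} \<rightarrow>\<^sub>E I" "s \<circ> Hilbert_Choice.inv \<pi> \<in> {..<M} \<rightarrow>\<^sub>E I"
    using Maps_comp_permutes assms permutes_inv[OF assms] s by blast+
qed simp

section \<open>Polarization\<close>

lemma prod_fibre_powers:
  fixes \<epsilon> :: "nat \<Rightarrow> complex"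
  assumes "h \<in> Maps M m"
  shows "(\<Prod>l<M. \<epsilon> (h l)) = (\<Prod>j<m. \<epsilon> j ^ card {l. l < M \<and> h l = j})"
proof -
  have "(\<Prod>l<M. \<epsilon> (h l)) = (\<Prod>j<m. \<Prod>l\<in>{l\<in>{..<M}. h l = j}. \<epsilon> (h l))"
    using assms by (subst prod.group) auto
  also have "\<dots> = (\<Prod>j<m. \<epsilon> j ^ card {l. l < M \<and> h l = j})"
    by (intro prod.cong refl) (simp)
  finally show ?thesis .
qed

text \<open>A surjective self-map of a finite set is a permutation. The restriction mediates between
  two conventions: permutations are the identity outside the set, elements of \<open>Maps\<close>
  are undefined there.\<close>

lemma bij_betw_permutes_surj_Maps:
  "bij_betw (\<lambda>\<pi>. restrict \<pi> {..<M}) {\<pi>. \<pi> permutes {..<M}} {h \<in> Maps M M. {..<M} \<subseteq> h ` {..<M}}"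
proof (rule bij_betw_byWitness[of _ "\<lambda>h j. if j < M then h j else j"])
  show "\<forall>\<pi>\<in>{\<pi>. \<pi> permutes {..<M}}. (\<lambda>j. if j < M then restrict \<pi> {..<M} j else j) = \<pi>"
    by (auto simp: fun_eq_iff permutes_not_in)
  show "\<forall>h\<in>{h \<in> Maps M M. {..<M} \<subseteq> h ` {..<M}}. restrict (\<lambda>j. if j < M then h j else j) {..<M} = h"
    by (auto simp: fun_eq_iff restrict_def PiE_iff extensional_def)
  show "(\<lambda>\<pi>. restrict \<pi> {..<M}) ` {\<pi>. \<pi> permutes {..<M}} \<subseteq> {h \<in> Maps M M. {..<M} \<subseteq> h ` {..<M}}"
    using permutes_image permutes_in_image by (fastforce simp: image_def)
  show "(\<lambda>h j. if j < M then h j else j) ` {h \<in> Maps M M. {..<M} \<subseteq> h ` {..<M}}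
        \<subseteq> {\<pi>. \<pi> permutes {..<M}}"
  proof clarify
    fix h assume h: "h \<in> Maps M M" "{..<M} \<subseteq> h ` {..<M}"
    have "h ` {..<M} = {..<M}" using h by auto
    then have "bij_betw h {..<M} {..<M}"
      by (simp add: bij_betw_def eq_card_imp_inj_on)
    then have "bij_betw (\<lambda>j. if j < M then h j else j) {..<M} {..<M}"
      by (subst bij_betw_cong[where g = h]) auto
    then show "(\<lambda>j. if j < M then h j else j) permutes {..<M}"
      by (rule bij_imp_permutes) auto
  qed
qed

text \<open>
  Evaluate the form at \<open>\<Sum>\<^sub>j \<epsilon> j \<cdot> e (t j)\<close> with \<open>\<epsilon> j \<in> {0, 1}\<close> and sum over all \<open>\<epsilon>\<close> with sign
  \<open>\<Prod>\<^sub>j (if \<epsilon> j = 0 then -1 else 1)\<close>: only the terms using every \<open>j\<close> survive.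
\<close>

lemma polarization:
  fixes C :: "(nat \<Rightarrow> 'i) \<Rightarrow> complex"
  assumes fin: "finite I"
    and zero: "\<And>x. (\<Sum>t\<in>{..<M} \<rightarrow>\<^sub>E I. C t * (\<Prod>j<M. x (t j))) = 0"
    and t: "t \<in> {..<M} \<rightarrow>\<^sub>E I"
  shows "(\<Sum>\<pi> | \<pi> permutes {..<M}. C (t \<circ> \<pi>)) = 0"
proof -
  define a where "a e = (if e = 0 then -1 else (1::complex))" for e :: complex
  define E where "E = {..<M} \<rightarrow>\<^sub>E {0, 1 :: complex}"
  define D where "D h = C (\<lambda>l\<in>{..<M}. t (h l))" for h
  have finE: "finite E" unfolding E_def by (simp add: finite_PiE)
  have eval: "(\<Sum>h\<in>Maps M M. D h * (\<Prod>l<M. \<epsilon> (h l))) = 0" for \<epsilon> :: "nat \<Rightarrow> complex"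
  proof -
    define x where "x i = (\<Sum>j<M. if t j = i then \<epsilon> j else 0)" for i
    have ex: "(\<Prod>l<M. x (u l)) = (\<Sum>h\<in>Maps M M. \<Prod>l<M. if t (h l) = u l then \<epsilon> (h l) else 0)" for u
      unfolding x_def by (subst prod_sum_PiE) auto
    have inner: "(\<Sum>u\<in>{..<M} \<rightarrow>\<^sub>E I. C u * (\<Prod>l<M. if t (h l) = u l then \<epsilon> (h l) else 0))
        = D h * (\<Prod>l<M. \<epsilon> (h l))" if h: "h \<in> Maps M M" for h
    proof -
      let ?v = "\<lambda>l\<in>{..<M}. t (h l)"
      have v: "?v \<in> {..<M} \<rightarrow>\<^sub>E I" using h t by (auto simp: PiE_iff)
      have "(\<Sum>u\<in>{..<M} \<rightarrow>\<^sub>E I. C u * (\<Prod>l<M. if t (h l) = u l then \<epsilon> (h l) else 0))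
          = (\<Sum>u\<in>{..<M} \<rightarrow>\<^sub>E I. if u = ?v then D h * (\<Prod>l<M. \<epsilon> (h l)) else 0)"
      proof (intro sum.cong refl)
        fix u assume u: "u \<in> {..<M} \<rightarrow>\<^sub>E I"
        show "C u * (\<Prod>l<M. if t (h l) = u l then \<epsilon> (h l) else 0)
            = (if u = ?v then D h * (\<Prod>l<M. \<epsilon> (h l)) else 0)"
        proof (cases "u = ?v")
          case True
          then show ?thesis by (simp add: D_def)
        next
          case False
          then obtain l where "l < M" "u l \<noteq> t (h l)"
            using PiE_ext[OF u v] by force
          then have "(\<Prod>l<M. if t (h l) = u l then \<epsilon> (h l) else 0) = 0"
            by (intro prod_zero) (auto intro!: bexI[of _ l])
          then show ?thesis using False by simp
        qed
      qed
      also have "\<dots> = D h * (\<Prod>l<M. \<epsilon> (h l))"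
        using v fin by (simp add: finite_PiE)
      finally show ?thesis .
    qed
    have "0 = (\<Sum>u\<in>{..<M} \<rightarrow>\<^sub>E I. C u * (\<Prod>l<M. x (u l)))" using zero by simp
    also have "\<dots> = (\<Sum>u\<in>{..<M} \<rightarrow>\<^sub>E I. \<Sum>h\<in>Maps M M.
        C u * (\<Prod>l<M. if t (h l) = u l then \<epsilon> (h l) else 0))"
      by (simp add: ex sum_distrib_left)
    also have "\<dots> = (\<Sum>h\<in>Maps M M. D h * (\<Prod>l<M. \<epsilon> (h l)))"
      by (subst sum.swap) (intro sum.cong refl inner)
    finally show ?thesis by simp
  qed
  have weight: "(\<Sum>\<epsilon>\<in>E. (\<Prod>j<M. a (\<epsilon> j)) * (\<Prod>l<M. \<epsilon> (h l)))
      = (if {..<M} \<subseteq> h ` {..<M} then 1 else 0)" if h: "h \<in> Maps M M" for h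
  proof -
    let ?c = "\<lambda>j. card {l. l < M \<and> h l = j}"
    have "(\<Sum>\<epsilon>\<in>E. (\<Prod>j<M. a (\<epsilon> j)) * (\<Prod>l<M. \<epsilon> (h l)))
        = (\<Sum>\<epsilon>\<in>E. \<Prod>j<M. a (\<epsilon> j) * \<epsilon> j ^ ?c j)"
      by (simp add: prod_fibre_powers[OF h] prod.distrib)
    also have "\<dots> = (\<Prod>j<M. \<Sum>e\<in>{0,1}. a e * e ^ ?c j)"
      unfolding E_def by (subst prod_sum_PiE) auto
    \<comment> \<open>The factor at j equals 1 - 0 ^ c, where c is the number of preimages of j
      under h; it is 0 exactly when j is not hit.\<close>
    also have "\<dots> = (\<Prod>j<M. if j \<in> h ` {..<M} then 1 else 0)"
    proof (intro prod.cong refl)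
      fix j
      have "?c j = 0 \<longleftrightarrow> j \<notin> h ` {..<M}" by auto
      then show "(\<Sum>e\<in>{0,1}. a e * e ^ ?c j) = (if j \<in> h ` {..<M} then 1 else 0)"
        by (auto simp: a_def power_0_left)
    qed
    also have "\<dots> = (if {..<M} \<subseteq> h ` {..<M} then 1 else 0)"
    proof (cases "{..<M} \<subseteq> h ` {..<M}")
      case True
      then show ?thesis by (auto intro!: prod.neutral)
    next
      case False
      then show ?thesis by (auto intro!: prod_zero)
    qed
    finally show ?thesis .
  qed
  have "0 = (\<Sum>\<epsilon>\<in>E. (\<Prod>j<M. a (\<epsilon> j)) * (\<Sum>h\<in>Maps M M. D h * (\<Prod>l<M. \<epsilon> (h l))))"
    by (simp add: eval)
  also have "\<dots> = (\<Sum>h\<in>Maps M M. \<Sum>\<epsilon>\<in>E. D h * ((\<Prod>j<M. a (\<epsilon> j)) * (\<Prod>l<M. \<epsilon> (h l))))"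
    by (subst sum.swap) (simp add: sum_distrib_left mult_ac)
  also have "\<dots> = (\<Sum>h\<in>Maps M M. D h * (if {..<M} \<subseteq> h ` {..<M} then 1 else 0))"
    by (intro sum.cong refl) (simp only: sum_distrib_left[symmetric] weight)
  also have "\<dots> = (\<Sum>h\<in>{h \<in> Maps M M. {..<M} \<subseteq> h ` {..<M}}. D h)"
    by (rule sum.mono_neutral_cong_right) auto
  also have "\<dots> = (\<Sum>\<pi> | \<pi> permutes {..<M}. D (restrict \<pi> {..<M}))"
    by (rule sum.reindex_bij_betw[OF bij_betw_permutes_surj_Maps, symmetric])
  also have "\<dots> = (\<Sum>\<pi> | \<pi> permutes {..<M}. C (t \<circ> \<pi>))"
  proof (intro sum.cong refl)
    fix \<pi> assume "\<pi> \<in> {\<pi>. \<pi> permutes {..<M}}"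
    then have "(\<lambda>l\<in>{..<M}. t (restrict \<pi> {..<M} l)) = t \<circ> \<pi>"
      using t by (auto simp: fun_eq_iff restrict_def PiE_iff extensional_def permutes_not_in)
    then show "D (restrict \<pi> {..<M}) = C (t \<circ> \<pi>)" by (simp add: D_def)
  qed
  finally show ?thesis by simp
qed

corollary polarization_symmetric:
  fixes C :: "(nat \<Rightarrow> 'i) \<Rightarrow> complex"
  assumes "finite I"
    and "\<And>x. (\<Sum>t\<in>{..<M} \<rightarrow>\<^sub>E I. C t * (\<Prod>j<M. x (t j))) = 0"
    and "\<And>\<pi> t. \<pi> permutes {..<M} \<Longrightarrow> t \<in> {..<M} \<rightarrow>\<^sub>E I \<Longrightarrow> C (t \<circ> \<pi>) = C t"
    and "t \<in> {..<M} \<rightarrow>\<^sub>E I"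
  shows "C t = 0"
proof -
  have "(\<Sum>\<pi> | \<pi> permutes {..<M}. C (t \<circ> \<pi>)) = (\<Sum>\<pi> | \<pi> permutes {..<M}. C t)"
    by (intro sum.cong refl) (use assms(3,4) in blast)
  also have "\<dots> = fact M * C t"
    by (simp add: card_permutations[of "{..<M}" M])
  finally show ?thesis
    unfolding polarization[OF assms(1,2,4)] by simp
qed

section \<open>Signs of maps and determinants\<close>

text \<open>The Levi-Civita symbol of h on \<open>{..<M}\<close>. Since \<open>sign\<close> expects
  a permutation of all naturals, h is continued by the identity.\<close>

definition map_sgn :: "nat \<Rightarrow> (nat \<Rightarrow> nat) \<Rightarrow> complex" where
  "map_sgn M h = (if bij_betw h {..<M} {..<M} then of_int (sign (\<lambda>j. if j < M then h j else j)) else 0)"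

lemma extend_permutes:
  assumes "bij_betw h {..<M} {..<M}"
  shows "(\<lambda>j. if j < M then h j else j) permutes {..<M}"
proof -
  have "bij_betw (\<lambda>j. if j < M then h j else j) {..<M} {..<M}"
    using assms by (subst bij_betw_cong[where g = h]) auto
  then show ?thesis by (rule bij_imp_permutes) auto
qed

lemma map_sgn_cong:
  assumes "\<And>j. j < M \<Longrightarrow> h j = h' j"
  shows "map_sgn M h = map_sgn M h'"
proof -
  have "(\<lambda>j. if j < M then h j else j) = (\<lambda>j. if j < M then h' j else j)"
    using assms by auto
  moreover have "bij_betw h {..<M} {..<M} \<longleftrightarrow> bij_betw h' {..<M} {..<M}"
    using assms by (intro bij_betw_cong) auto
  ultimately show ?thesis by (simp add: map_sgn_def)
qed

lemma map_sgn_nonzero_iff: "map_sgn M h \<noteq> 0 \<longleftrightarrow> bij_betw h {..<M} {..<M}"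
  by (simp add: map_sgn_def)

lemma map_sgn_permutes: "\<pi> permutes {..<M} \<Longrightarrow> map_sgn M \<pi> = of_int (sign \<pi>)"
  using permutes_imp_bij[of \<pi> "{..<M}"] permutes_not_in[of \<pi> "{..<M}"]
  by (simp add: map_sgn_def) (metis (mono_tags, lifting) ext lessThan_iff)

lemma map_sgn_square: "map_sgn M h \<noteq> 0 \<Longrightarrow> map_sgn M h * map_sgn M h = 1"
  by (simp add: map_sgn_def of_int_mult[symmetric] split: if_splits)

lemma permutation_lessThan: "\<pi> permutes {..<M :: nat} \<Longrightarrow> permutation \<pi>"
  unfolding permutation_permutes using finite_lessThan by blast

lemma map_sgn_comp_right:
  assumes "\<pi> permutes {..<M}"
  shows "map_sgn M (h \<circ> \<pi>) = of_int (sign \<pi>) * map_sgn M h"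
proof -
  let ?e = "\<lambda>h j. if j < M then h j else j"
  have iff: "bij_betw (h \<circ> \<pi>) {..<M} {..<M} \<longleftrightarrow> bij_betw h {..<M} {..<M}"
    by (rule bij_betw_comp_iff[OF permutes_imp_bij[OF assms], symmetric])
  have eq: "?e (h \<circ> \<pi>) = ?e h \<circ> \<pi>"
    using permutes_in_image[OF assms] permutes_not_in[OF assms] by (auto simp: fun_eq_iff)
  have "sign (?e h \<circ> \<pi>) = sign (?e h) * sign \<pi>" if "bij_betw h {..<M} {..<M}"
    using permutation_lessThan assms extend_permutes[OF that] by (intro sign_compose) blast+
  then show ?thesis unfolding map_sgn_def iff eq by simp
qed

lemma map_sgn_comp_left:
  assumes "q permutes {..<M}"
  shows "map_sgn M (q \<circ> h) = of_int (sign q) * map_sgn M h"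
proof -
  let ?e = "\<lambda>h j. if j < M then h j else j"
  have iff: "bij_betw (q \<circ> h) {..<M} {..<M} \<longleftrightarrow> bij_betw h {..<M} {..<M}"
  proof
    assume "bij_betw (q \<circ> h) {..<M} {..<M}"
    from bij_betw_trans[OF this permutes_imp_bij[OF permutes_inv[OF assms]]]
    show "bij_betw h {..<M} {..<M}"
      unfolding o_assoc permutes_inv_o[OF assms] by simp
  qed (rule bij_betw_trans[OF _ permutes_imp_bij[OF assms]])
  have eq: "?e (q \<circ> h) = q \<circ> ?e h"
    using permutes_not_in[OF assms] by (auto simp: fun_eq_iff)
  have "sign (q \<circ> ?e h) = sign q * sign (?e h)" if "bij_betw h {..<M} {..<M}"
    using permutation_lessThan assms extend_permutes[OF that] by (intro sign_compose) blast+
  then show ?thesis unfolding map_sgn_def iff eq by simp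
qed

text \<open>The Leibniz formula, summed over all self-maps because \<open>map_sgn\<close> kills
  those that are not bijective. In this form it can be matched with expanded products of
  sums.\<close>

lemma det_eq_sum_Maps:
  fixes N :: "nat \<Rightarrow> nat \<Rightarrow> complex"
  shows "det (mat M M (\<lambda>(r, j). N r j)) = (\<Sum>h\<in>Maps M M. map_sgn M h * (\<Prod>j<M. N (h j) j))"
proof -
  have "det (mat M M (\<lambda>(r, j). N r j))
      = (\<Sum>p | p permutes {..<M}. of_int (sign p) * (\<Prod>j<M. N (p j) j))"
    unfolding lessThan_atLeast0
    by (subst det_col[of _ M]) (auto intro!: sum.cong prod.cong dest: permutes_in_image simp: lessThan_atLeast0)
  also have "\<dots> = (\<Sum>p | p permutes {..<M}. map_sgn M (restrict p {..<M}) * (\<Prod>j<M. N (restrict p {..<M} j) j))"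
  proof (intro sum.cong refl)
    fix p assume "p \<in> {p. p permutes {..<M}}"
    then have "map_sgn M (restrict p {..<M}) = of_int (sign p)"
      using map_sgn_permutes[of p M] map_sgn_cong[of M "restrict p {..<M}" p] by simp
    then show "of_int (sign p) * (\<Prod>j<M. N (p j) j)
        = map_sgn M (restrict p {..<M}) * (\<Prod>j<M. N (restrict p {..<M} j) j)" by simp
  qed
  also have "\<dots> = (\<Sum>h\<in>{h \<in> Maps M M. {..<M} \<subseteq> h ` {..<M}}. map_sgn M h * (\<Prod>j<M. N (h j) j))"
    by (rule sum.reindex_bij_betw[OF bij_betw_permutes_surj_Maps])
  also have "\<dots> = (\<Sum>h\<in>Maps M M. map_sgn M h * (\<Prod>j<M. N (h j) j))"
    by (rule sum.mono_neutral_left) (auto simp: map_sgn_def bij_betw_def)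
  finally show ?thesis .
qed

lemma sum_Maps_indicator:
  fixes f :: "(nat \<Rightarrow> nat) \<Rightarrow> complex"
  assumes "\<And>h h'. (\<And>j. j < M \<Longrightarrow> h j = h' j) \<Longrightarrow> f h = f h'" and "\<And>j. j < M \<Longrightarrow> v j < n"
  shows "(\<Sum>h\<in>Maps M n. f h * (\<Prod>j<M. if h j = v j then 1 else 0)) = f v"
proof -
  let ?v = "restrict v {..<M}"
  have "(\<Sum>h\<in>Maps M n. f h * (\<Prod>j<M. if h j = v j then 1 else 0)) = (\<Sum>h\<in>Maps M n. if h = ?v then f v else 0)"
  proof (intro sum.cong refl)
    fix h assume h: "h \<in> Maps M n"
    show "f h * (\<Prod>j<M. if h j = v j then 1 else 0) = (if h = ?v then f v else 0)"
    proof (cases "\<forall>j<M. h j = v j")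
      case True
      then have "h = ?v" using h by (auto simp: fun_eq_iff PiE_iff extensional_def restrict_def)
      moreover have "f h = f v" using True assms(1) by blast
      ultimately show ?thesis using True by simp
    next
      case False
      then have "h \<noteq> ?v" by auto
      moreover have "(\<Prod>j<M. if h j = v j then 1 else (0::complex)) = 0"
        using False by (auto intro!: prod_zero)
      ultimately show ?thesis by simp
    qed
  qed
  also have "\<dots> = f v"
    using assms(2) by (subst sum.delta) auto
  finally show ?thesis .
qed

text \<open>Signs become determinants, so that multiplicativity and block structure apply to them; a
  map that is not injective gives two equal columns.\<close>

lemma map_sgn_eq_det:
  assumes "\<And>j. j < M \<Longrightarrow> h j < M"
  shows "map_sgn M h = det (mat M M (\<lambda>(r, j). if r = h j then 1 else 0))"
  unfolding det_eq_sum_Maps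
proof (rule sum_Maps_indicator[symmetric])
  show "map_sgn M h = map_sgn M h'" if "\<And>j. j < M \<Longrightarrow> h j = h' j" for h h'
    using that by (rule map_sgn_cong)
qed (use assms in blast)

text \<open>An index r stands for position \<open>r mod n\<close> in block \<open>r div n\<close>.
  The induction splits off the last block.\<close>

lemma det_block_diag:
  fixes G :: "nat \<Rightarrow> nat \<Rightarrow> nat \<Rightarrow> complex"
  assumes n: "n > 0"
  shows "det (mat (n * k) (n * k) (\<lambda>(r, c). if r div n = c div n then G (r div n) (r mod n) (c mod n) else 0))
    = (\<Prod>b<k. det (mat n n (\<lambda>(r, c). G b r c)))"
proof (induction k)
  case 0
  show ?case by (simp add: det_dim_zero)
next
  case (Suc k)
  let ?f = "\<lambda>(r, c). if r div n = c div n then G (r div n) (r mod n) (c mod n) else 0"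
  have div: "r div n = k \<and> r mod n = r - n * k" if "\<not> r < n * k" "r < n * k + n" for r
  proof -
    have "r = k * n + (r - n * k)" "r - n * k < n" using that by (auto simp: mult.commute)
    then show ?thesis by (metis div_mult_self3 add.right_neutral div_less mod_less mod_mult_self3 n less_numeral_extra(3) add_0)
  qed
  have div': "r div n < k" if "r < n * k" for r
    using that by (simp add: less_mult_imp_div_less mult.commute)
  have "mat (n * Suc k) (n * Suc k) ?f
      = four_block_mat (mat (n * k) (n * k) ?f) (0\<^sub>m (n * k) n) (0\<^sub>m n (n * k)) (mat n n (\<lambda>(r, c). G k r c))"
  proof (rule eq_matI, goal_cases)
    case (1 r c)
    then have r: "r < n * k + n" and c: "c < n * k + n" by auto
    show ?case
    proof (cases "r < n * k")
      case True
      show ?thesis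
      proof (cases "c < n * k")
        case False
        then have "r div n \<noteq> c div n" using div'[OF True] div[OF False c] by simp
        then show ?thesis using True False r c by simp
      qed (use True r in simp)
    next
      case r': False
      show ?thesis
      proof (cases "c < n * k")
        case True
        then have "r div n \<noteq> c div n" using div'[OF True] div[OF r' r] by simp
        then show ?thesis using True r' r c by simp
      next
        case False
        then have "r div n = k" "c div n = k" "r mod n = r - n * k" "c mod n = c - n * k"
          using div r' r c by blast+
        then show ?thesis using False r' r c by simp
      qed
    qed
  qed auto
  then have "det (mat (n * Suc k) (n * Suc k) ?f)
      = det (mat (n * k) (n * k) ?f) * det (mat n n (\<lambda>(r, c). G k r c))"
    by (simp add: det_four_block_mat_lower_left_zero[of _ "n * k" _ n])
  then show ?case using Suc.IH by (simp add: mult.commute)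
qed

text \<open>The number \<open>t j * n + s j\<close> encodes the pair (s j, t j): block t j, position
  s j. As a function of s this is, up to sign, the product of the n by n Levi-Civita symbols over
  the fibres of t.\<close>

definition eps :: "nat \<Rightarrow> nat \<Rightarrow> (nat \<Rightarrow> nat) \<Rightarrow> (nat \<Rightarrow> nat) \<Rightarrow> complex" where
  "eps n M s t = map_sgn M (\<lambda>j. t j * n + s j)"

lemma eps_cong:
  assumes "\<And>j. j < M \<Longrightarrow> s j = s' j" and "\<And>j. j < M \<Longrightarrow> t j = t' j"
  shows "eps n M s t = eps n M s' t'"
  unfolding eps_def by (rule map_sgn_cong) (simp add: assms)

lemma eps_comp_permutes:
  assumes "\<pi> permutes {..<M}"
  shows "eps n M (s \<circ> \<pi>) (t \<circ> \<pi>) = of_int (sign \<pi>) * eps n M s t"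
  using map_sgn_comp_right[OF assms, of "\<lambda>j. t j * n + s j"] by (simp add: eps_def o_def)

lemma pair_code_less:
  fixes a b :: nat
  assumes "a < n" "b < k"
  shows "b * n + a < n * k"
proof -
  have "b * n + a < Suc b * n" using assms by simp
  also have "\<dots> \<le> k * n" using assms by (intro mult_right_mono) auto
  finally show ?thesis by (simp add: mult.commute)
qed

lemma pair_code_eq_iff:
  fixes a b :: nat
  assumes "a < n" "n > 0"
  shows "r = b * n + a \<longleftrightarrow> r div n = b \<and> r mod n = a"
  using assms div_mult_mod_eq[of r n] by auto

text \<open>Column j of the matrix is supported in block t j. In the Leibniz expansion only maps h
  with \<open>h j div n = t j\<close> survive, and such an h is the same as its remainders
  s.\<close>

lemma sum_eps_eq_det:
  assumes n: "n > 0" and M: "M = n * k" and t: "\<And>j. j < M \<Longrightarrow> t j < k"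
  shows "(\<Sum>s\<in>Maps M n. eps n M s t * (\<Prod>j<M. Y j (s j)))
    = det (mat M M (\<lambda>(r, j). if r div n = t j then Y j (r mod n) else 0))"
proof -
  let ?N = "\<lambda>r j. if r div n = t j then Y j (r mod n) else 0"
  let ?H = "{h \<in> Maps M M. \<forall>j<M. h j div n = t j}"
  have "(\<Sum>s\<in>Maps M n. eps n M s t * (\<Prod>j<M. Y j (s j)))
      = (\<Sum>h\<in>?H. map_sgn M h * (\<Prod>j<M. ?N (h j) j))"
  proof (rule sum.reindex_bij_witness[of _ "\<lambda>h. \<lambda>j\<in>{..<M}. h j mod n" "\<lambda>s. \<lambda>j\<in>{..<M}. t j * n + s j"])
    fix s assume s: "s \<in> Maps M n"
    then have sn: "\<And>j. j < M \<Longrightarrow> s j < n" by auto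
    have dm: "(t j * n + s j) div n = t j" "(t j * n + s j) mod n = s j" if "j < M" for j
      using sn[OF that] n by auto
    show "(\<lambda>j\<in>{..<M}. (\<lambda>j\<in>{..<M}. t j * n + s j) j mod n) = s"
      using s dm by (auto simp: fun_eq_iff PiE_iff extensional_def restrict_def)
    show "(\<lambda>j\<in>{..<M}. t j * n + s j) \<in> ?H"
      using dm pair_code_less[OF sn t] by (auto simp: M)
    show "map_sgn M (\<lambda>j\<in>{..<M}. t j * n + s j) * (\<Prod>j<M. ?N ((\<lambda>j\<in>{..<M}. t j * n + s j) j) j)
      = eps n M s t * (\<Prod>j<M. Y j (s j))"
      unfolding eps_def using dm
      by (intro arg_cong2[where f = "(*)"] map_sgn_cong prod.cong) auto
  next
    fix h assume h: "h \<in> ?H"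
    show "(\<lambda>j\<in>{..<M}. h j mod n) \<in> Maps M n" using n by auto
    have "t j * n + h j mod n = h j" if "j < M" for j
      using h that div_mult_mod_eq[of "h j" n] by auto
    then show "(\<lambda>j\<in>{..<M}. t j * n + (\<lambda>j\<in>{..<M}. h j mod n) j) = h"
      using h by (auto simp: fun_eq_iff PiE_iff extensional_def restrict_def)
  qed
  also have "\<dots> = (\<Sum>h\<in>Maps M M. map_sgn M h * (\<Prod>j<M. ?N (h j) j))"
    by (rule sum.mono_neutral_left) (auto intro!: prod_zero)
  finally show ?thesis by (simp add: det_eq_sum_Maps)
qed

text \<open>The determinant given by \<open>sum_eps_eq_det\<close> factors as B * P: B has k
  diagonal copies of g, so its determinant is det g ^ k, and P is the 0/1 matrix of the pairs (s j,
  t j), whose determinant is \<open>eps n M s t\<close>.\<close>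

lemma eps_transform:
  assumes n: "n > 0" and M: "M = n * k" and g: "g \<in> carrier_mat n n"
    and s: "\<And>j. j < M \<Longrightarrow> s j < n" and t: "\<And>j. j < M \<Longrightarrow> t j < k"
  shows "(\<Sum>s'\<in>Maps M n. eps n M s' t * (\<Prod>j<M. g $$ (s' j, s j))) = det g ^ k * eps n M s t"
proof -
  define B where "B = mat M M (\<lambda>(r, c). if r div n = c div n then g $$ (r mod n, c mod n) else 0)"
  define P where "P = mat M M (\<lambda>(r, j). if r = t j * n + s j then 1 else (0::complex))"
  have code: "t j * n + s j < M" if "j < M" for j
    unfolding M using pair_code_less s t that by blast
  have gm: "mat n n (($$) g) = g"
    using g by (intro eq_matI) auto
  have "mat M M (\<lambda>(r, j). if r div n = t j then g $$ (r mod n, s j) else 0) = B * P"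
  proof (rule eq_matI, goal_cases)
    case (1 r j)
    then have r: "r < M" and j: "j < M" by (auto simp: B_def P_def)
    have "(B * P) $$ (r, j) = (\<Sum>x<M. B $$ (r, x) * (if x = t j * n + s j then 1 else 0))"
      using r j by (simp add: B_def P_def times_mat_def scalar_prod_def lessThan_atLeast0)
    also have "\<dots> = B $$ (r, t j * n + s j)"
      using code[OF j] by (simp add: if_distrib cong: if_cong)
    also have "\<dots> = (if r div n = t j then g $$ (r mod n, s j) else 0)"
      using r code[OF j] s[OF j] n by (simp add: B_def)
    finally show ?case using r j by simp
  qed (auto simp: B_def P_def)
  moreover have "det B = det g ^ k"
    unfolding B_def M using det_block_diag[OF n, of k "\<lambda>b r c. g $$ (r, c)"] by (simp add: gm)
  moreover have "det P = eps n M s t"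
    unfolding P_def eps_def using code by (simp add: map_sgn_eq_det)
  moreover have "det (B * P) = det B * det P"
    by (rule det_mult[of _ M]) (simp_all add: B_def P_def)
  ultimately show ?thesis
    using sum_eps_eq_det[OF n M, of t "\<lambda>j a. g $$ (a, s j)"] t by simp
qed

section \<open>Comparison of \<open>eps\<close> with the row signs in the definition of
  Delta\<close>

lemma tuple_sgn_eq_map_sgn:
  assumes "length a = n"
  shows "of_int (tuple_sgn n a) = map_sgn n ((!) a)"
proof -
  have "bij_betw ((!) a) {..<n} {..<n} \<longleftrightarrow> distinct a \<and> set a = {..<n}"
  proof -
    have "(!) a ` {..<n} = set a" using assms by (auto simp: set_conv_nth)
    moreover have "inj_on ((!) a) {..<n} \<longleftrightarrow> distinct a"
      unfolding inj_on_def distinct_conv_nth assms by blast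
    ultimately show ?thesis by (simp add: bij_betw_def)
  qed
  then show ?thesis by (simp add: tuple_sgn_def map_sgn_def)
qed

text \<open>
  Listing the positions of \<open>T\<close>'s row \<open>i\<close> symbol by symbol turns the determinant defining \<open>eps\<close>
  into a block diagonal one, with one block for each symbol.
\<close>

lemma row_sgn_eq_eps:
  assumes n: "n > 0" and len: "length T = n * k"
    and range: "\<And>j. j < n * k \<Longrightarrow> T ! j ! i < k"
    and bal: "\<And>b. b < k \<Longrightarrow> length (filter (\<lambda>j. T ! j ! i = b) [0..<n * k]) = n"
  obtains \<kappa> :: complex where "\<kappa> \<noteq> 0"
    and "\<And>s. (\<And>j. j < n * k \<Longrightarrow> s j < n) \<Longrightarrow>
           of_int (row_sgn n T i s) = \<kappa> * eps n (n * k) s (\<lambda>j. T ! j ! i)"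
proof -
  define M where "M = n * k"
  define L where "L b = filter (\<lambda>j. T ! j ! i = b) [0..<M]" for b
  \<comment> \<open>The positions sorted by symbol: p c is entry number \<open>c mod n\<close> in
    the increasing list of positions that carry symbol \<open>c div n\<close>. The sign of p is the
    constant \<kappa>, which is independent of s.\<close>
  define p where "p c = (if c < M then L (c div n) ! (c mod n) else c)" for c
  have L: "length (L b) = n" "distinct (L b)" if "b < k" for b
    using bal[OF that] by (simp_all add: L_def M_def)
  have memL: "L b ! a < M \<and> T ! (L b ! a) ! i = b" if "b < k" "a < n" for a b
    using nth_mem[of a "L b"] L[OF that(1)] that(2) by (auto simp: L_def)
  have dk: "c div n < k" "c mod n < n" if "c < M" for c
    using that n by (auto simp: M_def less_mult_imp_div_less mult.commute)
  have pM: "p c < M" "T ! p c ! i = c div n" if "c < M" for c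
    using memL dk[OF that] that by (auto simp: p_def)
  have "inj_on p {..<M}"
  proof (rule inj_onI)
    fix c c' assume c: "c \<in> {..<M}" "c' \<in> {..<M}" "p c = p c'"
    then have d: "c div n = c' div n" using pM[of c] pM[of c'] by simp
    then have "L (c div n) ! (c mod n) = L (c div n) ! (c' mod n)" using c by (simp add: p_def)
    then have "c mod n = c' mod n"
      using L[of "c div n"] dk[of c] dk[of c'] c by (simp add: nth_eq_iff_index_eq)
    with d show "c = c'" by (metis div_mult_mod_eq)
  qed
  moreover have "p ` {..<M} \<subseteq> {..<M}" using pM by auto
  ultimately have "bij_betw p {..<M} {..<M}"
    by (simp add: bij_betw_def endo_inj_surj)
  then have p: "p permutes {..<M}" by (rule bij_imp_permutes) (simp add: p_def)
  have "of_int (row_sgn n T i s) = of_int (sign p) * eps n M s (\<lambda>j. T ! j ! i)"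
    if s: "\<And>j. j < M \<Longrightarrow> s j < n" for s
  proof -
    let ?h = "\<lambda>j. T ! j ! i * n + s j"
    have hp: "(?h \<circ> p) c < M" if "c < M" for c
      using pair_code_less[OF s[OF pM(1)[OF that]] range] pM(1)[OF that] by (simp add: M_def)
    have "of_int (sign p) * eps n M s (\<lambda>j. T ! j ! i) = map_sgn M (?h \<circ> p)"
      by (simp add: eps_def map_sgn_comp_right[OF p])
    also have "\<dots> = det (mat M M (\<lambda>(r, c). if r = (?h \<circ> p) c then 1 else 0))"
      using hp by (rule map_sgn_eq_det)
    also have "mat M M (\<lambda>(r, c). if r = (?h \<circ> p) c then 1 else (0::complex))
        = mat M M (\<lambda>(r, c). if r div n = c div n then
                      (\<lambda>b r c. if r = s (L b ! c) then 1 else 0) (r div n) (r mod n) (c mod n) else 0)"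
    proof (rule eq_matI, goal_cases)
      case (1 r c)
      then have r: "r < M" and c: "c < M" by auto
      have eq: "(?h \<circ> p) c = (c div n) * n + s (L (c div n) ! (c mod n))"
        using pM(2)[OF c] c by (simp add: p_def)
      have "s (L (c div n) ! (c mod n)) < n" using s memL dk[OF c] by blast
      then have "r = (?h \<circ> p) c \<longleftrightarrow> r div n = c div n \<and> r mod n = s (L (c div n) ! (c mod n))"
        unfolding eq using n by (rule pair_code_eq_iff)
      then show ?case using r c by (simp del: o_apply)
    qed auto
    also have "det \<dots> = (\<Prod>b<k. det (mat n n (\<lambda>(r, c). if r = s (L b ! c) then 1 else 0)))"
      unfolding M_def by (rule det_block_diag[OF n])
    also have "\<dots> = (\<Prod>b<k. of_int (tuple_sgn n (map s (L b))))"
    proof (intro prod.cong refl)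
      fix b assume "b \<in> {..<k}"
      then have b: "b < k" by simp
      have "of_int (tuple_sgn n (map s (L b))) = map_sgn n ((!) (map s (L b)))"
        using L[OF b] by (simp add: tuple_sgn_eq_map_sgn)
      also have "\<dots> = map_sgn n (\<lambda>c. s (L b ! c))"
        using L[OF b] by (intro map_sgn_cong) simp
      also have "\<dots> = det (mat n n (\<lambda>(r, c). if r = s (L b ! c) then 1 else 0))"
        using s memL[OF b] by (intro map_sgn_eq_det) blast
      finally show "det (mat n n (\<lambda>(r, c). if r = s (L b ! c) then 1 else 0))
          = (of_int (tuple_sgn n (map s (L b))) :: complex)" by simp
    qed
    also have "\<dots> = of_int (row_sgn n T i s)"
      using n by (simp add: row_sgn_def len L_def M_def)
    finally show ?thesis by simp
  qed
  then show ?thesis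
    using that[of "of_int (sign p)"] sign_nz unfolding M_def by force
qed

section \<open>Multilinear invariants of the special linear group\<close>

text \<open>c lists the values of a multilinear form on M-tuples of basis vectors. The sum is the
  value of the form at the columns s j of g, so the condition is invariance under substituting
  g.\<close>

definition sl_invariant :: "nat \<Rightarrow> nat \<Rightarrow> ((nat \<Rightarrow> nat) \<Rightarrow> complex) \<Rightarrow> bool" where
  "sl_invariant n M c \<longleftrightarrow>
     (\<forall>g\<in>SL n. \<forall>s\<in>Maps M n. (\<Sum>s'\<in>Maps M n. c s' * (\<Prod>j<M. g $$ (s' j, s j))) = c s)"

text \<open>If z ^ n = det g, then g / z lies in SL; scaling back in M = n * k slots costs z ^ M =
  det g ^ k.\<close>

lemma sl_invariant_det_nonzero:
  assumes n: "n > 0" and M: "M = n * k" and c: "sl_invariant n M c"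
    and g: "g \<in> carrier_mat n n" and s: "s \<in> Maps M n" and nz: "det g \<noteq> 0"
  shows "(\<Sum>s'\<in>Maps M n. c s' * (\<Prod>j<M. g $$ (s' j, s j))) = det g ^ k * c s"
proof -
  have "{z. z ^ n = det g} \<noteq> {}" using card_nth_roots[OF nz n] n by force
  then obtain z where z: "z ^ n = det g" by auto
  have z0: "z \<noteq> 0" using z nz n by (auto simp: zero_power)
  define h where "h = (1 / z) \<cdot>\<^sub>m g"
  have "h \<in> SL n" using g z z0 nz by (simp add: SL_def h_def power_one_over)
  then have "c s = (\<Sum>s'\<in>Maps M n. c s' * (\<Prod>j<M. h $$ (s' j, s j)))"
    using c s by (simp add: sl_invariant_def)
  also have "\<dots> = (\<Sum>s'\<in>Maps M n. c s' * ((1 / z) ^ M * (\<Prod>j<M. g $$ (s' j, s j))))"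
  proof (intro sum.cong refl arg_cong2[where f = "(*)"])
    fix s' assume s': "s' \<in> Maps M n"
    have "(\<Prod>j<M. h $$ (s' j, s j)) = (\<Prod>j<M. (1 / z) * g $$ (s' j, s j))"
      using s s' g by (intro prod.cong) (auto simp: h_def PiE_iff)
    then show "(\<Prod>j<M. h $$ (s' j, s j)) = (1 / z) ^ M * (\<Prod>j<M. g $$ (s' j, s j))"
      by (simp only: prod.distrib) simp
  qed
  also have "\<dots> = (1 / z) ^ M * (\<Sum>s'\<in>Maps M n. c s' * (\<Prod>j<M. g $$ (s' j, s j)))"
    by (simp add: sum_distrib_left mult_ac)
  finally have "z ^ M * c s = (\<Sum>s'\<in>Maps M n. c s' * (\<Prod>j<M. g $$ (s' j, s j)))"
    using z0 by (simp add: power_one_over)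
  moreover have "z ^ M = det g ^ k" by (simp add: M power_mult z)
  ultimately show ?thesis by simp
qed

text \<open>Singular matrices are reached through \<open>g + x \<cdot> 1\<close>, which is singular for finitely many \<open>x\<close> only.\<close>

lemma sl_invariant_det:
  assumes n: "n > 0" and M: "M = n * k" and c: "sl_invariant n M c"
    and g: "g \<in> carrier_mat n n" and s: "s \<in> Maps M n"
  shows "(\<Sum>s'\<in>Maps M n. c s' * (\<Prod>j<M. g $$ (s' j, s j))) = det g ^ k * c s"
proof -
  define E where "E a b = [: g $$ (a, b), if a = b then 1 else 0 :]" for a b
  define D where "D = det (mat n n (\<lambda>(a, b). E a b))"
  define q where "q = (\<Sum>s'\<in>Maps M n. smult (c s') (\<Prod>j<M. E (s' j) (s j))) - smult (c s) (D ^ k)"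
  define gx where "gx x = mat n n (\<lambda>(a, b). poly (E a b) x)" for x
  have detx: "poly D x = det (gx x)" for x
    unfolding D_def by (rule poly_det_cong[of _ n]) (auto simp: gx_def)
  \<comment> \<open>D is the determinant of g + x * 1 as a polynomial in x, hence monic and
    nonzero.\<close>
  have "D = char_poly (- g)"
    unfolding D_def char_poly_def using g
    by (intro arg_cong[where f = det] eq_matI) (auto simp: char_poly_matrix_def E_def)
  then have D0: "D \<noteq> 0" using degree_monic_char_poly[of "- g" n] g by auto
  have qx: "poly q x = (\<Sum>s'\<in>Maps M n. c s' * (\<Prod>j<M. gx x $$ (s' j, s j))) - det (gx x) ^ k * c s" for x
  proof -
    have "(\<Prod>j<M. poly (E (s' j) (s j)) x) = (\<Prod>j<M. gx x $$ (s' j, s j))" if "s' \<in> Maps M n" for s'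
      using s that by (intro prod.cong) (auto simp: gx_def PiE_iff)
    then show ?thesis by (simp add: q_def poly_sum poly_prod detx mult.commute)
  qed
  \<comment> \<open>The factor D makes the identity true also where g + x * 1 is singular. As a
    nonzero polynomial it can be cancelled afterwards, and evaluation at x = 0 gives the
    claim.\<close>
  have "poly (q * D) x = 0" for x
  proof (cases "det (gx x) = 0")
    case True
    then show ?thesis by (simp add: detx)
  next
    case False
    have "gx x \<in> carrier_mat n n" by (simp add: gx_def)
    from sl_invariant_det_nonzero[OF n M c this s False] show ?thesis by (simp add: qx)
  qed
  then have "q * D = 0" using poly_all_0_iff_0 by blast
  then have "poly q 0 = 0" using D0 by simp
  moreover have "gx 0 = g" using g by (intro eq_matI) (auto simp: gx_def E_def)
  ultimately show ?thesis by (simp add: qx)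
qed

text \<open>Rewrites a sum with fixed column indices b as a form in the matrix entries x (a, b), the
  shape that \<open>polarization\<close> expects.\<close>

lemma sum_pairs_fixed_snd:
  fixes \<phi> :: "(nat \<Rightarrow> nat) \<Rightarrow> complex"
  assumes "b \<in> Maps M n"
  shows "(\<Sum>t\<in>{..<M} \<rightarrow>\<^sub>E {..<n} \<times> {..<n}.
            (if restrict (snd \<circ> t) {..<M} = b then \<phi> (restrict (fst \<circ> t) {..<M}) else 0) * (\<Prod>j<M. x (t j)))
       = (\<Sum>a\<in>Maps M n. \<phi> a * (\<Prod>j<M. x (a j, b j)))" (is "?L = ?R")
proof -
  define P where "P t \<longleftrightarrow> restrict (snd \<circ> t) {..<M} = b" for t :: "nat \<Rightarrow> nat \<times> nat"
  define F where "F t = \<phi> (restrict (fst \<circ> t) {..<M}) * (\<Prod>j<M. x (t j))" for t :: "nat \<Rightarrow> nat \<times> nat"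
  define I where "I = {..<M} \<rightarrow>\<^sub>E {..<n} \<times> {..<n}"
  have fin: "finite I" unfolding I_def by (intro finite_PiE) auto
  have IF: "(if restrict (snd \<circ> t) {..<M} = b then \<phi> (restrict (fst \<circ> t) {..<M}) else 0) * (\<Prod>j<M. x (t j))
      = (if P t then F t else 0)" for t
    by (simp add: P_def F_def)
  have "(\<Sum>t\<in>{t \<in> I. P t}. F t) = ?R"
  proof (rule sum.reindex_bij_witness[of _ "\<lambda>a. \<lambda>j\<in>{..<M}. (a j, b j)" "\<lambda>t. restrict (fst \<circ> t) {..<M}"])
    fix t assume "t \<in> {t \<in> I. P t}"
    then have t: "t \<in> I" and P: "restrict (snd \<circ> t) {..<M} = b" by (simp_all add: P_def)
    have b: "b j = snd (t j)" if "j < M" for j using that P[symmetric] by simp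
    show "(\<lambda>j\<in>{..<M}. (restrict (fst \<circ> t) {..<M} j, b j)) = t"
      using t b by (auto simp: I_def fun_eq_iff restrict_def PiE_iff extensional_def)
    show "restrict (fst \<circ> t) {..<M} \<in> Maps M n" using t by (auto simp: I_def PiE_iff mem_Times_iff)
    have "(\<Prod>j<M. x (restrict (fst \<circ> t) {..<M} j, b j)) = (\<Prod>j<M. x (t j))"
      using b by (intro prod.cong) auto
    then show "\<phi> (restrict (fst \<circ> t) {..<M}) * (\<Prod>j<M. x (restrict (fst \<circ> t) {..<M} j, b j)) = F t"
      by (simp only: F_def)
  next
    fix a assume a: "a \<in> Maps M n"
    show "restrict (fst \<circ> (\<lambda>j\<in>{..<M}. (a j, b j))) {..<M} = a"
      using a by (auto simp: fun_eq_iff restrict_def PiE_iff extensional_def)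
    show "(\<lambda>j\<in>{..<M}. (a j, b j)) \<in> {t \<in> I. P t}"
      using a assms by (auto simp: I_def P_def fun_eq_iff restrict_def PiE_iff extensional_def)
  qed
  then show ?thesis
    unfolding IF I_def[symmetric] sum.inter_filter[OF fin] .
qed

lemma map_sgn_in_Reals: "map_sgn M h \<in> \<real>"
  by (simp add: map_sgn_def)

text \<open>
  Polarizing \<open>\<Sum>\<^sub>a c a \<cdot> \<Prod>\<^sub>j g (a j, s j) = det g ^ k \<cdot> c s\<close>, where \<open>det g ^ k\<close> is written in the same
  form with \<open>eps \<cdot> \<tau>\<close> for \<open>c\<close> and \<open>\<rho>\<close> for \<open>s\<close>, and pairing with \<open>eps \<cdot> \<tau>\<close> expresses \<open>N \<cdot> c s\<close> through the pairings
  of \<open>c\<close>; here \<open>N\<close> is, up to a positive factor, the squared norm of the average of \<open>eps \<cdot> \<tau>\<close> over the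
  stabilizer of \<open>\<rho>\<close>.
\<close>

theorem sl_invariant_eq_0:
  assumes n: "n > 0" and M: "M = n * k" and c: "sl_invariant n M c"
    and ortho: "\<And>t. t \<in> Maps M k \<Longrightarrow> (\<Sum>a\<in>Maps M n. c a * eps n M a t) = 0"
    and s: "s \<in> Maps M n"
  shows "c s = 0"
proof -
  \<comment> \<open>Since j = \<tau> j * n + \<rho> j, the pair map of \<rho> and \<tau> is the
    identity. Hence w \<rho> = 1, and \<open>eps_transform\<close> at s = \<rho> expresses det g ^ k
    itself.\<close>
  define \<rho> where "\<rho> = (\<lambda>j\<in>{..<M}. j mod n)"
  define \<tau> where "\<tau> = (\<lambda>j\<in>{..<M}. j div n)"
  define w where "w a = eps n M a \<tau>" for a
  define S where "S = {\<pi>. \<pi> permutes {..<M}}"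
  define H where "H = {\<pi> \<in> S. \<rho> \<circ> \<pi> = \<rho>}"
  \<comment> \<open>K is empty unless s takes every value k times. The argument covers that case as
    well and then yields c s = 0 directly.\<close>
  define K where "K = {\<pi> \<in> S. \<rho> \<circ> \<pi> = s}"
  have \<rho>: "\<rho> \<in> Maps M n" using n by (auto simp: \<rho>_def)
  have \<tau>: "\<tau> \<in> Maps M k" by (auto simp: \<tau>_def M less_mult_imp_div_less mult.commute)
  have "w \<rho> = map_sgn M id"
    unfolding w_def eps_def by (intro map_sgn_cong) (simp add: \<rho>_def \<tau>_def)
  then have w\<rho>: "w \<rho> = 1" using map_sgn_permutes[OF permutes_id, of M] by simp
  have finS: "finite S" unfolding S_def by (simp add: finite_permutations)
  then have fin: "finite H" "finite K" by (auto simp: H_def K_def)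
  have S_inv: "Hilbert_Choice.inv \<pi> \<in> S" "\<pi> \<circ> Hilbert_Choice.inv \<pi> = id" "Hilbert_Choice.inv \<pi> \<circ> \<pi> = id"
    if "\<pi> \<in> S" for \<pi>
    using that permutes_inv permutes_inv_o by (auto simp: S_def)
  have S_comp: "\<pi> \<circ> \<pi>' \<in> S" if "\<pi> \<in> S" "\<pi>' \<in> S" for \<pi> \<pi>'
    using that permutes_compose by (auto simp: S_def)
  have in_Maps: "a \<circ> \<pi> \<in> Maps M m" if "\<pi> \<in> S" "a \<in> Maps M m" for \<pi> a m
    using Maps_comp_permutes that by (simp add: S_def)
  have shift: "(\<Sum>a\<in>Maps M n. f (a \<circ> \<pi>)) = (\<Sum>a\<in>Maps M n. f a)" if "\<pi> \<in> S" for \<pi> and f :: "_ \<Rightarrow> complex"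
    using sum_Maps_comp_permutes that by (simp add: S_def)
  \<comment> \<open>Two expressions for det g ^ k * c s are compared as polynomials in the entries
    of g. Polarization at the pairs (a j, \<rho> j) sums over all their orderings; those whose
    second entries read s form K, those whose second entries read \<rho> form H.\<close>
  have polar: "(\<Sum>\<pi>\<in>K. c (a \<circ> \<pi>)) = c s * (\<Sum>\<pi>\<in>H. w (a \<circ> \<pi>))" if a: "a \<in> Maps M n" for a
  proof -
    let ?I = "{..<n} \<times> {..<n}"
    let ?f = "\<lambda>t. restrict (fst \<circ> t) {..<M}" and ?s = "\<lambda>t. restrict (snd \<circ> t) {..<M}"
    define C where "C t = (if ?s t = s then c (?f t) else 0) - c s * (if ?s t = \<rho> then w (?f t) else 0)" for t
    have zero: "(\<Sum>t\<in>{..<M} \<rightarrow>\<^sub>E ?I. C t * (\<Prod>j<M. x (t j))) = 0" for x :: "nat \<times> nat \<Rightarrow> complex"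
    proof -
      define g where "g = mat n n x"
      have g: "g \<in> carrier_mat n n" by (simp add: g_def)
      have gx: "(\<Prod>j<M. x (a j, b j)) = (\<Prod>j<M. g $$ (a j, b j))" if "a \<in> Maps M n" "b \<in> Maps M n" for a b
        using that by (intro prod.cong) (auto simp: g_def PiE_iff)
      have "(\<Sum>t\<in>{..<M} \<rightarrow>\<^sub>E ?I. C t * (\<Prod>j<M. x (t j)))
          = (\<Sum>t\<in>{..<M} \<rightarrow>\<^sub>E ?I. (if ?s t = s then c (?f t) else 0) * (\<Prod>j<M. x (t j)))
          - c s * (\<Sum>t\<in>{..<M} \<rightarrow>\<^sub>E ?I. (if ?s t = \<rho> then w (?f t) else 0) * (\<Prod>j<M. x (t j)))"
        unfolding C_def left_diff_distrib sum_subtractf sum_distrib_left by (simp only: mult.assoc)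
      also have "\<dots> = (\<Sum>a\<in>Maps M n. c a * (\<Prod>j<M. g $$ (a j, s j)))
          - c s * (\<Sum>a\<in>Maps M n. w a * (\<Prod>j<M. g $$ (a j, \<rho> j)))"
        unfolding sum_pairs_fixed_snd[OF s] sum_pairs_fixed_snd[OF \<rho>]
        using gx[OF _ s] gx[OF _ \<rho>] by (simp cong: sum.cong)
      also have "\<dots> = 0"
        using sl_invariant_det[OF n M c g s] eps_transform[OF n M g, of \<rho> \<tau>] \<rho> \<tau> w\<rho>
        by (simp add: w_def PiE_iff)
      finally show ?thesis .
    qed
    define t where "t = (\<lambda>j\<in>{..<M}. (a j, \<rho> j))"
    have t: "t \<in> {..<M} \<rightarrow>\<^sub>E ?I" using a \<rho> by (auto simp: t_def)
    have "C (t \<circ> \<pi>) = (if \<rho> \<circ> \<pi> = s then c (a \<circ> \<pi>) else 0) - c s * (if \<rho> \<circ> \<pi> = \<rho> then w (a \<circ> \<pi>) else 0)"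
      if "\<pi> \<in> S" for \<pi>
    proof -
      have "\<pi> j < M" if "j < M" for j
        using \<open>\<pi> \<in> S\<close> that permutes_in_image[of \<pi> "{..<M}" j] by (simp add: S_def)
      then have "?f (t \<circ> \<pi>) = a \<circ> \<pi>" "?s (t \<circ> \<pi>) = \<rho> \<circ> \<pi>"
        using in_Maps[OF that a] in_Maps[OF that \<rho>]
        by (auto simp: fun_eq_iff restrict_def t_def PiE_iff extensional_def)
      then show ?thesis by (simp only: C_def)
    qed
    then have "(\<Sum>\<pi>\<in>S. C (t \<circ> \<pi>))
        = (\<Sum>\<pi>\<in>S. if \<rho> \<circ> \<pi> = s then c (a \<circ> \<pi>) else 0) - c s * (\<Sum>\<pi>\<in>S. if \<rho> \<circ> \<pi> = \<rho> then w (a \<circ> \<pi>) else 0)"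
      by (simp add: sum_subtractf sum_distrib_left del: o_apply cong: sum.cong)
    also have "\<dots> = (\<Sum>\<pi>\<in>K. c (a \<circ> \<pi>)) - c s * (\<Sum>\<pi>\<in>H. w (a \<circ> \<pi>))"
      unfolding K_def H_def by (simp only: sum.inter_filter[OF finS])
    finally show ?thesis
      using polarization[OF _ zero t] by (simp add: S_def)
  qed
  define v where "v a = (\<Sum>\<pi>\<in>H. w (a \<circ> \<pi>))" for a
  \<comment> \<open>Replacing a by a composed with the inverse of \<pi> moves \<pi> from c to
    \<tau>. Up to sign this leaves a pairing of c with \<open>eps\<close>, which vanishes by
    \<open>ortho\<close>.\<close>
  have lhs: "(\<Sum>a\<in>Maps M n. c (a \<circ> \<pi>) * w a) = 0" if \<pi>: "\<pi> \<in> S" for \<pi>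
  proof -
    let ?i = "Hilbert_Choice.inv \<pi>"
    have w_inv: "w (a \<circ> ?i) = of_int (sign ?i) * eps n M a (\<tau> \<circ> \<pi>)" for a
    proof -
      have "\<tau> = (\<tau> \<circ> \<pi>) \<circ> ?i" unfolding comp_assoc S_inv(2)[OF \<pi>] by simp
      then show ?thesis
        using eps_comp_permutes[of ?i M n a "\<tau> \<circ> \<pi>"] S_inv(1)[OF \<pi>] by (simp add: w_def S_def)
    qed
    have "(\<Sum>a\<in>Maps M n. c (a \<circ> \<pi>) * w a) = (\<Sum>a\<in>Maps M n. c (a \<circ> \<pi>) * w (a \<circ> \<pi> \<circ> ?i))"
      unfolding comp_assoc S_inv(2)[OF \<pi>] by simp
    also have "\<dots> = (\<Sum>a\<in>Maps M n. c a * w (a \<circ> ?i))"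
      by (rule shift[OF \<pi>])
    also have "\<dots> = of_int (sign ?i) * (\<Sum>a\<in>Maps M n. c a * eps n M a (\<tau> \<circ> \<pi>))"
      unfolding w_inv sum_distrib_left by (simp only: mult_ac)
    also have "\<dots> = 0" unfolding ortho[OF in_Maps[OF \<pi> \<tau>]] by simp
    finally show ?thesis .
  qed
  have "c s * (\<Sum>a\<in>Maps M n. v a * w a) = (\<Sum>a\<in>Maps M n. (c s * v a) * w a)"
    by (simp add: sum_distrib_left mult.assoc)
  also have "\<dots> = (\<Sum>a\<in>Maps M n. \<Sum>\<pi>\<in>K. c (a \<circ> \<pi>) * w a)"
    unfolding v_def by (intro sum.cong refl) (simp only: polar[symmetric] sum_distrib_right)
  also have "\<dots> = (\<Sum>\<pi>\<in>K. \<Sum>a\<in>Maps M n. c (a \<circ> \<pi>) * w a)"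
    by (rule sum.swap)
  also have "\<dots> = 0"
    by (rule sum.neutral) (use lhs in \<open>auto simp: K_def\<close>)
  finally have N: "c s * (\<Sum>a\<in>Maps M n. v a * w a) = 0" .
  have H_sub: "\<pi> \<in> S" "\<rho> \<circ> \<pi> = \<rho>" if "\<pi> \<in> H" for \<pi> using that by (auto simp: H_def)
  have H_inv: "Hilbert_Choice.inv \<pi> \<in> H" if "\<pi> \<in> H" for \<pi>
  proof -
    have "\<rho> = \<rho> \<circ> \<pi> \<circ> Hilbert_Choice.inv \<pi>"
      unfolding comp_assoc S_inv(2)[OF H_sub(1)[OF that]] by simp
    then show ?thesis using S_inv(1) that unfolding H_def by simp
  qed
  have H_comp: "\<pi> \<circ> \<pi>' \<in> H" if "\<pi> \<in> H" "\<pi>' \<in> H" for \<pi> \<pi>'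
  proof -
    have "\<rho> \<circ> (\<pi> \<circ> \<pi>') = \<rho>"
      by (simp only: comp_assoc[symmetric] H_sub(2)[OF that(1)] H_sub(2)[OF that(2)])
    then show ?thesis
      unfolding H_def using S_comp[OF H_sub(1)[OF that(1)] H_sub(1)[OF that(2)]] by blast
  qed
  have v_inv: "v (a \<circ> \<pi>) = v a" if "\<pi> \<in> H" for a \<pi>
    unfolding v_def
  proof (rule sum.reindex_bij_witness[of _ "\<lambda>\<pi>'. Hilbert_Choice.inv \<pi> \<circ> \<pi>'" "\<lambda>\<pi>'. \<pi> \<circ> \<pi>'"])
    fix \<pi>' assume "\<pi>' \<in> H"
    show "Hilbert_Choice.inv \<pi> \<circ> (\<pi> \<circ> \<pi>') = \<pi>'" "\<pi> \<circ> (Hilbert_Choice.inv \<pi> \<circ> \<pi>') = \<pi>'"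
      unfolding comp_assoc[symmetric] using S_inv[OF H_sub(1)[OF that]] by simp_all
    show "\<pi> \<circ> \<pi>' \<in> H" "Hilbert_Choice.inv \<pi> \<circ> \<pi>' \<in> H"
      using H_comp H_inv that \<open>\<pi>' \<in> H\<close> by blast+
    show "w (a \<circ> (\<pi> \<circ> \<pi>')) = w (a \<circ> \<pi> \<circ> \<pi>')" by (simp only: comp_assoc)
  qed
  \<comment> \<open>By invariance of v under H, each of the \<open>card H\<close> terms in the
    second factor contributes the same amount.\<close>
  have norm: "(\<Sum>a\<in>Maps M n. v a * v a) = of_nat (card H) * (\<Sum>a\<in>Maps M n. v a * w a)"
  proof -
    have "(\<Sum>a\<in>Maps M n. v a * v a) = (\<Sum>\<pi>\<in>H. \<Sum>a\<in>Maps M n. v a * w (a \<circ> \<pi>))"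
      by (subst sum.swap) (simp add: v_def sum_distrib_left)
    also have "\<dots> = (\<Sum>\<pi>\<in>H. \<Sum>a\<in>Maps M n. v (a \<circ> \<pi>) * w (a \<circ> \<pi>))"
      by (intro sum.cong refl) (simp only: v_inv)
    also have "\<dots> = (\<Sum>\<pi>\<in>H. \<Sum>a\<in>Maps M n. v a * w a)"
      by (intro sum.cong refl shift H_sub)
    finally show ?thesis by simp
  qed
  have "id \<in> H" by (auto simp: H_def S_def permutes_id)
  then have card: "card H > 0" using fin by (auto simp: card_gt_0_iff)
  have "v a \<in> \<real>" for a by (auto simp: v_def w_def eps_def map_sgn_in_Reals intro!: sum_in_Reals)
  then have vr: "v a = of_real (Re (v a))" for a by (simp add: complex_is_Real_iff complex_eq_iff)
  \<comment> \<open>H fixes \<rho> and w \<rho> = 1. As v is real, the sum of its squares is then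
    positive.\<close>
  have "v \<rho> = of_nat (card H)"
    unfolding v_def using H_sub(2) w\<rho> by (simp del: o_apply)
  then have "Re (v \<rho>) \<noteq> 0" using card by simp
  moreover have "(\<Sum>a\<in>Maps M n. v a * v a) = of_real (\<Sum>a\<in>Maps M n. Re (v a) * Re (v a))"
    unfolding of_real_sum of_real_mult by (simp only: vr[symmetric])
  moreover have "(\<Sum>a\<in>Maps M n. Re (v a) * Re (v a)) \<ge> Re (v \<rho>) * Re (v \<rho>)"
    using \<rho> by (intro member_le_sum) auto
  ultimately have "(\<Sum>a\<in>Maps M n. v a * v a) \<noteq> 0"
    by (metis not_real_square_gt_zero of_real_eq_0_iff order.strict_iff_not order_refl)
  then show ?thesis using N norm by auto
qed

section \<open>Forms with several rows of indices\<close>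

abbreviation Tables :: "nat \<Rightarrow> nat \<Rightarrow> nat \<Rightarrow> (nat \<Rightarrow> nat \<Rightarrow> nat) set" where
  "Tables d M n \<equiv> {..<d} \<rightarrow>\<^sub>E Maps M n"

lemma finite_Tables [simp]: "finite (Tables d M n)"
  by (intro finite_PiE) auto

lemma finite_multi_idx [simp]: "finite (multi_idx n d)"
  using finite_lists_length_eq[of "{..<n}" d] by (simp add: multi_idx_def conj_commute)

lemma card_multi_idx: "card (multi_idx n d) = n ^ d"
  using card_lists_length_eq[of "{..<n}" d] by (simp add: multi_idx_def conj_commute)

text \<open>A table is seen in two ways: its rows are the tensor factors on which the groups act,
  its columns are the indices of the variables in a monomial.\<close>

definition columns :: "nat \<Rightarrow> nat \<Rightarrow> (nat \<Rightarrow> nat \<Rightarrow> nat) \<Rightarrow> nat \<Rightarrow> nat list" where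
  "columns d M s = (\<lambda>j\<in>{..<M}. map (\<lambda>i. s i j) [0..<d])"

definition table_of :: "nat \<Rightarrow> nat \<Rightarrow> (nat \<Rightarrow> nat list) \<Rightarrow> nat \<Rightarrow> nat \<Rightarrow> nat" where
  "table_of d M t = (\<lambda>i\<in>{..<d}. \<lambda>j\<in>{..<M}. t j ! i)"

lemma TablesD:
  assumes "s \<in> Tables d M n"
  shows "i < d \<Longrightarrow> s i \<in> Maps M n" and "i < d \<Longrightarrow> j < M \<Longrightarrow> s i j < n"
    and "\<not> i < d \<Longrightarrow> s i = undefined" and "i < d \<Longrightarrow> \<not> j < M \<Longrightarrow> s i j = undefined"
proof -
  show *: "s i \<in> Maps M n" if "i < d" for i using PiE_mem[OF assms, of i] that by simp
  show "s i j < n" if "i < d" "j < M" for i j using PiE_mem[OF *[OF that(1)], of j] that by simp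
  show "s i = undefined" if "\<not> i < d" for i using PiE_arb[OF assms, of i] that by simp
  show "s i j = undefined" if "i < d" "\<not> j < M" for i j
    using PiE_arb[OF *[OF that(1)], of j] that by simp
qed

lemma Tables_eqI:
  assumes "s \<in> Tables d M n" and "s' \<in> Tables d M n'"
    and "\<And>i j. i < d \<Longrightarrow> j < M \<Longrightarrow> s i j = s' i j"
  shows "s = s'"
proof (intro ext)
  fix i j
  show "s i j = s' i j"
    using TablesD(3,4)[OF assms(1)] TablesD(3,4)[OF assms(2)] assms(3)
    by (cases "i < d"; cases "j < M") simp_all
qed

lemma TablesI:
  assumes "\<And>i j. i < d \<Longrightarrow> j < M \<Longrightarrow> f i j < n"
  shows "(\<lambda>i\<in>{..<d}. \<lambda>j\<in>{..<M}. f i j) \<in> Tables d M n"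
  using assms by simp

lemma columns_in: "s \<in> Tables d M n \<Longrightarrow> columns d M s \<in> {..<M} \<rightarrow>\<^sub>E multi_idx n d"
  using TablesD(2)[of s d M n] by (auto simp: columns_def multi_idx_def)

lemma multi_idx_nth: "I \<in> multi_idx n d \<Longrightarrow> i < d \<Longrightarrow> I ! i < n"
  unfolding multi_idx_def using nth_mem by fastforce

lemma table_of_in:
  assumes "t \<in> {..<M} \<rightarrow>\<^sub>E multi_idx n d"
  shows "table_of d M t \<in> Tables d M n"
  unfolding table_of_def
proof (rule TablesI)
  fix i j assume "i < d" "j < M"
  then show "t j ! i < n" using multi_idx_nth PiE_mem[OF assms, of j] by simp
qed

lemma table_of_columns:
  assumes "s \<in> Tables d M n"
  shows "table_of d M (columns d M s) = s"
  by (rule Tables_eqI[OF table_of_in[OF columns_in[OF assms]] assms]) (simp add: table_of_def columns_def)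

lemma columns_table_of:
  assumes "t \<in> {..<M} \<rightarrow>\<^sub>E multi_idx n d"
  shows "columns d M (table_of d M t) = t"
proof (rule PiE_ext[OF columns_in[OF table_of_in[OF assms]] assms])
  fix j assume j: "j \<in> {..<M}"
  have "length (t j) = d" using PiE_mem[OF assms j] by (simp add: multi_idx_def)
  then show "columns d M (table_of d M t) j = t j"
    using j by (intro nth_equalityI) (simp_all add: columns_def table_of_def)
qed

lemma bij_columns: "bij_betw (columns d M) (Tables d M n) ({..<M} \<rightarrow>\<^sub>E multi_idx n d)"
  by (rule bij_betw_byWitness[where f' = "table_of d M"])
    (intro ballI image_subsetI table_of_columns columns_table_of columns_in table_of_in, assumption)+

text \<open>Coefficients are indexed by ordered tuples of columns instead of monomials, so that the
  rows can be treated as independent tensor factors. The price is that c is determined by the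
  polynomial only after symmetrization over the order of the columns.\<close>

definition form :: "nat \<Rightarrow> nat \<Rightarrow> nat \<Rightarrow> ((nat \<Rightarrow> nat \<Rightarrow> nat) \<Rightarrow> complex) \<Rightarrow> hypermatrix \<Rightarrow> complex" where
  "form n d M c X = (\<Sum>s\<in>Tables d M n. c s * (\<Prod>j<M. X (columns d M s j)))"

lemma form_eq_sum_columns:
  "form n d M c X = (\<Sum>t\<in>{..<M} \<rightarrow>\<^sub>E multi_idx n d. c (table_of d M t) * (\<Prod>j<M. X (t j)))"
  unfolding form_def
  by (subst sum.reindex_bij_betw[OF bij_columns, symmetric])
    (rule sum.cong[OF refl], simp only: table_of_columns)

lemma form_cong: "(\<And>s. s \<in> Tables d M n \<Longrightarrow> c s = c' s) \<Longrightarrow> form n d M c = form n d M c'"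
  by (simp add: form_def fun_eq_iff)

lemma form_diff: "form n d M (\<lambda>s. c s - c' s) X = form n d M c X - form n d M c' X"
  by (simp add: form_def left_diff_distrib sum_subtractf)

lemma form_scale: "form n d M (\<lambda>s. a * c s) X = a * form n d M c X"
  by (simp add: form_def sum_distrib_left mult.assoc)

definition permute_columns :: "nat \<Rightarrow> (nat \<Rightarrow> nat) \<Rightarrow> (nat \<Rightarrow> nat \<Rightarrow> nat) \<Rightarrow> nat \<Rightarrow> nat \<Rightarrow> nat" where
  "permute_columns d \<pi> s = (\<lambda>i\<in>{..<d}. s i \<circ> \<pi>)"

lemma permute_columns_in:
  assumes "\<pi> permutes {..<M}" "s \<in> Tables d M n"
  shows "permute_columns d \<pi> s \<in> Tables d M n"
proof (rule PiE_I)
  fix i assume "i \<in> {..<d}"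
  then have "s i \<circ> \<pi> \<in> Maps M n"
    using Maps_comp_permutes[OF assms(1) TablesD(1)[OF assms(2)]] by blast
  with \<open>i \<in> {..<d}\<close> show "permute_columns d \<pi> s i \<in> Maps M n"
    by (simp only: permute_columns_def restrict_apply if_True)
qed (simp add: permute_columns_def)

lemma table_of_comp:
  assumes "\<pi> permutes {..<M}" "t \<in> {..<M} \<rightarrow>\<^sub>E multi_idx n d"
  shows "table_of d M (t \<circ> \<pi>) = permute_columns d \<pi> (table_of d M t)"
  using permutes_in_image[OF assms(1)]
  by (intro Tables_eqI[OF table_of_in[OF Maps_comp_permutes[OF assms]] permute_columns_in[OF assms(1) table_of_in[OF assms(2)]]])
    (simp add: table_of_def permute_columns_def)

lemma sum_permute_columns:
  assumes "\<pi> permutes {..<M}"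
  shows "(\<Sum>s\<in>Tables d M n. f (permute_columns d \<pi> s)) = (\<Sum>s\<in>Tables d M n. f s)"
proof -
  have "(\<Sum>s\<in>Tables d M n. f (permute_columns d \<pi> s))
      = (\<Sum>t\<in>{..<M} \<rightarrow>\<^sub>E multi_idx n d. f (permute_columns d \<pi> (table_of d M t)))"
    by (subst sum.reindex_bij_betw[OF bij_columns, symmetric])
      (rule sum.cong[OF refl], simp only: table_of_columns)
  also have "\<dots> = (\<Sum>t\<in>{..<M} \<rightarrow>\<^sub>E multi_idx n d. f (table_of d M (t \<circ> \<pi>)))"
    by (rule sum.cong[OF refl]) (simp only: table_of_comp[OF assms])
  also have "\<dots> = (\<Sum>t\<in>{..<M} \<rightarrow>\<^sub>E multi_idx n d. f (table_of d M t))"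
    by (rule sum_Maps_comp_permutes[OF assms])
  also have "\<dots> = (\<Sum>s\<in>Tables d M n. f s)"
    by (subst sum.reindex_bij_betw[OF bij_columns, symmetric])
      (rule sum.cong[OF refl], simp only: table_of_columns)
  finally show ?thesis .
qed

definition symmetric_coeff :: "nat \<Rightarrow> nat \<Rightarrow> nat \<Rightarrow> ((nat \<Rightarrow> nat \<Rightarrow> nat) \<Rightarrow> complex) \<Rightarrow> bool" where
  "symmetric_coeff n d M c \<longleftrightarrow>
     (\<forall>\<pi> s. \<pi> permutes {..<M} \<longrightarrow> s \<in> Tables d M n \<longrightarrow> c (permute_columns d \<pi> s) = c s)"

text \<open>Polarization in the variables X I makes the sum of c over all orders of the columns
  vanish, and by symmetry this sum is a positive multiple of c s.\<close>

lemma form_eq_0_imp: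
  assumes "symmetric_coeff n d M c" and "\<And>X. form n d M c X = 0" and "s \<in> Tables d M n"
  shows "c s = 0"
proof -
  have "c (table_of d M (columns d M s)) = 0"
  proof (rule polarization_symmetric[where I = "multi_idx n d" and M = M and C = "\<lambda>t. c (table_of d M t)"])
    fix \<pi> t assume "\<pi> permutes {..<M}" "t \<in> {..<M} \<rightarrow>\<^sub>E multi_idx n d"
    then show "c (table_of d M (t \<circ> \<pi>)) = c (table_of d M t)"
      using assms(1) table_of_in unfolding symmetric_coeff_def by (simp only: table_of_comp)
  qed (use assms(2) columns_in[OF assms(3)] in \<open>simp_all add: form_eq_sum_columns[symmetric]\<close>)
  then show ?thesis by (simp only: table_of_columns[OF assms(3)])
qed

section \<open>Homogeneous polynomials as forms\<close>

text \<open>Numbering the disjoint union of the sets \<open>{..<e i}\<close> lists every i with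
  multiplicity e i.\<close>

lemma ex_map_with_fibres:
  fixes e :: "'i \<Rightarrow> nat"
  assumes "finite I" and "(\<Sum>i\<in>I. e i) = M"
  obtains t where "t \<in> {..<M} \<rightarrow>\<^sub>E I"
    and "\<And>X :: 'i \<Rightarrow> complex. (\<Prod>j<M. X (t j)) = (\<Prod>i\<in>I. X i ^ e i)"
proof -
  define A where "A = (SIGMA i:I. {..<e i})"
  have "finite A" "card A = M" using assms by (auto simp: A_def)
  then obtain h where h: "bij_betw h {..<M} A"
    using ex_bij_betw_nat_finite[of A] by (auto simp: lessThan_atLeast0)
  define t where "t = (\<lambda>j\<in>{..<M}. fst (h j))"
  have "t \<in> {..<M} \<rightarrow>\<^sub>E I"
  proof -
    have "fst (h j) \<in> I" if "j < M" for j
      using bij_betwE[OF h, rule_format, of j] that by (cases "h j") (simp add: A_def)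
    then show ?thesis by (simp add: t_def)
  qed
  moreover have "(\<Prod>j<M. X (t j)) = (\<Prod>i\<in>I. X i ^ e i)" for X :: "'i \<Rightarrow> complex"
  proof -
    have "(\<Prod>j<M. X (t j)) = (\<Prod>j<M. X (fst (h j)))" by (simp add: t_def)
    also have "\<dots> = (\<Prod>p\<in>A. X (fst p))" by (rule prod.reindex_bij_betw[OF h])
    also have "\<dots> = (\<Prod>i\<in>I. \<Prod>l<e i. X i)"
      unfolding A_def using assms(1) by (subst prod.Sigma) (auto simp: case_prod_beta)
    finally show ?thesis by simp
  qed
  ultimately show ?thesis using that by blast
qed

lemma finite_exponents: "finite (exponents n d m)"
  by (rule finite_subset[of _ "multi_idx n d \<rightarrow>\<^sub>E {..m}"]) (auto simp: exponents_def intro!: finite_PiE)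

text \<open>Each monomial is written as one chosen tuple of columns; averaging over the reorderings
  makes the coefficients symmetric and keeps the polynomial.\<close>

lemma homogeneous_poly_imp_form:
  assumes "homogeneous_poly n d M f"
  obtains c where "symmetric_coeff n d M c" and "f = form n d M c"
proof -
  let ?P = "{..<M} \<rightarrow>\<^sub>E multi_idx n d"
  let ?S = "{\<pi>. \<pi> permutes {..<M}}"
  obtain a where a: "\<And>X. f X = (\<Sum>e\<in>exponents n d M. a e * (\<Prod>I\<in>multi_idx n d. X I ^ e I))"
    using assms unfolding homogeneous_poly_def by blast
  have fin: "finite (exponents n d M)" "finite ?P"
    by (rule finite_exponents) (intro finite_PiE finite_lessThan finite_multi_idx)
  have "\<exists>t. t \<in> ?P \<and> (\<forall>X :: hypermatrix. (\<Prod>j<M. X (t j)) = (\<Prod>I\<in>multi_idx n d. X I ^ e I))"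
    if "e \<in> exponents n d M" for e
  proof -
    have "(\<Sum>I\<in>multi_idx n d. e I) = M" using that by (simp add: exponents_def)
    from ex_map_with_fibres[OF finite_multi_idx this] show ?thesis by (metis (full_types))
  qed
  then obtain t where tP: "\<And>e. e \<in> exponents n d M \<Longrightarrow> t e \<in> ?P"
    and tX: "\<And>e (X :: hypermatrix). e \<in> exponents n d M \<Longrightarrow> (\<Prod>j<M. X (t e j)) = (\<Prod>I\<in>multi_idx n d. X I ^ e I)"
    by metis
  define b where "b u = (\<Sum>e\<in>exponents n d M. if u = t e then a e else 0)" for u
  define b' where "b' u = (\<Sum>\<pi>\<in>?S. b (u \<circ> \<pi>)) / fact M" for u
  define c where "c s = b' (columns d M s)" for s
  have fb: "f X = (\<Sum>u\<in>?P. b u * (\<Prod>j<M. X (u j)))" for X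
  proof -
    have "(\<Sum>u\<in>?P. b u * (\<Prod>j<M. X (u j)))
        = (\<Sum>e\<in>exponents n d M. \<Sum>u\<in>?P. if u = t e then a e * (\<Prod>j<M. X (t e j)) else 0)"
      unfolding b_def sum_distrib_right
      by (subst sum.swap, intro sum.cong refl) simp
    also have "\<dots> = (\<Sum>e\<in>exponents n d M. a e * (\<Prod>j<M. X (t e j)))"
      using tP fin by (intro sum.cong refl) (simp add: sum.delta)
    also have "\<dots> = f X" unfolding a using tX by (intro sum.cong refl) simp
    finally show ?thesis by simp
  qed
  have fb': "f X = (\<Sum>u\<in>?P. b' u * (\<Prod>j<M. X (u j)))" for X
  proof -
    have shift: "(\<Sum>u\<in>?P. b (u \<circ> \<pi>) * (\<Prod>j<M. X (u j))) = f X" if "\<pi> \<in> ?S" for \<pi>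
    proof -
      have \<pi>: "\<pi> permutes {..<M}" using that by simp
      have "(\<Prod>j<M. X (u j)) = (\<Prod>j<M. X ((u \<circ> \<pi>) j))" for u
        using prod.permute[OF \<pi>, of "\<lambda>j. X (u j)"] by (simp add: o_def)
      then have "(\<Sum>u\<in>?P. b (u \<circ> \<pi>) * (\<Prod>j<M. X (u j)))
          = (\<Sum>u\<in>?P. (\<lambda>u. b u * (\<Prod>j<M. X (u j))) (u \<circ> \<pi>))" by metis
      also have "\<dots> = (\<Sum>u\<in>?P. b u * (\<Prod>j<M. X (u j)))" by (rule sum_Maps_comp_permutes[OF \<pi>])
      also have "\<dots> = f X" by (simp only: fb)
      finally show ?thesis .
    qed
    have "(\<Sum>u\<in>?P. b' u * (\<Prod>j<M. X (u j)))
        = (\<Sum>u\<in>?P. \<Sum>\<pi>\<in>?S. b (u \<circ> \<pi>) * (\<Prod>j<M. X (u j))) / fact M"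
      by (simp add: b'_def sum_divide_distrib sum_distrib_right del: o_apply)
    also have "\<dots> = (\<Sum>\<pi>\<in>?S. \<Sum>u\<in>?P. b (u \<circ> \<pi>) * (\<Prod>j<M. X (u j))) / fact M"
      by (subst sum.swap) (rule refl)
    also have "\<dots> = (\<Sum>\<pi>\<in>?S. f X) / fact M"
      using shift by (simp del: o_apply)
    also have "\<dots> = f X" by (simp add: card_permutations[of "{..<M}" M])
    finally show ?thesis by simp
  qed
  have b'_sym: "b' (u \<circ> \<pi>) = b' u" if \<pi>: "\<pi> permutes {..<M}" for u \<pi>
  proof -
    have "(\<Sum>\<pi>'\<in>?S. b (u \<circ> \<pi> \<circ> \<pi>')) = (\<Sum>\<pi>'\<in>?S. b (u \<circ> \<pi>'))"
      using setum_permutations_compose_left[OF \<pi>, of "\<lambda>\<pi>'. b (u \<circ> \<pi>')"] by (simp add: comp_assoc)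
    then show ?thesis by (simp only: b'_def)
  qed
  have "form n d M c = f"
  proof
    fix X
    show "form n d M c X = f X"
      unfolding form_eq_sum_columns fb' c_def
      by (intro sum.cong refl) (simp only: columns_table_of)
  qed
  moreover have "symmetric_coeff n d M c"
    unfolding symmetric_coeff_def
  proof (intro allI impI)
    fix \<pi> s assume \<pi>: "\<pi> permutes {..<M}" and s: "s \<in> Tables d M n"
    have "permute_columns d \<pi> s = table_of d M (columns d M s \<circ> \<pi>)"
      using table_of_comp[OF \<pi> columns_in[OF s]] table_of_columns[OF s] by simp
    then have "columns d M (permute_columns d \<pi> s) = columns d M s \<circ> \<pi>"
      using columns_table_of[OF Maps_comp_permutes[OF \<pi> columns_in[OF s]]] by simp
    then show "c (permute_columns d \<pi> s) = c s" using b'_sym[OF \<pi>] by (simp only: c_def)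
  qed
  ultimately show ?thesis using that by blast
qed

lemma homogeneous_poly_form: "homogeneous_poly n d M (form n d M c)"
proof -
  let ?P = "{..<M} \<rightarrow>\<^sub>E multi_idx n d"
  define ex where "ex t = (\<lambda>I\<in>multi_idx n d. card {j. j < M \<and> t j = I})" for t :: "nat \<Rightarrow> nat list"
  have prodX: "(\<Prod>j<M. X (t j)) = (\<Prod>I\<in>multi_idx n d. X I ^ ex t I)" if "t \<in> ?P" for t and X :: hypermatrix
  proof -
    have "(\<Prod>j<M. X (t j)) = (\<Prod>I\<in>multi_idx n d. \<Prod>j\<in>{j\<in>{..<M}. t j = I}. X (t j))"
      using that by (subst prod.group) auto
    also have "\<dots> = (\<Prod>I\<in>multi_idx n d. X I ^ ex t I)"
      by (intro prod.cong refl) (simp add: ex_def)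
    finally show ?thesis .
  qed
  have exI: "ex t \<in> exponents n d M" if t: "t \<in> ?P" for t
  proof -
    have "(\<Sum>I\<in>multi_idx n d. \<Sum>j\<in>{j\<in>{..<M}. t j = I}. 1) = (\<Sum>j<M. (1::nat))"
      using t by (intro sum.group) auto
    then have "(\<Sum>I\<in>multi_idx n d. ex t I) = M" by (simp add: ex_def)
    moreover have "ex t I \<le> M" if "I \<in> multi_idx n d" for I
      using card_mono[of "{..<M}" "{j. j < M \<and> t j = I}"] that by (auto simp: ex_def)
    ultimately show ?thesis by (auto simp: exponents_def ex_def)
  qed
  have fin: "finite (exponents n d M)" "finite ?P"
    by (rule finite_exponents) (intro finite_PiE finite_lessThan finite_multi_idx)
  define a where "a e = (\<Sum>t\<in>{t\<in>?P. ex t = e}. c (table_of d M t))" for e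
  have "form n d M c X = (\<Sum>e\<in>exponents n d M. a e * (\<Prod>I\<in>multi_idx n d. X I ^ e I))" for X
  proof -
    have "form n d M c X = (\<Sum>t\<in>?P. c (table_of d M t) * (\<Prod>I\<in>multi_idx n d. X I ^ ex t I))"
      unfolding form_eq_sum_columns using prodX by (intro sum.cong refl) simp
    also have "\<dots> = (\<Sum>e\<in>exponents n d M. \<Sum>t\<in>{t\<in>?P. ex t = e}.
        c (table_of d M t) * (\<Prod>I\<in>multi_idx n d. X I ^ ex t I))"
      using fin exI by (intro sum.group[symmetric]) auto
    also have "\<dots> = (\<Sum>e\<in>exponents n d M. a e * (\<Prod>I\<in>multi_idx n d. X I ^ e I))"
      unfolding a_def sum_distrib_right by (intro sum.cong refl) auto
    finally show ?thesis .
  qed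
  then show ?thesis unfolding homogeneous_poly_def by blast
qed

section \<open>Invariant forms\<close>

lemma sum_PiE_split:
  assumes "i \<in> I" and "finite I"
  shows "(\<Sum>s\<in>I \<rightarrow>\<^sub>E B. f s) = (\<Sum>b\<in>B. \<Sum>r\<in>(I - {i}) \<rightarrow>\<^sub>E B. f (r(i := b)))"
proof -
  have I: "insert i (I - {i}) = I" using assms by auto
  have inj: "inj_on (\<lambda>(b, r). r(i := b)) (B \<times> ((I - {i}) \<rightarrow>\<^sub>E B))"
    by (rule inj_combinator) simp
  have "(\<Sum>s\<in>I \<rightarrow>\<^sub>E B. f s) = (\<Sum>s\<in>(\<lambda>(b, r). r(i := b)) ` (B \<times> ((I - {i}) \<rightarrow>\<^sub>E B)). f s)"
    using PiE_insert_eq[of i "I - {i}" "\<lambda>_. B"] by (simp only: I)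
  also have "\<dots> = (\<Sum>(b, r)\<in>B \<times> ((I - {i}) \<rightarrow>\<^sub>E B). f (r(i := b)))"
    by (subst sum.reindex[OF inj]) (simp add: case_prod_beta o_def)
  finally show ?thesis by (simp add: sum.cartesian_product)
qed

lemma Tables_update:
  assumes "s \<in> Tables d M n" "a \<in> Maps M n" "i < d"
  shows "s(i := a) \<in> Tables d M n"
  using PiE_fun_upd[of a "\<lambda>_. Maps M n" i s "{..<d}"] assms by (simp add: insert_absorb)

lemma prod_tensor_act:
  assumes "s \<in> Tables d M n"
  shows "(\<Prod>j<M. tensor_act n d A X (columns d M s j))
    = (\<Sum>s'\<in>Tables d M n. (\<Prod>i<d. \<Prod>j<M. A i $$ (s i j, s' i j)) * (\<Prod>j<M. X (columns d M s' j)))"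
proof -
  have "(\<Prod>j<M. tensor_act n d A X (columns d M s j))
      = (\<Prod>j<M. \<Sum>J\<in>multi_idx n d. (\<Prod>i<d. A i $$ (s i j, J ! i)) * X J)"
    by (intro prod.cong refl) (simp add: tensor_act_def columns_def)
  also have "\<dots> = (\<Sum>t\<in>{..<M} \<rightarrow>\<^sub>E multi_idx n d. \<Prod>j<M. (\<Prod>i<d. A i $$ (s i j, t j ! i)) * X (t j))"
    by (rule prod_sum_PiE) auto
  also have "\<dots> = (\<Sum>s'\<in>Tables d M n. \<Prod>j<M. (\<Prod>i<d. A i $$ (s i j, columns d M s' j ! i)) * X (columns d M s' j))"
    by (rule sum.reindex_bij_betw[OF bij_columns, symmetric])
  also have "\<dots> = (\<Sum>s'\<in>Tables d M n. (\<Prod>j<M. \<Prod>i<d. A i $$ (s i j, s' i j)) * (\<Prod>j<M. X (columns d M s' j)))"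
    by (intro sum.cong refl) (simp add: prod.distrib columns_def)
  finally show ?thesis by (simp only: prod.swap[of _ "{..<d}"])
qed

text \<open>Expanding the transformed entries moves the action from the variables to the
  coefficients, where it is the substitution of \<open>sl_invariant\<close> with one matrix for each
  row.\<close>

lemma form_tensor_act:
  "form n d M c (tensor_act n d A X)
    = form n d M (\<lambda>s'. \<Sum>s\<in>Tables d M n. c s * (\<Prod>i<d. \<Prod>j<M. A i $$ (s i j, s' i j))) X"
proof -
  have "form n d M c (tensor_act n d A X) = (\<Sum>s\<in>Tables d M n. \<Sum>s'\<in>Tables d M n.
      c s * (\<Prod>i<d. \<Prod>j<M. A i $$ (s i j, s' i j)) * (\<Prod>j<M. X (columns d M s' j)))"
    unfolding form_def
    by (intro sum.cong refl) (simp only: prod_tensor_act sum_distrib_left mult.assoc)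
  then show ?thesis
    unfolding form_def by (subst (asm) sum.swap) (simp only: sum_distrib_right)
qed

text \<open>The other rows are frozen as parameters, which is what an induction over the rows
  needs.\<close>

definition slotwise_invariant :: "nat \<Rightarrow> nat \<Rightarrow> nat \<Rightarrow> ((nat \<Rightarrow> nat \<Rightarrow> nat) \<Rightarrow> complex) \<Rightarrow> bool" where
  "slotwise_invariant n d M c \<longleftrightarrow>
     (\<forall>i<d. \<forall>s\<in>Tables d M n. sl_invariant n M (\<lambda>a. c (s(i := a))))"

lemma one_in_SL: "1\<^sub>m n \<in> SL n"
  by (simp add: SL_def)

lemma prod_one_mat:
  assumes "a \<in> Maps M n" "b \<in> Maps M n"
  shows "(\<Prod>j<M. (1\<^sub>m n :: complex mat) $$ (a j, b j)) = (if a = b then 1 else 0)"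
proof (cases "a = b")
  case True
  then show ?thesis using PiE_mem[OF assms(1)] by simp
next
  case False
  then obtain j where "j < M" "a j \<noteq> b j" using PiE_ext[OF assms] by auto
  then have "(1\<^sub>m n :: complex mat) $$ (a j, b j) = 0"
    using PiE_mem[OF assms(1), of j] PiE_mem[OF assms(2), of j] by simp
  then show ?thesis using False \<open>j < M\<close> by (auto intro!: prod_zero)
qed

text \<open>Identity matrices in the other rows force s to agree with s' there, so only the sum over
  row i remains.\<close>

lemma sum_single_slot:
  fixes g :: "complex mat" and c :: "(nat \<Rightarrow> nat \<Rightarrow> nat) \<Rightarrow> complex"
  assumes i: "i < d" and s': "s' \<in> Tables d M n"
  shows "(\<Sum>s\<in>Tables d M n. c s * (\<Prod>l<d. \<Prod>j<M. (if l = i then g else 1\<^sub>m n) $$ (s l j, s' l j)))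
    = (\<Sum>a\<in>Maps M n. c (s'(i := a)) * (\<Prod>j<M. g $$ (a j, s' i j)))"
proof -
  let ?I = "{..<d} - {i}"
  define r' where "r' = restrict s' ?I"
  have r': "r' \<in> ?I \<rightarrow>\<^sub>E Maps M n" using TablesD(1)[OF s'] by (auto simp: r'_def)
  have upd: "r'(i := a) = s'(i := a)" for a
    using TablesD(3)[OF s'] by (auto simp: r'_def fun_eq_iff)
  have "(\<Sum>s\<in>Tables d M n. c s * (\<Prod>l<d. \<Prod>j<M. (if l = i then g else 1\<^sub>m n) $$ (s l j, s' l j)))
      = (\<Sum>a\<in>Maps M n. \<Sum>r\<in>?I \<rightarrow>\<^sub>E Maps M n. c (r(i := a)) *
          (\<Prod>l<d. \<Prod>j<M. (if l = i then g else 1\<^sub>m n) $$ ((r(i := a)) l j, s' l j)))"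
    using i by (intro sum_PiE_split) auto
  also have "\<dots> = (\<Sum>a\<in>Maps M n. \<Sum>r\<in>?I \<rightarrow>\<^sub>E Maps M n.
      if r = r' then c (r'(i := a)) * (\<Prod>j<M. g $$ (a j, s' i j)) else 0)"
  proof (intro sum.cong refl)
    fix a r assume r: "r \<in> ?I \<rightarrow>\<^sub>E Maps M n"
    have "(\<Prod>l<d. \<Prod>j<M. (if l = i then g else 1\<^sub>m n) $$ ((r(i := a)) l j, s' l j))
        = (\<Prod>j<M. g $$ (a j, s' i j)) *
          (\<Prod>l\<in>?I. \<Prod>j<M. (if l = i then g else 1\<^sub>m n) $$ ((r(i := a)) l j, s' l j))"
      using i by (subst prod.remove[of _ i]) auto
    also have "(\<Prod>l\<in>?I. \<Prod>j<M. (if l = i then g else 1\<^sub>m n) $$ ((r(i := a)) l j, s' l j))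
        = (\<Prod>l\<in>?I. if r l = s' l then 1 else 0)"
    proof (rule prod.cong[OF refl])
      fix l assume l: "l \<in> ?I"
      then have "(\<Prod>j<M. (if l = i then g else 1\<^sub>m n) $$ ((r(i := a)) l j, s' l j))
          = (\<Prod>j<M. (1\<^sub>m n :: complex mat) $$ (r l j, s' l j))" by simp
      also have "\<dots> = (if r l = s' l then 1 else 0)"
        using prod_one_mat[OF PiE_mem[OF r l] TablesD(1)[OF s', of l]] l by simp
      finally show "(\<Prod>j<M. (if l = i then g else 1\<^sub>m n) $$ ((r(i := a)) l j, s' l j))
          = (if r l = s' l then 1 else 0)" .
    qed
    also have "\<dots> = (if r = r' then 1 else 0)"
    proof (cases "r = r'")
      case True
      then show ?thesis by (simp add: r'_def)
    next
      case False
      then obtain l where "l \<in> ?I" "r l \<noteq> s' l"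
        using PiE_ext[OF r r'] unfolding r'_def by fastforce
      then have "(\<Prod>l\<in>?I. if r l = s' l then 1 else (0 :: complex)) = 0"
        by (intro prod_zero) auto
      then show ?thesis using False by simp
    qed
    finally show "c (r(i := a)) * (\<Prod>l<d. \<Prod>j<M. (if l = i then g else 1\<^sub>m n) $$ ((r(i := a)) l j, s' l j))
        = (if r = r' then c (r'(i := a)) * (\<Prod>j<M. g $$ (a j, s' i j)) else 0)"
      by simp
  qed
  also have "\<dots> = (\<Sum>a\<in>Maps M n. c (r'(i := a)) * (\<Prod>j<M. g $$ (a j, s' i j)))"
  proof -
    have "finite (?I \<rightarrow>\<^sub>E Maps M n)" by (intro finite_PiE) auto
    then show ?thesis using r' by (simp only: sum.delta if_True)
  qed
  finally show ?thesis by (simp only: upd)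
qed

text \<open>Let a matrix act in one row only. The old and the transformed coefficients are symmetric
  families of the same polynomial, so \<open>form_eq_0_imp\<close> identifies them: invariance of
  values becomes invariance of coefficients.\<close>

lemma invariants_imp_form:
  assumes "f \<in> invariants n d M"
  obtains c where "symmetric_coeff n d M c" and "slotwise_invariant n d M c" and "f = form n d M c"
proof -
  have hom: "homogeneous_poly n d M f"
    and inv: "\<And>A X. (\<forall>i<d. A i \<in> SL n) \<Longrightarrow> f (tensor_act n d A X) = f X"
    using assms by (auto simp: invariants_def)
  obtain c where c: "symmetric_coeff n d M c" and f: "f = form n d M c"
    using homogeneous_poly_imp_form[OF hom] .
  have key: "(\<Sum>a\<in>Maps M n. c (s(i := a)) * (\<Prod>j<M. g $$ (a j, s i j))) = c s"
    if i: "i < d" and g: "g \<in> SL n" and s: "s \<in> Tables d M n" for i g s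
  proof -
    define A where "A l = (if l = i then g else 1\<^sub>m n)" for l :: nat
    define c' where "c' s' = (\<Sum>s\<in>Tables d M n. c s * (\<Prod>l<d. \<Prod>j<M. A l $$ (s l j, s' l j)))" for s'
    have "form n d M c' X = form n d M c X" for X
      using inv[of A X] g one_in_SL unfolding f form_tensor_act c'_def A_def by simp
    then have zero: "form n d M (\<lambda>s. c' s - c s) X = 0" for X
      by (simp add: form_diff)
    \<comment> \<open>Within a row the same matrix acts on every column, so the action commutes with
      reordering the columns.\<close>
    have sym': "symmetric_coeff n d M c'"
      unfolding symmetric_coeff_def
    proof (intro allI impI)
      fix \<pi> s' assume \<pi>: "\<pi> permutes {..<M}" and s': "s' \<in> Tables d M n"
      have inner: "(\<Prod>j<M. A l $$ (permute_columns d \<pi> s l j, permute_columns d \<pi> s' l j))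
          = (\<Prod>j<M. A l $$ (s l j, s' l j))" if "l < d" for l s
        using prod.permute[OF \<pi>, of "\<lambda>j. A l $$ (s l j, s' l j)"] that
        by (simp add: permute_columns_def o_def)
      have "c' (permute_columns d \<pi> s') = (\<Sum>s\<in>Tables d M n. c (permute_columns d \<pi> s) *
          (\<Prod>l<d. \<Prod>j<M. A l $$ (permute_columns d \<pi> s l j, permute_columns d \<pi> s' l j)))"
        unfolding c'_def by (rule sum_permute_columns[OF \<pi>, symmetric])
      also have "\<dots> = c' s'"
        unfolding c'_def
      proof (rule sum.cong[OF refl])
        fix s assume "s \<in> Tables d M n"
        then have "c (permute_columns d \<pi> s) = c s" using c \<pi> by (simp add: symmetric_coeff_def)
        moreover have "(\<Prod>l<d. \<Prod>j<M. A l $$ (permute_columns d \<pi> s l j, permute_columns d \<pi> s' l j))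
            = (\<Prod>l<d. \<Prod>j<M. A l $$ (s l j, s' l j))"
          by (intro prod.cong refl inner) simp
        ultimately show "c (permute_columns d \<pi> s) *
            (\<Prod>l<d. \<Prod>j<M. A l $$ (permute_columns d \<pi> s l j, permute_columns d \<pi> s' l j))
          = c s * (\<Prod>l<d. \<Prod>j<M. A l $$ (s l j, s' l j))" by simp
      qed
      finally show "c' (permute_columns d \<pi> s') = c' s'" .
    qed
    have "symmetric_coeff n d M (\<lambda>s. c' s - c s)"
      using c sym' by (simp add: symmetric_coeff_def)
    from form_eq_0_imp[OF this zero s] have "c' s = c s" by simp
    then show ?thesis unfolding c'_def A_def sum_single_slot[OF i s] .
  qed
  have "slotwise_invariant n d M c"
    unfolding slotwise_invariant_def sl_invariant_def
  proof (intro allI impI ballI)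
    fix i s g b assume i: "i < d" and s: "s \<in> Tables d M n" and g: "g \<in> SL n" and b: "b \<in> Maps M n"
    show "(\<Sum>a\<in>Maps M n. c (s(i := a)) * (\<Prod>j<M. g $$ (a j, b j))) = c (s(i := b))"
      using key[OF i g Tables_update[OF s b i]] by simp
  qed
  with c f that show ?thesis by blast
qed

section \<open>Pairing with tables\<close>

text \<open>The table T selects one SL-invariant, \<open>eps\<close> with second argument T i, for
  each row i; c is contracted with all of them.\<close>

definition pairing :: "nat \<Rightarrow> nat \<Rightarrow> nat \<Rightarrow> ((nat \<Rightarrow> nat \<Rightarrow> nat) \<Rightarrow> complex) \<Rightarrow> (nat \<Rightarrow> nat \<Rightarrow> nat) \<Rightarrow> complex" where
  "pairing n d M c T = (\<Sum>s\<in>Tables d M n. c s * (\<Prod>i<d. eps n M (s i) (T i)))"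

lemma sl_invariant_sum:
  assumes "\<And>r. r \<in> R \<Longrightarrow> sl_invariant n M (c r)"
  shows "sl_invariant n M (\<lambda>a. \<Sum>r\<in>R. c r a * K r)"
  unfolding sl_invariant_def
proof (intro ballI)
  fix g s assume g: "g \<in> SL n" and s: "s \<in> Maps M n"
  have "(\<Sum>a\<in>Maps M n. (\<Sum>r\<in>R. c r a * K r) * (\<Prod>j<M. g $$ (a j, s j)))
      = (\<Sum>r\<in>R. \<Sum>a\<in>Maps M n. c r a * K r * (\<Prod>j<M. g $$ (a j, s j)))"
    unfolding sum_distrib_right by (rule sum.swap)
  also have "\<dots> = (\<Sum>r\<in>R. (\<Sum>a\<in>Maps M n. c r a * (\<Prod>j<M. g $$ (a j, s j))) * K r)"
    unfolding sum_distrib_right by (simp only: mult_ac)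
  also have "\<dots> = (\<Sum>r\<in>R. c r s * K r)"
    using assms g s by (intro sum.cong refl) (simp add: sl_invariant_def)
  finally show "(\<Sum>a\<in>Maps M n. (\<Sum>r\<in>R. c r a * K r) * (\<Prod>j<M. g $$ (a j, s j)))
      = (\<Sum>r\<in>R. c r s * K r)" .
qed

text \<open>Induction on the set of rows: fixing row i at b leaves an invariant on the remaining
  rows, and its pairings vanish because, as functions of b, they satisfy the hypotheses of
  \<open>sl_invariant_eq_0\<close>.\<close>

lemma slotwise_eq_0_aux:
  assumes n: "n > 0" and M: "M = n * k" and J: "finite J"
    and "\<And>i s. i \<in> J \<Longrightarrow> s \<in> J \<rightarrow>\<^sub>E Maps M n \<Longrightarrow> sl_invariant n M (\<lambda>a. c (s(i := a)))"
    and "\<And>T. T \<in> J \<rightarrow>\<^sub>E Maps M k \<Longrightarrow> (\<Sum>s\<in>J \<rightarrow>\<^sub>E Maps M n. c s * (\<Prod>i\<in>J. eps n M (s i) (T i))) = 0"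
    and "s \<in> J \<rightarrow>\<^sub>E Maps M n"
  shows "c s = 0"
  using J assms(4-)
proof (induction J arbitrary: c s rule: finite_induct)
  case empty
  then show ?case by simp
next
  case (insert i J)
  have J: "insert i J - {i} = J" using insert.hyps by auto
  define b where "b = s i"
  define r where "r = restrict s J"
  have sn: "s l \<in> Maps M n" if "l \<in> insert i J" for l
    using PiE_mem[OF insert.prems(3) that] .
  have b: "b \<in> Maps M n" using sn by (simp add: b_def)
  have r: "r \<in> J \<rightarrow>\<^sub>E Maps M n" using sn by (auto simp: r_def)
  have s: "s = r(i := b)"
    using PiE_arb[OF insert.prems(3)] by (auto simp: r_def b_def fun_eq_iff)
  have upd: "r(i := b) \<in> insert i J \<rightarrow>\<^sub>E Maps M n" if "r \<in> J \<rightarrow>\<^sub>E Maps M n" for r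
    using PiE_fun_upd[OF b that] .
  have "c (r(i := b)) = 0"
  proof (rule insert.IH[where c = "\<lambda>r. c (r(i := b))"])
    fix l r assume l: "l \<in> J" and r: "r \<in> J \<rightarrow>\<^sub>E Maps M n"
    have "l \<noteq> i" using l insert.hyps by auto
    from fun_upd_twist[OF this]
    have "(\<lambda>a. c ((r(l := a))(i := b))) = (\<lambda>a. c ((r(i := b))(l := a)))"
      by (intro ext) (rule arg_cong[where f = c])
    then show "sl_invariant n M (\<lambda>a. c ((r(l := a))(i := b)))"
      using insert.prems(1)[OF insertI2[OF l] upd[OF r]] by (simp only:)
  next
    fix T assume T: "T \<in> J \<rightarrow>\<^sub>E Maps M k"
    \<comment> \<open>All rows but i are contracted with T. The result is invariant in row i, and
      pairing it with t gives the full pairing with \<open>T(i := t)\<close>.\<close>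
    define x where "x a = (\<Sum>r\<in>J \<rightarrow>\<^sub>E Maps M n. c (r(i := a)) * (\<Prod>l\<in>J. eps n M (r l) (T l)))" for a
    have "x b = 0"
    proof (rule sl_invariant_eq_0[OF n M, where c = x])
      show "sl_invariant n M x"
        unfolding x_def[abs_def]
      proof (rule sl_invariant_sum[where c = "\<lambda>r a. c (r(i := a))"])
        fix r assume "r \<in> J \<rightarrow>\<^sub>E Maps M n"
        then show "sl_invariant n M (\<lambda>a. c (r(i := a)))"
          using insert.prems(1)[OF insertI1 upd] by (simp only: fun_upd_upd)
      qed
    next
      fix t assume t: "t \<in> Maps M k"
      have T': "T(i := t) \<in> insert i J \<rightarrow>\<^sub>E Maps M k" using PiE_fun_upd[OF t T] .
      have prod: "(\<Prod>l\<in>insert i J. eps n M ((r(i := a)) l) ((T(i := t)) l))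
          = eps n M a t * (\<Prod>l\<in>J. eps n M (r l) (T l))" for r a
      proof -
        have "(\<Prod>l\<in>J. eps n M ((r(i := a)) l) ((T(i := t)) l)) = (\<Prod>l\<in>J. eps n M (r l) (T l))"
          using insert.hyps by (intro prod.cong refl) auto
        then show ?thesis using insert.hyps by simp
      qed
      have "(\<Sum>a\<in>Maps M n. x a * eps n M a t)
          = (\<Sum>a\<in>Maps M n. \<Sum>r\<in>J \<rightarrow>\<^sub>E Maps M n. c (r(i := a)) *
              (\<Prod>l\<in>insert i J. eps n M ((r(i := a)) l) ((T(i := t)) l)))"
        unfolding x_def sum_distrib_right prod by (simp only: mult_ac)
      also have "\<dots> = (\<Sum>s\<in>insert i J \<rightarrow>\<^sub>E Maps M n. c s * (\<Prod>l\<in>insert i J. eps n M (s l) ((T(i := t)) l)))"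
        using sum_PiE_split[of i "insert i J" "\<lambda>s. c s * (\<Prod>l\<in>insert i J. eps n M (s l) ((T(i := t)) l))" "Maps M n"]
          insert.hyps by (simp only: J finite_insert insertI1)
      also have "\<dots> = 0" by (rule insert.prems(2)[OF T'])
      finally show "(\<Sum>a\<in>Maps M n. x a * eps n M a t) = 0" .
    qed (rule b)
    then show "(\<Sum>r\<in>J \<rightarrow>\<^sub>E Maps M n. c (r(i := b)) * (\<Prod>l\<in>J. eps n M (r l) (T l))) = 0"
      by (simp only: x_def)
  qed (rule r)
  then show ?case by (simp only: s)
qed

theorem slotwise_invariant_eq_0:
  assumes "n > 0" and "M = n * k" and "slotwise_invariant n d M c"
    and "\<And>T. T \<in> Tables d M k \<Longrightarrow> pairing n d M c T = 0"
    and "s \<in> Tables d M n"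
  shows "c s = 0"
  by (rule slotwise_eq_0_aux[OF assms(1,2), of "{..<d}" c s])
    (use assms(3-) in \<open>simp_all only: slotwise_invariant_def pairing_def finite_lessThan lessThan_iff\<close>)

section \<open>Renumbering, relabelling and the exchange of n and k\<close>

lemma map_sgn_recode:
  assumes \<phi>: "bij_betw \<phi> X {..<M}" and \<psi>: "bij_betw \<psi> X {..<M}"
  obtains \<kappa> :: complex where "\<kappa> \<noteq> 0"
    and "\<And>h. (\<And>j. j < M \<Longrightarrow> h j \<in> X) \<Longrightarrow> map_sgn M (\<lambda>j. \<phi> (h j)) = \<kappa> * map_sgn M (\<lambda>j. \<psi> (h j))"
proof -
  \<comment> \<open>The change of numbering from \<psi> to \<phi>; its sign serves as \<kappa> for
    all h at once.\<close>
  define q where "q x = (if x < M then \<phi> (inv_into X \<psi> x) else x)" for x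
  have "bij_betw (\<phi> \<circ> inv_into X \<psi>) {..<M} {..<M}"
    by (rule bij_betw_trans[OF bij_betw_inv_into[OF \<psi>] \<phi>])
  then have "bij_betw q {..<M} {..<M}"
    by (subst bij_betw_cong[where g = "\<phi> \<circ> inv_into X \<psi>"]) (auto simp: q_def)
  then have q: "q permutes {..<M}" by (rule bij_imp_permutes) (simp add: q_def)
  have "map_sgn M (\<lambda>j. \<phi> (h j)) = of_int (sign q) * map_sgn M (\<lambda>j. \<psi> (h j))"
    if h: "\<And>j. j < M \<Longrightarrow> h j \<in> X" for h
  proof -
    have "map_sgn M (\<lambda>j. \<phi> (h j)) = map_sgn M (q \<circ> (\<lambda>j. \<psi> (h j)))"
    proof (rule map_sgn_cong)
      fix j assume "j < M"
      then have "h j \<in> X" by (rule h)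
      then have "\<psi> (h j) < M" "inv_into X \<psi> (\<psi> (h j)) = h j"
        using bij_betwE[OF \<psi>] inv_into_f_f[OF bij_betw_imp_inj_on[OF \<psi>]] by auto
      then show "\<phi> (h j) = (q \<circ> (\<lambda>j. \<psi> (h j))) j" by (simp add: q_def)
    qed
    then show ?thesis by (simp only: map_sgn_comp_left[OF q])
  qed
  with that[of "of_int (sign q)"] sign_nz[of q] show ?thesis by simp
qed

lemma bij_pair_code:
  fixes n k :: nat
  assumes "n > 0"
  shows "bij_betw (\<lambda>x. snd x * n + fst x) ({..<n} \<times> {..<k}) {..<n * k}"
proof (rule bij_betw_byWitness[where f' = "\<lambda>r. (r mod n, r div n)"])
  show "(\<lambda>x. snd x * n + fst x) ` ({..<n} \<times> {..<k}) \<subseteq> {..<n * k}"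
    using pair_code_less by auto
  show "(\<lambda>r. (r mod n, r div n)) ` {..<n * k} \<subseteq> {..<n} \<times> {..<k}"
    using assms by (auto simp: less_mult_imp_div_less mult.commute)
qed (use assms in auto)

lemma eps_relabel:
  assumes n: "n > 0" and M: "M = n * k" and p: "p permutes {..<k}"
  obtains \<kappa> :: complex where "\<kappa> \<noteq> 0"
    and "\<And>s t. (\<And>j. j < M \<Longrightarrow> s j < n \<and> t j < k) \<Longrightarrow> eps n M s (\<lambda>j. p (t j)) = \<kappa> * eps n M s t"
proof -
  have "bij_betw (map_prod id p) ({..<n} \<times> {..<k}) ({..<n} \<times> {..<k})"
    using permutes_imp_bij[OF p] by (intro bij_betw_map_prod) auto
  from bij_betw_trans[OF this bij_pair_code[OF n]]
  have "bij_betw (\<lambda>x. p (snd x) * n + fst x) ({..<n} \<times> {..<k}) {..<M}"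
    by (simp add: M o_def)
  moreover have "bij_betw (\<lambda>x. snd x * n + fst x) ({..<n} \<times> {..<k}) {..<M}"
    using bij_pair_code[OF n] by (simp only: M)
  ultimately obtain \<kappa> :: complex where "\<kappa> \<noteq> 0"
    and \<kappa>: "\<And>h. (\<And>j. j < M \<Longrightarrow> h j \<in> {..<n} \<times> {..<k}) \<Longrightarrow>
      map_sgn M (\<lambda>j. p (snd (h j)) * n + fst (h j)) = \<kappa> * map_sgn M (\<lambda>j. snd (h j) * n + fst (h j))"
    by (rule map_sgn_recode) blast
  moreover have "eps n M s (\<lambda>j. p (t j)) = \<kappa> * eps n M s t" if "\<And>j. j < M \<Longrightarrow> s j < n \<and> t j < k" for s t
    using \<kappa>[of "\<lambda>j. (s j, t j)"] that by (simp add: eps_def)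
  ultimately show ?thesis using that by blast
qed

text \<open>Exchanging the entries of a pair only renumbers the codes. This is what lets n and k
  change roles in the duality.\<close>

lemma eps_swap:
  assumes n: "n > 0" and k: "k > 0" and M: "M = n * k"
  obtains \<kappa> :: complex where "\<kappa> \<noteq> 0"
    and "\<And>s t. (\<And>j. j < M \<Longrightarrow> s j < n \<and> t j < k) \<Longrightarrow> eps k M t s = \<kappa> * eps n M s t"
proof -
  have "bij_betw prod.swap ({..<n} \<times> {..<k}) ({..<k} \<times> {..<n})"
    by (rule bij_betw_byWitness[where f' = prod.swap]) auto
  from bij_betw_trans[OF this bij_pair_code[OF k]]
  have "bij_betw (\<lambda>x. fst x * k + snd x) ({..<n} \<times> {..<k}) {..<M}"
    by (simp add: M o_def mult.commute[of k n])
  moreover have "bij_betw (\<lambda>x. snd x * n + fst x) ({..<n} \<times> {..<k}) {..<M}"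
    using bij_pair_code[OF n] by (simp only: M)
  ultimately obtain \<kappa> :: complex where "\<kappa> \<noteq> 0"
    and \<kappa>: "\<And>h. (\<And>j. j < M \<Longrightarrow> h j \<in> {..<n} \<times> {..<k}) \<Longrightarrow>
      map_sgn M (\<lambda>j. fst (h j) * k + snd (h j)) = \<kappa> * map_sgn M (\<lambda>j. snd (h j) * n + fst (h j))"
    by (rule map_sgn_recode) blast
  moreover have "eps k M t s = \<kappa> * eps n M s t" if "\<And>j. j < M \<Longrightarrow> s j < n \<and> t j < k" for s t
    using \<kappa>[of "\<lambda>j. (s j, t j)"] that by (simp add: eps_def)
  ultimately show ?thesis using that by blast
qed

text \<open>The codes with quotient b form an interval of length n, and a bijective pair map must
  fill it using exactly the positions with symbol b.\<close>

lemma eps_nonzero_imp_balanced: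
  assumes n: "n > 0" and M: "M = n * k" and s: "\<And>j. j < M \<Longrightarrow> s j < n"
    and nz: "eps n M s t \<noteq> 0" and b: "b < k"
  shows "card {j. j < M \<and> t j = b} = n"
proof -
  let ?h = "\<lambda>j. t j * n + s j"
  have h: "bij_betw ?h {..<M} {..<M}"
    using nz by (simp add: eps_def map_sgn_nonzero_iff)
  have div: "?h j div n = t j" if "j < M" for j using s[OF that] n by simp
  have "bij_betw ?h {j. j < M \<and> t j = b} {r. r < M \<and> r div n = b}"
  proof (rule bij_betw_subset[OF h])
    show "?h ` {j. j < M \<and> t j = b} = {r. r < M \<and> r div n = b}"
    proof
      show "{r. r < M \<and> r div n = b} \<subseteq> ?h ` {j. j < M \<and> t j = b}"
      proof
        fix r assume r: "r \<in> {r. r < M \<and> r div n = b}"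
        then have "r \<in> ?h ` {..<M}" unfolding bij_betw_imp_surj_on[OF h] by simp
        then obtain j where j: "j < M" "r = ?h j" by auto
        then have "t j = b" using div[of j] r by simp
        with j show "r \<in> ?h ` {j. j < M \<and> t j = b}" by blast
      qed
      show "?h ` {j. j < M \<and> t j = b} \<subseteq> {r. r < M \<and> r div n = b}"
        using div bij_betwE[OF h] by auto
    qed
  qed auto
  then have "card {j. j < M \<and> t j = b} = card {r. r < M \<and> r div n = b}"
    by (rule bij_betw_same_card)
  also have "{r. r < M \<and> r div n = b} = {b * n..<b * n + n}"
  proof -
    have "b * n + n \<le> n * k" using mult_le_mono1[of "Suc b" k n] b by (simp add: mult.commute)
    then have "r < M \<and> r div n = b \<longleftrightarrow> b * n \<le> r \<and> r < b * n + n" for r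
      unfolding M using n div_mult_mod_eq[of r n] mod_less_divisor[of n r]
      by (metis add.commute add_less_cancel_left div_nat_eqI le_add1 mult.commute mult_Suc order_less_le_trans)
    then show ?thesis
      unfolding set_eq_iff mem_Collect_eq atLeastLessThan_iff by blast
  qed
  finally show ?thesis by simp
qed

lemma pairing_cong:
  assumes "\<And>i j. i < d \<Longrightarrow> j < M \<Longrightarrow> T i j = T' i j"
  shows "pairing n d M c T = pairing n d M c T'"
  unfolding pairing_def
  by (intro sum.cong refl arg_cong2[where f = "(*)"] prod.cong eps_cong) (use assms in auto)

text \<open>Reindexing the sum moves \<pi> from T to c, where symmetry absorbs it; each of the d
  rows leaves one factor \<open>sign \<pi>\<close>.\<close>

lemma pairing_permute_columns:
  assumes c: "symmetric_coeff n d M c" and \<pi>: "\<pi> permutes {..<M}"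
  shows "pairing n d M c (permute_columns d \<pi> T) = of_int (sign \<pi>) ^ d * pairing n d M c T"
proof -
  have "pairing n d M c (permute_columns d \<pi> T)
      = (\<Sum>s\<in>Tables d M n. c (permute_columns d \<pi> s) *
          (\<Prod>i<d. eps n M (permute_columns d \<pi> s i) (permute_columns d \<pi> T i)))"
    unfolding pairing_def by (rule sum_permute_columns[OF \<pi>, symmetric])
  also have "\<dots> = (\<Sum>s\<in>Tables d M n. of_int (sign \<pi>) ^ d * (c s * (\<Prod>i<d. eps n M (s i) (T i))))"
  proof (rule sum.cong[OF refl])
    fix s assume s: "s \<in> Tables d M n"
    have "(\<Prod>i<d. eps n M (permute_columns d \<pi> s i) (permute_columns d \<pi> T i))
        = (\<Prod>i<d. of_int (sign \<pi>) * eps n M (s i) (T i))"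
      by (intro prod.cong refl)
        (simp only: permute_columns_def restrict_apply if_True eps_comp_permutes[OF \<pi>])
    then show "c (permute_columns d \<pi> s) * (\<Prod>i<d. eps n M (permute_columns d \<pi> s i) (permute_columns d \<pi> T i))
        = of_int (sign \<pi>) ^ d * (c s * (\<Prod>i<d. eps n M (s i) (T i)))"
      using c \<pi> s by (simp add: symmetric_coeff_def prod.distrib)
  qed
  finally show ?thesis by (simp add: pairing_def sum_distrib_left)
qed

lemma pairing_relabel:
  assumes n: "n > 0" and M: "M = n * k" and p: "\<And>i. i < d \<Longrightarrow> p i permutes {..<k}"
    and T: "T \<in> Tables d M k" and T': "\<And>i j. i < d \<Longrightarrow> j < M \<Longrightarrow> T' i j = p i (T i j)"
    and 0: "pairing n d M c T = 0"
  shows "pairing n d M c T' = 0"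
proof -
  have "\<exists>\<kappa> :: complex. \<forall>s t. (\<forall>j<M. s j < n \<and> t j < k) \<longrightarrow> eps n M s (\<lambda>j. p i (t j)) = \<kappa> * eps n M s t"
    if "i < d" for i
    using eps_relabel[OF n M p[OF that]] by metis
  then obtain \<kappa> :: "nat \<Rightarrow> complex" where
    \<kappa>: "\<And>i s t. i < d \<Longrightarrow> (\<And>j. j < M \<Longrightarrow> s j < n \<and> t j < k) \<Longrightarrow>
        eps n M s (\<lambda>j. p i (t j)) = \<kappa> i * eps n M s t"
    by metis
  have "pairing n d M c T' = (\<Sum>s\<in>Tables d M n. (\<Prod>i<d. \<kappa> i) * (c s * (\<Prod>i<d. eps n M (s i) (T i))))"
    unfolding pairing_def
  proof (rule sum.cong[OF refl])
    fix s assume s: "s \<in> Tables d M n"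
    have "(\<Prod>i<d. eps n M (s i) (T' i)) = (\<Prod>i<d. \<kappa> i * eps n M (s i) (T i))"
    proof (rule prod.cong[OF refl])
      fix i assume "i \<in> {..<d}"
      then have i: "i < d" by simp
      have "eps n M (s i) (T' i) = eps n M (s i) (\<lambda>j. p i (T i j))"
        using T' i by (intro eps_cong) auto
      also have "\<dots> = \<kappa> i * eps n M (s i) (T i)"
        using TablesD(2)[OF s i] TablesD(2)[OF T i] by (intro \<kappa>[OF i]) simp
      finally show "eps n M (s i) (T' i) = \<kappa> i * eps n M (s i) (T i)" .
    qed
    then show "c s * (\<Prod>i<d. eps n M (s i) (T' i)) = (\<Prod>i<d. \<kappa> i) * (c s * (\<Prod>i<d. eps n M (s i) (T i)))"
      by (simp add: prod.distrib)
  qed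
  also have "\<dots> = (\<Prod>i<d. \<kappa> i) * pairing n d M c T"
    by (simp add: pairing_def sum_distrib_left)
  finally show ?thesis using 0 by simp
qed

lemma pairing_nonzero_imp_balanced:
  assumes n: "n > 0" and M: "M = n * k" and nz: "pairing n d M c T \<noteq> 0" and "i < d" "b < k"
  shows "card {j. j < M \<and> T i j = b} = n"
proof -
  obtain s where s: "s \<in> Tables d M n" and "c s * (\<Prod>i<d. eps n M (s i) (T i)) \<noteq> 0"
    using nz unfolding pairing_def by (meson sum.not_neutral_contains_not_neutral)
  then have "eps n M (s i) (T i) \<noteq> 0" using \<open>i < d\<close> by auto
  then show ?thesis
    using TablesD(2)[OF s \<open>i < d\<close>] \<open>b < k\<close> by (intro eps_nonzero_imp_balanced[OF n M]) auto
qed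

text \<open>This is where \<open>d\<close> must be odd: swapping two equal columns changes the sign of each row.\<close>

lemma pairing_nonzero_imp_distinct:
  assumes d: "odd d" and c: "symmetric_coeff n d M c" and nz: "pairing n d M c T \<noteq> 0"
  shows "inj_on (columns d M T) {..<M}"
proof (rule inj_onI, rule ccontr)
  fix j j' assume j: "j \<in> {..<M}" "j' \<in> {..<M}" and eq: "columns d M T j = columns d M T j'" and "j \<noteq> j'"
  have \<pi>: "transpose j j' permutes {..<M}" using j by (intro permutes_swap_id)
  have "T i j = T i j'" if "i < d" for i
    using arg_cong[OF eq, of "\<lambda>l. l ! i"] that j by (simp add: columns_def)
  then have "pairing n d M c (permute_columns d (transpose j j') T) = pairing n d M c T"
    by (intro pairing_cong) (auto simp: permute_columns_def transpose_def)
  then have "pairing n d M c T = - pairing n d M c T"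
    using pairing_permute_columns[OF c \<pi>, of T] d \<open>j \<noteq> j'\<close> by (simp add: sign_swap_id)
  with nz show False by simp
qed

section \<open>Tables unique up to relabelling and reordering\<close>

text \<open>Balance and distinct columns are what a nonzero pairing forces for odd d. T0 is
  canonical if every such table arises from it by permuting columns and relabelling the symbols
  within each row.\<close>

definition canonical_table :: "nat \<Rightarrow> nat \<Rightarrow> nat \<Rightarrow> (nat \<Rightarrow> nat \<Rightarrow> nat) \<Rightarrow> bool" where
  "canonical_table n k d T0 \<longleftrightarrow> T0 \<in> Tables d (n * k) k \<and>
     (\<forall>T\<in>Tables d (n * k) k. (\<forall>i<d. \<forall>b<k. card {j. j < n * k \<and> T i j = b} = n) \<longrightarrow>
        inj_on (columns d (n * k) T) {..<n * k} \<longrightarrow>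
        (\<exists>p \<pi>. (\<forall>i<d. p i permutes {..<k}) \<and> \<pi> permutes {..<n * k} \<and>
           (\<forall>i<d. \<forall>j<n * k. T i j = p i (T0 i (\<pi> j)))))"

text \<open>If the pairing at T were nonzero, T would be a relabelled and reordered T0, but both
  operations preserve vanishing.\<close>

lemma pairing_canonical_eq_0:
  assumes n: "n > 0" and d: "odd d" and T0: "canonical_table n k d T0"
    and c: "symmetric_coeff n d (n * k) c" and 0: "pairing n d (n * k) c T0 = 0"
    and T: "T \<in> Tables d (n * k) k"
  shows "pairing n d (n * k) c T = 0"
proof (rule ccontr)
  assume nz: "pairing n d (n * k) c T \<noteq> 0"
  have "\<forall>i<d. \<forall>b<k. card {j. j < n * k \<and> T i j = b} = n"
    using pairing_nonzero_imp_balanced[OF n refl nz] by blast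
  from bspec[OF conjunct2[OF T0[unfolded canonical_table_def]] T, THEN mp, OF this, THEN mp,
      OF pairing_nonzero_imp_distinct[OF d c nz]]
  obtain p \<pi> where p: "\<And>i. i < d \<Longrightarrow> p i permutes {..<k}" and \<pi>: "\<pi> permutes {..<n * k}"
    and eq: "\<And>i j. i < d \<Longrightarrow> j < n * k \<Longrightarrow> T i j = p i (T0 i (\<pi> j))"
    by blast
  have T0': "T0 \<in> Tables d (n * k) k" using T0 by (simp add: canonical_table_def)
  have "pairing n d (n * k) c T = 0"
  proof (rule pairing_relabel[OF n refl p permute_columns_in[OF \<pi> T0']])
    show "T i j = p i (permute_columns d \<pi> T0 i j)" if "i < d" "j < n * k" for i j
      using eq that by (simp add: permute_columns_def)
    show "pairing n d (n * k) c (permute_columns d \<pi> T0) = 0"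
      unfolding pairing_permute_columns[OF c \<pi>] 0 by simp
  qed
  with nz show False ..
qed

text \<open>Let z have order n. The scalar matrix z in row 0 has determinant z ^ n = 1 and
  multiplies every entry by z, hence f by z ^ m, so z ^ m = 1.\<close>

lemma dvd_invariant_degree:
  assumes n: "n > 0" and d: "d > 0" and f: "f \<in> invariants n d m" and nz: "f \<noteq> 0"
  shows "n dvd m"
proof -
  define z where "z = cis (2 * pi / n)"
  have zn: "z ^ n = 1" using n by (simp add: z_def DeMoivre)
  define A where "A i = (if i = 0 then z \<cdot>\<^sub>m 1\<^sub>m n else 1\<^sub>m n)" for i :: nat
  obtain c where f_form: "f = form n d m c" using invariants_imp_form[OF f] by blast
  have A: "\<forall>i<d. A i \<in> SL n" using zn by (simp add: A_def SL_def)
  have act: "tensor_act n d A X I = z * X I" if I: "I \<in> multi_idx n d" for X I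
  proof -
    have entry: "(\<Prod>i<d. A i $$ (I ! i, J ! i)) = (if J = I then z else 0)" if J: "J \<in> multi_idx n d" for J
    proof (cases "J = I")
      case True
      have "(\<Prod>i<d. A i $$ (I ! i, I ! i)) = (\<Prod>i<d. if i = 0 then z else 1)"
        using multi_idx_nth[OF I] by (intro prod.cong) (auto simp: A_def)
      also have "\<dots> = z" using d by (simp add: prod.delta')
      finally show ?thesis using True by simp
    next
      case False
      have "length I = d" "length J = d" using I J by (auto simp: multi_idx_def)
      then obtain i where i: "i < d" "J ! i \<noteq> I ! i" using False nth_equalityI by metis
      then have "A i $$ (I ! i, J ! i) = 0"
        using multi_idx_nth[OF I i(1)] multi_idx_nth[OF J i(1)] by (auto simp: A_def)
      then show ?thesis using False i by (auto intro!: prod_zero)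
    qed
    have "tensor_act n d A X I = (\<Sum>J\<in>multi_idx n d. if J = I then z * X J else 0)"
      unfolding tensor_act_def by (rule sum.cong[OF refl]) (simp add: entry)
    also have "\<dots> = z * X I" using I by (simp add: sum.delta')
    finally show ?thesis .
  qed
  have "f X = z ^ m * f X" for X
  proof -
    have "f X = f (tensor_act n d A X)" using f A by (simp add: invariants_def)
    also have "\<dots> = (\<Sum>s\<in>Tables d m n. z ^ m * (c s * (\<Prod>j<m. X (columns d m s j))))"
      unfolding f_form form_def
    proof (rule sum.cong[OF refl])
      fix s assume s: "s \<in> Tables d m n"
      have "(\<Prod>j<m. tensor_act n d A X (columns d m s j)) = (\<Prod>j<m. z * X (columns d m s j))"
        by (rule prod.cong[OF refl], rule act) (rule PiE_mem[OF columns_in[OF s]])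
      then show "c s * (\<Prod>j<m. tensor_act n d A X (columns d m s j)) = z ^ m * (c s * (\<Prod>j<m. X (columns d m s j)))"
        by (simp add: prod.distrib)
    qed
    also have "\<dots> = z ^ m * f X" unfolding f_form form_def sum_distrib_left ..
    finally show ?thesis .
  qed
  moreover obtain X where "f X \<noteq> 0" using nz by (auto simp: fun_eq_iff zero_fun_def)
  ultimately have "z ^ m = 1" by (metis mult_cancel_right1)
  then have "cis (2 * pi * m / n) = 1" by (simp add: z_def DeMoivre mult_ac)
  then obtain q :: int where "2 * pi * m / n = 2 * pi * q"
    by (auto simp: complex_eq_iff cos_one_2pi_int)
  then have "real m = real_of_int q * real n" using n by (simp add: field_simps)
  then have "int m = q * int n" by (metis of_int_eq_iff of_int_mult of_int_of_nat_eq)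
  then show ?thesis by (metis dvd_triv_right int_dvd_int_iff)
qed

text \<open>A nonzero invariant has a nonzero pairing with some table, whose n * k columns are
  distinct among the k ^ d possible ones.\<close>

theorem invariant_degree_bound:
  assumes n: "n > 0" and d: "odd d" and f: "f \<in> invariants n d m" and nz: "f \<noteq> 0" and m: "m > 0"
  obtains k where "m = n * k" and "k > 0" and "n \<le> k ^ (d - 1)"
proof -
  have d0: "d > 0" using d by (rule odd_pos)
  obtain k where k: "m = n * k" using dvd_invariant_degree[OF n d0 f nz] by (rule dvdE)
  obtain c where c: "symmetric_coeff n d m c" "slotwise_invariant n d m c" and f_form: "f = form n d m c"
    using invariants_imp_form[OF f] .
  have "\<exists>T\<in>Tables d m k. pairing n d m c T \<noteq> 0"
  proof (rule ccontr)
    assume "\<not> ?thesis"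
    then have "c s = 0" if "s \<in> Tables d m n" for s
      using slotwise_invariant_eq_0[OF n k c(2)] that by blast
    then have "f = 0" unfolding f_form by (simp add: form_def fun_eq_iff zero_fun_def)
    with nz show False ..
  qed
  then obtain T where T: "T \<in> Tables d m k" and T0: "pairing n d m c T \<noteq> 0" by blast
  have "card {..<m} \<le> card (multi_idx k d)"
    using pairing_nonzero_imp_distinct[OF d c(1) T0] columns_in[OF T]
    by (intro card_inj_on_le[of "columns d m T"]) auto
  then have le: "n * k \<le> k ^ d" by (simp add: k card_multi_idx)
  have kpos: "k > 0" using m k by simp
  have "k ^ d = k ^ (d - 1) * k" using d0 by (metis power_minus_mult)
  with le kpos have "n \<le> k ^ (d - 1)" by simp
  with k kpos that show ?thesis by blast
qed

section \<open>The invariant of a balanced table\<close>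

text \<open>Evaluation at X, regarded as a family of coefficients in s. The results on
  \<open>pairing\<close> thereby describe how the form attached to a table depends on that
  table.\<close>

definition monomial_coeff :: "nat \<Rightarrow> nat \<Rightarrow> hypermatrix \<Rightarrow> (nat \<Rightarrow> nat \<Rightarrow> nat) \<Rightarrow> complex" where
  "monomial_coeff d M X s = (\<Prod>j<M. X (columns d M s j))"

lemma symmetric_monomial_coeff: "symmetric_coeff n d M (monomial_coeff d M X)"
  unfolding symmetric_coeff_def
proof (intro allI impI)
  fix \<pi> s assume \<pi>: "\<pi> permutes {..<M}"
  have "columns d M (permute_columns d \<pi> s) j = columns d M s (\<pi> j)" if "j < M" for j
    using permutes_in_image[OF \<pi>, of j] that by (simp add: columns_def permute_columns_def)
  then have "monomial_coeff d M X (permute_columns d \<pi> s) = (\<Prod>j<M. X (columns d M s (\<pi> j)))"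
    by (simp add: monomial_coeff_def)
  also have "\<dots> = monomial_coeff d M X s"
    using prod.permute[OF \<pi>, of "\<lambda>j. X (columns d M s j)"] by (simp add: monomial_coeff_def o_def)
  finally show "monomial_coeff d M X (permute_columns d \<pi> s) = monomial_coeff d M X s" .
qed

lemma pairing_monomial_coeff:
  "pairing n d M (monomial_coeff d M X) T = form n d M (\<lambda>s. \<Prod>i<d. eps n M (s i) (T i)) X"
  unfolding pairing_def form_def monomial_coeff_def by (simp only: mult.commute)

text \<open>The sum over tables factors into one sum for each row, and \<open>eps_transform\<close>
  evaluates it with determinant 1.\<close>

lemma form_eps_in_invariants:
  assumes n: "n > 0" and M: "M = n * k" and T: "T \<in> Tables d M k"
  shows "form n d M (\<lambda>s. \<Prod>i<d. eps n M (s i) (T i)) \<in> invariants n d M"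
  unfolding invariants_def
proof (intro CollectI conjI allI impI homogeneous_poly_form)
  fix A X assume A: "\<forall>i<d. A i \<in> SL n"
  have "(\<Sum>s\<in>Tables d M n. (\<Prod>i<d. eps n M (s i) (T i)) * (\<Prod>i<d. \<Prod>j<M. A i $$ (s i j, s' i j)))
      = (\<Prod>i<d. eps n M (s' i) (T i))" if s': "s' \<in> Tables d M n" for s'
  proof -
    have "(\<Sum>s\<in>Tables d M n. (\<Prod>i<d. eps n M (s i) (T i)) * (\<Prod>i<d. \<Prod>j<M. A i $$ (s i j, s' i j)))
        = (\<Sum>s\<in>Tables d M n. \<Prod>i<d. eps n M (s i) (T i) * (\<Prod>j<M. A i $$ (s i j, s' i j)))"
      by (simp only: prod.distrib)
    also have "\<dots> = (\<Prod>i<d. \<Sum>a\<in>Maps M n. eps n M a (T i) * (\<Prod>j<M. A i $$ (a j, s' i j)))"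
      by (rule prod_sum_PiE[symmetric]) auto
    also have "\<dots> = (\<Prod>i<d. eps n M (s' i) (T i))"
    proof (rule prod.cong[OF refl])
      fix i assume "i \<in> {..<d}"
      then have i: "i < d" by simp
      have "A i \<in> carrier_mat n n" "det (A i) = 1" using A i by (auto simp: SL_def)
      then show "(\<Sum>a\<in>Maps M n. eps n M a (T i) * (\<Prod>j<M. A i $$ (a j, s' i j))) = eps n M (s' i) (T i)"
        using eps_transform[OF n M, of "A i" "s' i" "T i"] TablesD(2)[OF s' i] TablesD(2)[OF T i] by simp
    qed
    finally show ?thesis .
  qed
  then show "form n d M (\<lambda>s. \<Prod>i<d. eps n M (s i) (T i)) (tensor_act n d A X)
      = form n d M (\<lambda>s. \<Prod>i<d. eps n M (s i) (T i)) X"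
    unfolding form_tensor_act by (rule fun_cong[OF form_cong])
qed

text \<open>The constants of \<open>row_sgn_eq_eps\<close> multiply over the rows to a nonzero
  factor that depends on the table alone.\<close>

lemma Delta_eq_form:
  assumes n: "n > 0" and len: "length T = n * k" and T: "\<And>j. j < n * k \<Longrightarrow> T ! j \<in> multi_idx k d"
    and bal: "\<And>i b. i < d \<Longrightarrow> b < k \<Longrightarrow> card {j. j < n * k \<and> T ! j ! i = b} = n"
  obtains \<kappa> :: complex where "\<kappa> \<noteq> 0"
    and "\<And>X. Delta n d T X
          = \<kappa> * form n d (n * k) (\<lambda>s. \<Prod>i<d. eps n (n * k) (s i) (table_of d (n * k) ((!) T) i)) X"
proof -
  let ?M = "n * k" and ?T = "table_of d (n * k) ((!) T)"
  have "\<exists>\<kappa> :: complex. \<kappa> \<noteq> 0 \<and> (\<forall>s. (\<forall>j<?M. s j < n) \<longrightarrow>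
          of_int (row_sgn n T i s) = \<kappa> * eps n ?M s (?T i))" if i: "i < d" for i
  proof -
    have "length (filter (\<lambda>j. T ! j ! i = b) [0..<?M]) = n" if "b < k" for b
      using bal[OF i that] by (simp add: length_filter_conv_card atLeast0LessThan conj_commute cong: conj_cong)
    then obtain \<kappa> :: complex where \<kappa>: "\<kappa> \<noteq> 0" "\<And>s. (\<And>j. j < ?M \<Longrightarrow> s j < n) \<Longrightarrow>
           of_int (row_sgn n T i s) = \<kappa> * eps n ?M s (\<lambda>j. T ! j ! i)"
      using row_sgn_eq_eps[OF n len] multi_idx_nth[OF T i] by metis
    have "eps n ?M s (\<lambda>j. T ! j ! i) = eps n ?M s (?T i)" for s
      using i by (intro eps_cong) (simp_all add: table_of_def)
    with \<kappa> show ?thesis by metis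
  qed
  then obtain \<kappa> :: "nat \<Rightarrow> complex" where \<kappa>0: "\<And>i. i < d \<Longrightarrow> \<kappa> i \<noteq> 0"
    and \<kappa>: "\<And>i s. i < d \<Longrightarrow> (\<And>j. j < ?M \<Longrightarrow> s j < n) \<Longrightarrow>
          of_int (row_sgn n T i s) = \<kappa> i * eps n ?M s (?T i)"
    by metis
  have "Delta n d T X = (\<Prod>i<d. \<kappa> i) * form n d ?M (\<lambda>s. \<Prod>i<d. eps n ?M (s i) (?T i)) X" for X
  proof -
    have "Delta n d T X = (\<Sum>s\<in>Tables d ?M n. (\<Prod>i<d. \<kappa> i) *
        ((\<Prod>i<d. eps n ?M (s i) (?T i)) * (\<Prod>j<?M. X (columns d ?M s j))))"
      unfolding Delta_def len
    proof (rule sum.cong[OF refl])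
      fix s assume s: "s \<in> Tables d ?M n"
      have "of_int (\<Prod>i<d. row_sgn n T i (s i)) = (\<Prod>i<d. \<kappa> i * eps n ?M (s i) (?T i))"
        unfolding of_int_prod using \<kappa> TablesD(2)[OF s] by (intro prod.cong refl) simp
      then show "of_int (\<Prod>i<d. row_sgn n T i (s i)) * (\<Prod>j<?M. X (map (\<lambda>i. s i j) [0..<d]))
          = (\<Prod>i<d. \<kappa> i) * ((\<Prod>i<d. eps n ?M (s i) (?T i)) * (\<Prod>j<?M. X (columns d ?M s j)))"
        by (simp add: prod.distrib columns_def)
    qed
    then show ?thesis by (simp only: form_def sum_distrib_left)
  qed
  moreover have "(\<Prod>i<d. \<kappa> i) \<noteq> 0" using \<kappa>0 by simp
  ultimately show ?thesis using that by blast
qed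

text \<open>
  If the form of \<open>T0\<close> vanished, so would those of all tables \<open>T\<close>; then \<open>\<Sum>\<^sub>T u T \<cdot> \<Prod>\<^sub>i eps (s i) (T i)\<close>
  is zero as a form in \<open>s\<close>, and \<open>u = 0\<close> by the same duality with the roles of \<open>n\<close> and \<open>k\<close> exchanged.
\<close>

lemma form_canonical_nonzero:
  assumes n: "n > 0" and k: "k > 0" and d: "odd d" and T0: "canonical_table n k d T0"
    and u: "slotwise_invariant k d (n * k) u"
    and anti: "\<And>\<pi> T. \<pi> permutes {..<n * k} \<Longrightarrow> T \<in> Tables d (n * k) k \<Longrightarrow>
                  u (permute_columns d \<pi> T) = of_int (sign \<pi>) * u T"
    and T1: "T1 \<in> Tables d (n * k) k" and nz: "u T1 \<noteq> 0"
  shows "form n d (n * k) (\<lambda>s. \<Prod>i<d. eps n (n * k) (s i) (T0 i)) \<noteq> 0"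
proof
  let ?M = "n * k"
  assume "form n d ?M (\<lambda>s. \<Prod>i<d. eps n ?M (s i) (T0 i)) = 0"
  then have "pairing n d ?M (monomial_coeff d ?M X) T0 = 0" for X
    by (simp add: pairing_monomial_coeff zero_fun_def)
  then have all0: "pairing n d ?M (monomial_coeff d ?M X) T = 0" if "T \<in> Tables d ?M k" for X T
    using pairing_canonical_eq_0[OF n d T0 symmetric_monomial_coeff _ that] by blast
  define w where "w s = (\<Sum>T\<in>Tables d ?M k. u T * (\<Prod>i<d. eps n ?M (s i) (T i)))" for s
  have "form n d ?M w X = (\<Sum>T\<in>Tables d ?M k. u T * pairing n d ?M (monomial_coeff d ?M X) T)" for X
    unfolding pairing_monomial_coeff form_def w_def sum_distrib_left sum_distrib_right mult.assoc
    by (rule sum.swap)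
  then have w_form: "form n d ?M w X = 0" for X
    using all0 by simp
  have "symmetric_coeff n d ?M w"
    unfolding symmetric_coeff_def
  proof (intro allI impI)
    fix \<pi> s assume \<pi>: "\<pi> permutes {..<?M}"
    \<comment> \<open>One sign comes from u and d signs from the rows of \<open>eps\<close>; d + 1
      is even.\<close>
    have sgn: "of_int (sign \<pi>) * of_int (sign \<pi>) ^ d = (1 :: complex)"
      using d by (cases \<pi> rule: sign_cases) simp_all
    have "w (permute_columns d \<pi> s) = (\<Sum>T\<in>Tables d ?M k. u (permute_columns d \<pi> T) *
        (\<Prod>i<d. eps n ?M (permute_columns d \<pi> s i) (permute_columns d \<pi> T i)))"
      unfolding w_def by (rule sum_permute_columns[OF \<pi>, symmetric])
    also have "\<dots> = w s"
      unfolding w_def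
    proof (rule sum.cong[OF refl])
      fix T assume T: "T \<in> Tables d ?M k"
      have "(\<Prod>i<d. eps n ?M (permute_columns d \<pi> s i) (permute_columns d \<pi> T i))
          = (\<Prod>i<d. of_int (sign \<pi>) * eps n ?M (s i) (T i))"
        by (intro prod.cong refl)
          (simp only: permute_columns_def restrict_apply if_True eps_comp_permutes[OF \<pi>])
      then have "u (permute_columns d \<pi> T) * (\<Prod>i<d. eps n ?M (permute_columns d \<pi> s i) (permute_columns d \<pi> T i))
          = (of_int (sign \<pi>) * of_int (sign \<pi>) ^ d) * (u T * (\<Prod>i<d. eps n ?M (s i) (T i)))"
        by (simp add: anti[OF \<pi> T] prod.distrib)
      then show "u (permute_columns d \<pi> T) * (\<Prod>i<d. eps n ?M (permute_columns d \<pi> s i) (permute_columns d \<pi> T i))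
          = u T * (\<Prod>i<d. eps n ?M (s i) (T i))" by (simp only: sgn mult_1)
    qed
    finally show "w (permute_columns d \<pi> s) = w s" .
  qed
  then have w0: "w s = 0" if "s \<in> Tables d ?M n" for s
    using form_eq_0_imp w_form that by blast
  obtain \<kappa> :: complex where
    \<kappa>: "\<And>s t. (\<And>j. j < ?M \<Longrightarrow> s j < n \<and> t j < k) \<Longrightarrow> eps k ?M t s = \<kappa> * eps n ?M s t"
    using eps_swap[OF n k refl] by metis
  \<comment> \<open>Read with n and k exchanged, the coefficient w s is the pairing of u with the
    table s, up to the factor \<kappa> ^ d.\<close>
  have "pairing k d ?M u s = 0" if s: "s \<in> Tables d ?M n" for s
  proof -
    have "pairing k d ?M u s = (\<Sum>T\<in>Tables d ?M k. u T * (\<Prod>i<d. \<kappa> * eps n ?M (s i) (T i)))"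
      unfolding pairing_def
    proof (rule sum.cong[OF refl])
      fix T assume T: "T \<in> Tables d ?M k"
      have "eps k ?M (T i) (s i) = \<kappa> * eps n ?M (s i) (T i)" if "i < d" for i
        using TablesD(2)[OF s that] TablesD(2)[OF T that] by (intro \<kappa>) blast
      then show "u T * (\<Prod>i<d. eps k ?M (T i) (s i)) = u T * (\<Prod>i<d. \<kappa> * eps n ?M (s i) (T i))"
        by simp
    qed
    also have "\<dots> = \<kappa> ^ d * w s"
      by (simp add: w_def prod.distrib sum_distrib_left mult.left_commute)
    finally show ?thesis using w0[OF s] by simp
  qed
  then have "u T1 = 0"
    using slotwise_invariant_eq_0[OF k mult.commute u _ T1] by blast
  with nz show False ..
qed

lemma span_singleton_eq: "poly_space.span {f} = range (\<lambda>c X. c * f X)"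
  by (rule poly_space.span_singleton)

lemma dim_span_singleton:
  assumes "f \<noteq> 0"
  shows "poly_space.dim (poly_space.span {f}) = 1"
  using poly_space.dim_span_eq_card_independent[of "{f}"] assms by simp

text \<open>The pairing at the canonical table is a linear functional whose vanishing forces a
  symmetric slotwise invariant family to vanish. The invariants therefore form at most a line, which
  the nonzero Delta spans.\<close>

theorem invariants_canonical:
  assumes n: "n > 0" and d: "odd d"
    and len: "length T = n * k" and T: "\<And>j. j < n * k \<Longrightarrow> T ! j \<in> multi_idx k d"
    and bal: "\<And>i b. i < d \<Longrightarrow> b < k \<Longrightarrow> card {j. j < n * k \<and> T ! j ! i = b} = n"
    and can: "canonical_table n k d (table_of d (n * k) ((!) T))"
    and nz: "form n d (n * k) (\<lambda>s. \<Prod>i<d. eps n (n * k) (s i) (table_of d (n * k) ((!) T) i)) \<noteq> 0"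
  shows "Delta n d T \<noteq> 0"
    and "invariants n d (n * k) = poly_space.span {Delta n d T}"
proof -
  let ?M = "n * k" and ?T = "table_of d (n * k) ((!) T)"
  let ?F = "form n d (n * k) (\<lambda>s. \<Prod>i<d. eps n (n * k) (s i) (?T i))"
  obtain \<kappa> :: complex where \<kappa>: "\<kappa> \<noteq> 0" and Delta: "\<And>X. Delta n d T X = \<kappa> * ?F X"
    using Delta_eq_form[OF n len T bal] by blast
  show "Delta n d T \<noteq> 0"
  proof
    assume "Delta n d T = 0"
    then have "?F X = 0" for X using Delta[of X] \<kappa> by (simp add: zero_fun_def)
    with nz show False by (simp add: fun_eq_iff zero_fun_def)
  qed
  have T_in: "?T \<in> Tables d ?M k" using can by (simp add: canonical_table_def)
  have F_inv: "?F \<in> invariants n d ?M" by (rule form_eps_in_invariants[OF n refl T_in])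
  \<comment> \<open>The products of \<open>eps\<close> need not be symmetric under reordering the
    columns of s, so the same polynomial is written with symmetric coefficients.\<close>
  obtain c0 where c0: "symmetric_coeff n d ?M c0" "slotwise_invariant n d ?M c0" and F: "?F = form n d ?M c0"
    using invariants_imp_form[OF F_inv] .
  have vanish: "form n d ?M c X = 0"
    if "symmetric_coeff n d ?M c" "slotwise_invariant n d ?M c" "pairing n d ?M c ?T = 0" for c X
  proof -
    have "c s = 0" if s: "s \<in> Tables d ?M n" for s
      using slotwise_invariant_eq_0[OF n refl \<open>slotwise_invariant n d ?M c\<close> _ s]
        pairing_canonical_eq_0[OF n d can \<open>symmetric_coeff n d ?M c\<close> \<open>pairing n d ?M c ?T = 0\<close>] by blast
    then show ?thesis by (simp add: form_def)
  qed
  have b0: "pairing n d ?M c0 ?T \<noteq> 0"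
  proof
    assume "pairing n d ?M c0 ?T = 0"
    then have "?F = 0" unfolding F using vanish[OF c0] by (simp add: fun_eq_iff zero_fun_def)
    with nz show False ..
  qed
  show "invariants n d ?M = poly_space.span {Delta n d T}"
    unfolding span_singleton_eq
  proof
    show "range (\<lambda>c X. c * Delta n d T X) \<subseteq> invariants n d ?M"
    proof clarify
      fix c :: complex
      have "(\<lambda>X. c * Delta n d T X) = form n d ?M (\<lambda>s. (c * \<kappa>) * c0 s)"
        unfolding fun_eq_iff Delta F form_scale by simp
      moreover have "(c * \<kappa>) * ?F (tensor_act n d A X) = (c * \<kappa>) * ?F X" if "\<forall>i<d. A i \<in> SL n" for A X
        using F_inv that by (simp add: invariants_def)
      ultimately show "(\<lambda>X. c * Delta n d T X) \<in> invariants n d ?M"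
        unfolding invariants_def mem_Collect_eq using homogeneous_poly_form[of n d ?M "\<lambda>s. (c * \<kappa>) * c0 s"]
        by (simp add: Delta)
    qed
    show "invariants n d ?M \<subseteq> range (\<lambda>c X. c * Delta n d T X)"
    proof
      fix f assume "f \<in> invariants n d ?M"
      then obtain c where c: "symmetric_coeff n d ?M c" "slotwise_invariant n d ?M c" and f: "f = form n d ?M c"
        by (rule invariants_imp_form)
      define a where "a = pairing n d ?M c ?T / pairing n d ?M c0 ?T"
      let ?c = "\<lambda>s. c s - a * c0 s"
      have "symmetric_coeff n d ?M ?c" using c(1) c0(1) by (simp add: symmetric_coeff_def)
      moreover have "slotwise_invariant n d ?M ?c"
        unfolding slotwise_invariant_def sl_invariant_def
      proof (intro allI impI ballI)
        fix i s g b assume asm: "i < d" "s \<in> Tables d ?M n" "g \<in> SL n" "b \<in> Maps ?M n"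
        have "(\<Sum>x\<in>Maps ?M n. ?c (s(i := x)) * (\<Prod>j<?M. g $$ (x j, b j)))
            = (\<Sum>x\<in>Maps ?M n. c (s(i := x)) * (\<Prod>j<?M. g $$ (x j, b j)))
            - a * (\<Sum>x\<in>Maps ?M n. c0 (s(i := x)) * (\<Prod>j<?M. g $$ (x j, b j)))"
          unfolding left_diff_distrib sum_subtractf sum_distrib_left by (simp only: mult.assoc)
        then show "(\<Sum>x\<in>Maps ?M n. ?c (s(i := x)) * (\<Prod>j<?M. g $$ (x j, b j))) = ?c (s(i := b))"
          using c(2) c0(2) asm by (simp only: slotwise_invariant_def sl_invariant_def)
      qed
      moreover have "pairing n d ?M ?c ?T = 0"
      proof -
        have "pairing n d ?M ?c ?T = pairing n d ?M c ?T - a * pairing n d ?M c0 ?T"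
          unfolding pairing_def left_diff_distrib sum_subtractf sum_distrib_left by (simp only: mult.assoc)
        then show ?thesis using b0 by (simp add: a_def)
      qed
      ultimately have "form n d ?M ?c X = 0" for X by (rule vanish)
      then have "f X = a * ?F X" for X
        unfolding f F form_diff form_scale by simp
      then have "f = (\<lambda>X. (a / \<kappa>) * Delta n d T X)" using \<kappa> by (simp add: fun_eq_iff Delta)
      then show "f \<in> range (\<lambda>c X. c * Delta n d T X)" by blast
    qed
  qed
qed

lemma min_degree_eqI:
  assumes "m > 0" and "f \<in> invariants n d m" and "f \<noteq> 0"
    and "\<And>f m'. f \<in> invariants n d m' \<Longrightarrow> f \<noteq> 0 \<Longrightarrow> m' > 0 \<Longrightarrow> m \<le> m'"
  shows "min_degree d n = m"
  unfolding min_degree_def by (rule Least_equality) (use assms in blast)+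

section \<open>Alternating invariant tensors\<close>

definition delete_nth :: "nat \<Rightarrow> 'a list \<Rightarrow> 'a list" where
  "delete_nth i c = take i c @ drop (Suc i) c"

lemma delete_nth_in:
  assumes "c \<in> multi_idx k d" "i < d"
  shows "delete_nth i c \<in> multi_idx k (d - 1)"
  using assms set_take_subset[of i c] set_drop_subset[of "Suc i" c]
  by (auto simp: multi_idx_def delete_nth_def)

lemma delete_nth_eq_imp:
  assumes "length c = d" "length c' = d" "i < d" "c ! i = c' ! i" "delete_nth i c = delete_nth i c'"
  shows "c = c'"
proof -
  have "take i c = take i c'" "drop (Suc i) c = drop (Suc i) c'"
    using assms by (simp_all add: delete_nth_def)
  then show ?thesis using id_take_nth_drop[of i c] id_take_nth_drop[of i c'] assms by simp
qed

text \<open>For K = k ^ d and a bijective \<open>code\<close>, this is the volume form on the d-th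
  tensor power of \<complex>^k, evaluated at the basis tensors named by the columns;
  \<open>code\<close> orders that basis.\<close>

definition col_sgn :: "nat \<Rightarrow> nat \<Rightarrow> (nat list \<Rightarrow> nat) \<Rightarrow> (nat \<Rightarrow> nat \<Rightarrow> nat) \<Rightarrow> complex" where
  "col_sgn d K code T = map_sgn K (\<lambda>j. code (columns d K T j))"

lemma col_sgn_permute_columns:
  assumes "\<pi> permutes {..<K}"
  shows "col_sgn d K code (permute_columns d \<pi> T) = of_int (sign \<pi>) * col_sgn d K code T"
proof -
  have "col_sgn d K code (permute_columns d \<pi> T) = map_sgn K ((\<lambda>j. code (columns d K T j)) \<circ> \<pi>)"
    unfolding col_sgn_def
  proof (rule map_sgn_cong)
    fix j assume "j < K"
    then have "columns d K (permute_columns d \<pi> T) j = columns d K T (\<pi> j)"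
      using permutes_in_image[OF assms, of j] by (simp add: columns_def permute_columns_def)
    then show "code (columns d K (permute_columns d \<pi> T) j) = ((\<lambda>j. code (columns d K T j)) \<circ> \<pi>) j"
      by simp
  qed
  then show ?thesis by (simp only: map_sgn_comp_right[OF assms] col_sgn_def)
qed

lemma col_sgn_nonzero_imp_inj:
  assumes "col_sgn d K code T \<noteq> 0"
  shows "inj_on (columns d K T) {..<K}"
proof -
  have "inj_on (\<lambda>j. code (columns d K T j)) {..<K}"
    using assms by (simp add: col_sgn_def map_sgn_nonzero_iff bij_betw_def)
  then show ?thesis by (auto simp: inj_on_def)
qed

lemma col_sgn_nonzero:
  assumes code: "bij_betw code (multi_idx k d) {..<k ^ d}"
    and T: "T \<in> Tables d (k ^ d) k" and inj: "inj_on (columns d (k ^ d) T) {..<k ^ d}"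
  shows "col_sgn d (k ^ d) code T \<noteq> 0"
proof -
  let ?K = "k ^ d"
  have sub: "columns d ?K T ` {..<?K} \<subseteq> multi_idx k d" using PiE_mem[OF columns_in[OF T]] by blast
  then have "columns d ?K T ` {..<?K} = multi_idx k d"
    by (rule card_subset_eq[OF finite_multi_idx]) (simp add: card_image[OF inj] card_multi_idx)
  then have "bij_betw (columns d ?K T) {..<?K} (multi_idx k d)" using inj by (simp add: bij_betw_def)
  from bij_betw_trans[OF this code] show ?thesis
    by (simp add: col_sgn_def map_sgn_nonzero_iff o_def)
qed

lemma ex_code: "\<exists>code. bij_betw code (multi_idx k d) {..<k ^ d}"
  using ex_bij_betw_finite_nat[OF finite_multi_idx, of k d] by (simp add: card_multi_idx lessThan_atLeast0)

text \<open>
  Reading a column as the pair of its \<open>i\<close>-th entry and the rest turns \<open>col_sgn\<close> into a multiple of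
  \<open>eps\<close> in row \<open>i\<close>.
\<close>

lemma slotwise_invariant_col_sgn:
  assumes k: "k > 0" and code: "bij_betw code (multi_idx k d) {..<k ^ d}"
  shows "slotwise_invariant k d (k ^ d) (col_sgn d (k ^ d) code)"
  unfolding slotwise_invariant_def sl_invariant_def
proof (intro allI impI ballI)
  let ?K = "k ^ d"
  fix i T g b assume i: "i < d" and T: "T \<in> Tables d ?K k" and g: "g \<in> SL k" and b: "b \<in> Maps ?K k"
  have K: "?K = k * k ^ (d - 1)" using i by (metis power_eq_if less_nat_zero_code)
  obtain h where h: "bij_betw h (multi_idx k (d - 1)) {..<k ^ (d - 1)}" using ex_code by blast
  let ?r = "\<lambda>c. h (delete_nth i c)"
  have r: "?r c < k ^ (d - 1)" if "c \<in> multi_idx k d" for c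
    using bij_betwE[OF h] delete_nth_in[OF that i] by simp
  have "bij_betw (\<lambda>c. ?r c * k + c ! i) (multi_idx k d) {..<?K}"
  proof -
    have inj: "inj_on (\<lambda>c. ?r c * k + c ! i) (multi_idx k d)"
    proof (rule inj_onI)
      fix c c' assume c: "c \<in> multi_idx k d" "c' \<in> multi_idx k d" and eq: "?r c * k + c ! i = ?r c' * k + c' ! i"
      have lt: "c ! i < k" "c' ! i < k" using multi_idx_nth c i by auto
      have "?r c = ?r c'" "c ! i = c' ! i"
        using arg_cong[OF eq, of "\<lambda>x. x div k"] arg_cong[OF eq, of "\<lambda>x. x mod k"] lt k by simp_all
      moreover then have "delete_nth i c = delete_nth i c'"
        using bij_betw_imp_inj_on[OF h] delete_nth_in[OF c(1) i] delete_nth_in[OF c(2) i]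
        by (simp add: inj_on_eq_iff)
      moreover have "length c = d" "length c' = d" using c by (auto simp: multi_idx_def)
      ultimately show "c = c'" using delete_nth_eq_imp i by metis
    qed
    have "(\<lambda>c. ?r c * k + c ! i) ` multi_idx k d \<subseteq> {..<?K}"
      using pair_code_less[OF multi_idx_nth[OF _ i] r] unfolding K by blast
    then have "(\<lambda>c. ?r c * k + c ! i) ` multi_idx k d = {..<?K}"
      by (rule card_subset_eq[OF finite_lessThan]) (simp add: card_image[OF inj] card_multi_idx)
    with inj show ?thesis by (simp add: bij_betw_def)
  qed
  from map_sgn_recode[OF code this] obtain \<kappa> :: complex where
    \<kappa>: "\<And>f. (\<And>j. j < ?K \<Longrightarrow> f j \<in> multi_idx k d) \<Longrightarrow>
      map_sgn ?K (\<lambda>j. code (f j)) = \<kappa> * map_sgn ?K (\<lambda>j. ?r (f j) * k + f j ! i)"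
    by metis
  \<comment> \<open>The code of a column without its i-th entry: it reads only the other rows and is
    unchanged when row i is replaced.\<close>
  define \<rho> where "\<rho> j = ?r (columns d ?K T j)" for j
  have col: "columns d ?K T j \<in> multi_idx k d" if "j < ?K" for j
    using PiE_mem[OF columns_in[OF T]] that by simp
  have \<rho>: "\<rho> j < k ^ (d - 1)" if "j < ?K" for j
    unfolding \<rho>_def using r col[OF that] by blast
  have eq: "col_sgn d ?K code (T(i := a)) = \<kappa> * eps k ?K a \<rho>" if a: "a \<in> Maps ?K k" for a
  proof -
    have col': "columns d ?K (T(i := a)) j \<in> multi_idx k d" if "j < ?K" for j
      using PiE_mem[OF columns_in[OF Tables_update[OF T a i]]] that by simp
    have "col_sgn d ?K code (T(i := a))
        = \<kappa> * map_sgn ?K (\<lambda>j. ?r (columns d ?K (T(i := a)) j) * k + columns d ?K (T(i := a)) j ! i)"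
      unfolding col_sgn_def by (rule \<kappa>) (rule col')
    also have "map_sgn ?K (\<lambda>j. ?r (columns d ?K (T(i := a)) j) * k + columns d ?K (T(i := a)) j ! i)
        = eps k ?K a \<rho>"
      unfolding eps_def
    proof (rule map_sgn_cong)
      fix j assume j: "j < ?K"
      have "delete_nth i (columns d ?K (T(i := a)) j) = delete_nth i (columns d ?K T j)"
        using i j by (intro nth_equalityI) (auto simp: delete_nth_def columns_def nth_append)
      then show "?r (columns d ?K (T(i := a)) j) * k + columns d ?K (T(i := a)) j ! i = \<rho> j * k + a j"
        using i j by (simp add: \<rho>_def columns_def)
    qed
    finally show ?thesis .
  qed
  have "(\<Sum>a\<in>Maps ?K k. col_sgn d ?K code (T(i := a)) * (\<Prod>j<?K. g $$ (a j, b j)))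
      = \<kappa> * (\<Sum>a\<in>Maps ?K k. eps k ?K a \<rho> * (\<Prod>j<?K. g $$ (a j, b j)))"
    by (simp add: eq sum_distrib_left mult.assoc)
  also have "\<dots> = \<kappa> * eps k ?K b \<rho>"
    using eps_transform[OF k K, of g b \<rho>] g \<rho> PiE_mem[OF b] by (simp add: SL_def)
  also have "\<dots> = col_sgn d ?K code (T(i := b))" by (simp only: eq[OF b])
  finally show "(\<Sum>a\<in>Maps ?K k. col_sgn d ?K code (T(i := a)) * (\<Prod>j<?K. g $$ (a j, b j)))
      = col_sgn d ?K code (T(i := b))" .
qed

section \<open>Contraction of k columns with a determinant in each row\<close>

definition cat :: "nat \<Rightarrow> nat \<Rightarrow> (nat \<Rightarrow> nat) \<Rightarrow> (nat \<Rightarrow> nat) \<Rightarrow> nat \<Rightarrow> nat" where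
  "cat M p a x = (\<lambda>j\<in>{..<M + p}. if j < M then a j else x (j - M))"

lemma cat_in: "a \<in> Maps M k \<Longrightarrow> x \<in> Maps p k \<Longrightarrow> cat M p a x \<in> Maps (M + p) k"
  by (auto simp: cat_def PiE_iff)

lemma sum_cat: "(\<Sum>y\<in>Maps (M + p) k. f y) = (\<Sum>a\<in>Maps M k. \<Sum>x\<in>Maps p k. f (cat M p a x))"
proof -
  have "(\<Sum>y\<in>Maps (M + p) k. f y) = (\<Sum>z\<in>Maps M k \<times> Maps p k. f (cat M p (fst z) (snd z)))"
  proof (rule sum.reindex_bij_witness[of _ "\<lambda>z. cat M p (fst z) (snd z)"
        "\<lambda>y. (restrict y {..<M}, \<lambda>j\<in>{..<p}. y (M + j))"])
    fix y assume y: "y \<in> Maps (M + p) k"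
    have yk: "y j < k" if "j < M + p" for j using PiE_mem[OF y, of j] that by simp
    have arb: "y j = undefined" if "\<not> j < M + p" for j using PiE_arb[OF y, of j] that by simp
    have "restrict y {..<M} \<in> Maps M k" "(\<lambda>j\<in>{..<p}. y (M + j)) \<in> Maps p k"
      by (simp_all add: yk)
    then show "(restrict y {..<M}, \<lambda>j\<in>{..<p}. y (M + j)) \<in> Maps M k \<times> Maps p k"
      by (rule SigmaI)
    show c: "cat M p (fst (restrict y {..<M}, \<lambda>j\<in>{..<p}. y (M + j))) (snd (restrict y {..<M}, \<lambda>j\<in>{..<p}. y (M + j))) = y"
    proof
      fix j
      have "j - M < p" if "j < M + p" "\<not> j < M" using that by arith
      then show "cat M p (fst (restrict y {..<M}, \<lambda>j\<in>{..<p}. y (M + j))) (snd (restrict y {..<M}, \<lambda>j\<in>{..<p}. y (M + j))) j = y j"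
        using arb[of j] by (cases "j < M + p"; cases "j < M") (simp_all add: cat_def)
    qed
    show "f (cat M p (fst (restrict y {..<M}, \<lambda>j\<in>{..<p}. y (M + j)))
        (snd (restrict y {..<M}, \<lambda>j\<in>{..<p}. y (M + j)))) = f y" by (simp only: c)
  next
    fix z assume "z \<in> Maps M k \<times> Maps p k"
    then obtain a x where z: "z = (a, x)" and a: "a \<in> Maps M k" and x: "x \<in> Maps p k" by (rule SigmaE)
    show "cat M p (fst z) (snd z) \<in> Maps (M + p) k" using cat_in[OF a x] by (simp only: z fst_conv snd_conv)
    have "restrict (cat M p a x) {..<M} = a"
    proof
      fix j show "restrict (cat M p a x) {..<M} j = a j"
        using PiE_arb[OF a, of j] by (cases "j < M") (simp_all add: cat_def)
    qed
    moreover have "(\<lambda>j\<in>{..<p}. cat M p a x (M + j)) = x"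
    proof
      fix j show "(\<lambda>j\<in>{..<p}. cat M p a x (M + j)) j = x j"
        using PiE_arb[OF x, of j] by (cases "j < p") (simp_all add: cat_def)
    qed
    ultimately show "(restrict (cat M p (fst z) (snd z)) {..<M}, \<lambda>j\<in>{..<p}. cat M p (fst z) (snd z) (M + j)) = z"
      by (simp only: z fst_conv snd_conv)
  qed
  then show ?thesis by (simp add: sum.cartesian_product case_prod_beta)
qed

lemma prod_lessThan_add:
  fixes f :: "nat \<Rightarrow> complex"
  shows "(\<Prod>j<M + p. f j) = (\<Prod>j<M. f j) * (\<Prod>j<p. f (M + j))"
  by (induction p) (simp_all add: mult.assoc)

text \<open>The determinant form on the last k slots is itself unchanged by SL, so contracting with
  it leaves invariance in the first M slots.\<close>

lemma sl_invariant_contraction: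
  assumes k: "k > 0" and V: "sl_invariant k (M + k) V"
  shows "sl_invariant k M (\<lambda>a. \<Sum>x\<in>Maps k k. map_sgn k x * V (cat M k a x))"
  unfolding sl_invariant_def
proof (intro ballI)
  fix g b assume g: "g \<in> SL k" and b: "b \<in> Maps M k"
  have gc: "g \<in> carrier_mat k k" "det g = 1" using g by (auto simp: SL_def)
  \<comment> \<open>Here the second index of g is summed, so \<open>eps_transform\<close> is applied
    to the transpose, with a single block of size k and t = 0.\<close>
  have row: "(\<Sum>x\<in>Maps k k. map_sgn k x * (\<Prod>j<k. g $$ (x' j, x j))) = map_sgn k x'"
    if x': "x' \<in> Maps k k" for x'
  proof -
    have "(\<Sum>x\<in>Maps k k. map_sgn k x * (\<Prod>j<k. g $$ (x' j, x j)))
        = (\<Sum>x\<in>Maps k k. eps k k x (\<lambda>_. 0) * (\<Prod>j<k. transpose_mat g $$ (x j, x' j)))"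
    proof (rule sum.cong[OF refl])
      fix x assume x: "x \<in> Maps k k"
      have "(\<Prod>j<k. g $$ (x' j, x j)) = (\<Prod>j<k. transpose_mat g $$ (x j, x' j))"
        using PiE_mem[OF x] PiE_mem[OF x'] gc by (intro prod.cong refl) auto
      then show "map_sgn k x * (\<Prod>j<k. g $$ (x' j, x j))
          = eps k k x (\<lambda>_. 0) * (\<Prod>j<k. transpose_mat g $$ (x j, x' j))"
        by (simp add: eps_def)
    qed
    also have "\<dots> = det (transpose_mat g) ^ 1 * eps k k x' (\<lambda>_. 0)"
      using gc PiE_mem[OF x'] by (intro eps_transform[OF k, of k 1]) auto
    finally show ?thesis using gc by (simp add: det_transpose eps_def)
  qed
  have gcat: "(\<Prod>j<M + k. g $$ (cat M k a x' j, cat M k b x j))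
      = (\<Prod>j<M. g $$ (a j, b j)) * (\<Prod>j<k. g $$ (x' j, x j))" for a x x'
    unfolding prod_lessThan_add by (simp add: cat_def)
  have "(\<Sum>x\<in>Maps k k. map_sgn k x * V (cat M k b x))
      = (\<Sum>x\<in>Maps k k. map_sgn k x *
          (\<Sum>y\<in>Maps (M + k) k. V y * (\<Prod>j<M + k. g $$ (y j, cat M k b x j))))"
    using V g cat_in[OF b] by (intro sum.cong refl) (simp add: sl_invariant_def)
  also have "\<dots> = (\<Sum>x\<in>Maps k k. \<Sum>a\<in>Maps M k. \<Sum>x'\<in>Maps k k.
      V (cat M k a x') * (\<Prod>j<M. g $$ (a j, b j)) * (map_sgn k x * (\<Prod>j<k. g $$ (x' j, x j))))"
    unfolding sum_cat gcat sum_distrib_left by (simp only: mult_ac)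
  also have "\<dots> = (\<Sum>a\<in>Maps M k. \<Sum>x\<in>Maps k k. \<Sum>x'\<in>Maps k k.
      V (cat M k a x') * (\<Prod>j<M. g $$ (a j, b j)) * (map_sgn k x * (\<Prod>j<k. g $$ (x' j, x j))))"
    by (rule sum.swap)
  also have "\<dots> = (\<Sum>a\<in>Maps M k. \<Sum>x'\<in>Maps k k. \<Sum>x\<in>Maps k k.
      V (cat M k a x') * (\<Prod>j<M. g $$ (a j, b j)) * (map_sgn k x * (\<Prod>j<k. g $$ (x' j, x j))))"
    by (intro sum.cong refl sum.swap)
  also have "\<dots> = (\<Sum>a\<in>Maps M k. \<Sum>x'\<in>Maps k k. V (cat M k a x') * (\<Prod>j<M. g $$ (a j, b j)) * map_sgn k x')"
    by (intro sum.cong refl) (simp only: sum_distrib_left[symmetric] row)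
  also have "\<dots> = (\<Sum>a\<in>Maps M k. (\<Sum>x\<in>Maps k k. map_sgn k x * V (cat M k a x)) * (\<Prod>j<M. g $$ (a j, b j)))"
    unfolding sum_distrib_right by (simp only: mult_ac)
  finally show "(\<Sum>a\<in>Maps M k. (\<Sum>x\<in>Maps k k. map_sgn k x * V (cat M k a x)) * (\<Prod>j<M. g $$ (a j, b j)))
      = (\<Sum>x\<in>Maps k k. map_sgn k x * V (cat M k b x))" ..
qed

definition append_columns :: "nat \<Rightarrow> nat \<Rightarrow> nat \<Rightarrow> (nat \<Rightarrow> nat \<Rightarrow> nat) \<Rightarrow> (nat \<Rightarrow> nat \<Rightarrow> nat) \<Rightarrow> nat \<Rightarrow> nat \<Rightarrow> nat" where
  "append_columns d M p T e = (\<lambda>i\<in>{..<d}. cat M p (T i) (e i))"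

lemma append_columns_in:
  "T \<in> Tables d M k \<Longrightarrow> e \<in> Tables d p k \<Longrightarrow> append_columns d M p T e \<in> Tables d (M + p) k"
  using cat_in TablesD(1) unfolding append_columns_def by (intro restrict_PiE_iff[THEN iffD2]) blast

definition contract :: "nat \<Rightarrow> nat \<Rightarrow> nat \<Rightarrow> ((nat \<Rightarrow> nat \<Rightarrow> nat) \<Rightarrow> complex) \<Rightarrow> (nat \<Rightarrow> nat \<Rightarrow> nat) \<Rightarrow> complex" where
  "contract k d M v T = (\<Sum>e\<in>Tables d k k. (\<Prod>i<d. map_sgn k (e i)) * v (append_columns d M k T e))"

lemma slotwise_invariant_contract:
  assumes k: "k > 0" and v: "slotwise_invariant k d (M + k) v"
  shows "slotwise_invariant k d M (contract k d M v)"
  unfolding slotwise_invariant_def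
proof (intro allI impI ballI)
  fix i T assume i: "i < d" and T: "T \<in> Tables d M k"
  let ?I = "{..<d} - {i}"
  define z where "z = (\<lambda>j\<in>{..<k}. 0 :: nat)"
  have z: "z \<in> Maps k k" using k by (simp add: z_def)
  define P where "P r = (\<Prod>l\<in>?I. map_sgn k (r l))" for r
  define J where "J r = append_columns d M k T (r(i := z))" for r
  have rz: "r(i := z) \<in> Tables d k k" if "r \<in> ?I \<rightarrow>\<^sub>E Maps k k" for r
  proof -
    have "insert i ?I = {..<d}" using i by auto
    then show ?thesis using PiE_fun_upd[OF z that, of i] by (simp only:)
  qed
  have eq: "contract k d M v (T(i := a))
      = (\<Sum>r\<in>?I \<rightarrow>\<^sub>E Maps k k. (\<Sum>x\<in>Maps k k. map_sgn k x * v ((J r)(i := cat M k a x))) * P r)" for a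
  proof -
    have "contract k d M v (T(i := a)) = (\<Sum>x\<in>Maps k k. \<Sum>r\<in>?I \<rightarrow>\<^sub>E Maps k k.
        (\<Prod>l<d. map_sgn k ((r(i := x)) l)) * v (append_columns d M k (T(i := a)) (r(i := x))))"
      unfolding contract_def using i by (intro sum_PiE_split) auto
    also have "\<dots> = (\<Sum>x\<in>Maps k k. \<Sum>r\<in>?I \<rightarrow>\<^sub>E Maps k k. map_sgn k x * v ((J r)(i := cat M k a x)) * P r)"
    proof (intro sum.cong refl)
      fix x r
      have "(\<Prod>l<d. map_sgn k ((r(i := x)) l)) = map_sgn k x * (\<Prod>l\<in>?I. map_sgn k ((r(i := x)) l))"
        using i by (subst prod.remove[of _ i]) auto
      also have "(\<Prod>l\<in>?I. map_sgn k ((r(i := x)) l)) = P r"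
        unfolding P_def by (intro prod.cong) auto
      moreover have "append_columns d M k (T(i := a)) (r(i := x)) = (J r)(i := cat M k a x)"
        using i by (auto simp: J_def append_columns_def fun_eq_iff restrict_def)
      ultimately show "(\<Prod>l<d. map_sgn k ((r(i := x)) l)) * v (append_columns d M k (T(i := a)) (r(i := x)))
          = map_sgn k x * v ((J r)(i := cat M k a x)) * P r" by simp
    qed
    finally show ?thesis by (subst (asm) sum.swap) (simp only: sum_distrib_right)
  qed
  show "sl_invariant k M (\<lambda>a. contract k d M v (T(i := a)))"
    unfolding eq
  proof (rule sl_invariant_sum[where c = "\<lambda>r a. \<Sum>x\<in>Maps k k. map_sgn k x * v ((J r)(i := cat M k a x))"])
    fix r assume "r \<in> ?I \<rightarrow>\<^sub>E Maps k k"
    then have "J r \<in> Tables d (M + k) k" unfolding J_def by (intro append_columns_in T rz)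
    then have "sl_invariant k (M + k) (\<lambda>y. v ((J r)(i := y)))"
      using v i unfolding slotwise_invariant_def by blast
    from sl_invariant_contraction[OF k this]
    show "sl_invariant k M (\<lambda>a. \<Sum>x\<in>Maps k k. map_sgn k x * v ((J r)(i := cat M k a x)))" .
  qed
qed

lemma append_permute_columns:
  assumes \<pi>: "\<pi> permutes {..<M}" and T: "T \<in> Tables d M k" and e: "e \<in> Tables d p k"
  shows "append_columns d M p (permute_columns d \<pi> T) e = permute_columns d \<pi> (append_columns d M p T e)"
proof -
  have \<pi>': "\<pi> permutes {..<M + p}" by (rule permutes_subset[OF \<pi>]) simp
  show ?thesis
  proof (rule Tables_eqI)
    show "append_columns d M p (permute_columns d \<pi> T) e \<in> Tables d (M + p) k"
      by (intro append_columns_in permute_columns_in \<pi> T e)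
    show "permute_columns d \<pi> (append_columns d M p T e) \<in> Tables d (M + p) k"
      by (intro append_columns_in permute_columns_in \<pi>' T e)
    fix i j assume i: "i < d" and j: "j < M + p"
    show "append_columns d M p (permute_columns d \<pi> T) e i j = permute_columns d \<pi> (append_columns d M p T e) i j"
    proof (cases "j < M")
      case True
      then have "\<pi> j < M" using permutes_in_image[OF \<pi>, of j] by simp
      then show ?thesis using True i by (simp add: append_columns_def permute_columns_def cat_def)
    next
      case False
      then have "\<pi> j = j" using permutes_not_in[OF \<pi>] by simp
      then show ?thesis using False i j by (simp add: append_columns_def permute_columns_def cat_def)
    qed
  qed
qed

lemma contract_permute_columns:
  assumes v: "\<And>\<pi> T. \<pi> permutes {..<M + k} \<Longrightarrow> v (permute_columns d \<pi> T) = of_int (sign \<pi>) * v T"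
    and \<pi>: "\<pi> permutes {..<M}" and T: "T \<in> Tables d M k"
  shows "contract k d M v (permute_columns d \<pi> T) = of_int (sign \<pi>) * contract k d M v T"
proof -
  have \<pi>': "\<pi> permutes {..<M + k}" by (rule permutes_subset[OF \<pi>]) simp
  have "contract k d M v (permute_columns d \<pi> T)
      = (\<Sum>e\<in>Tables d k k. of_int (sign \<pi>) * ((\<Prod>i<d. map_sgn k (e i)) * v (append_columns d M k T e)))"
    unfolding contract_def
    by (rule sum.cong[OF refl]) (simp only: append_permute_columns[OF \<pi> T] v[OF \<pi>'] mult.left_commute)
  then show ?thesis by (simp only: contract_def sum_distrib_left)
qed

text \<open>Lets a permutation of the k symbols act on the k appended column positions with the same
  sign.\<close>

lemma map_sgn_shift:
  assumes x: "bij_betw x {..<p} {..<p}"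
  shows "(\<lambda>j. if M \<le> j \<and> j < M + p then M + x (j - M) else j) permutes {..<M + p}"
    and "of_int (sign (\<lambda>j. if M \<le> j \<and> j < M + p then M + x (j - M) else j)) = map_sgn p x"
proof -
  let ?\<pi> = "\<lambda>j. if M \<le> j \<and> j < M + p then M + x (j - M) else j"
  let ?x = "\<lambda>j. if j < p then x j else j"
  have px: "?x permutes {..<p}" by (rule extend_permutes[OF x])
  have inj: "inj_on (\<lambda>j. M + j) {..<p}" by simp
  have im: "(\<lambda>j. M + j) ` {..<p} = {M..<M + p}"
  proof -
    have "y \<in> (\<lambda>j. M + j) ` {..<p}" if "M \<le> y" "y < M + p" for y
      using that by (intro image_eqI[of _ _ "y - M"]) auto
    then show ?thesis by auto
  qed
  have eq: "map_permutation {..<p} (\<lambda>j. M + j) ?x = ?\<pi>"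
  proof
    fix y
    show "map_permutation {..<p} (\<lambda>j. M + j) ?x y = ?\<pi> y"
    proof (cases "M \<le> y \<and> y < M + p")
      case True
      then have "inv_into {..<p} (\<lambda>j. M + j) y = y - M"
      proof -
        have "y - M \<in> {..<p}" "M + (y - M) = y" using True by auto
        with inv_into_f_f[OF inj this(1)] show ?thesis by simp
      qed
      then show ?thesis using True by (simp add: map_permutation_def restrict_id_def im) auto
    next
      case False
      then show ?thesis by (auto simp: map_permutation_def restrict_id_def im)
    qed
  qed
  have "bij_betw (\<lambda>j. M + j) {..<p} {M..<M + p}" using inj im by (simp add: bij_betw_def)
  from map_permutation_permutes[OF this px] have "?\<pi> permutes {M..<M + p}" by (simp only: eq)
  then show "?\<pi> permutes {..<M + p}" by (rule permutes_subset) auto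
  have "sign ?\<pi> = sign ?x"
    using sign_map_permutation[OF inj px] by (simp only: eq finite_lessThan)
  then show "of_int (sign ?\<pi>) = map_sgn p x" using x by (simp only: map_sgn_def if_True)
qed

text \<open>No cancellation occurs: every nonzero summand equals the one in which the constant
  columns are appended in increasing order, so the contraction is a positive multiple of a nonzero
  value.\<close>

lemma contract_nonzero:
  assumes d: "odd d" and K: "M + k = k ^ d" and code: "bij_betw code (multi_idx k d) {..<M + k}"
    and L: "length L = M" "distinct L" "set L = {c \<in> multi_idx k d. \<forall>a. c \<noteq> replicate d a}"
  shows "contract k d M (col_sgn d (M + k) code) (table_of d M ((!) L)) \<noteq> 0"
proof -
  define T where "T = table_of d M ((!) L)"
  define A where "A e = append_columns d M k T e" for e
  define v where "v = col_sgn d (M + k) code"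
  define e0 where "e0 = (\<lambda>i\<in>{..<d}. \<lambda>j\<in>{..<k}. j)"
  define summand where "summand e = (\<Prod>i<d. map_sgn k (e i)) * v (A e)" for e
  have d0: "d > 0" using d by (rule odd_pos)
  have Lj: "L ! j \<in> set L" "L ! j \<in> multi_idx k d" if "j < M" for j
    using nth_mem[of j L] that L by auto
  have T: "T \<in> Tables d M k"
    unfolding T_def table_of_def by (rule TablesI) (rule multi_idx_nth[OF Lj(2)])
  have e0: "e0 \<in> Tables d k k" unfolding e0_def by (rule TablesI)
  have A_in: "A e \<in> Tables d (M + k) k" if "e \<in> Tables d k k" for e
    unfolding A_def by (rule append_columns_in[OF T that])
  have colL: "columns d (M + k) (A e) j = L ! j" if "j < M" for e j
  proof (rule nth_equalityI)
    show len: "length (columns d (M + k) (A e) j) = length (L ! j)"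
      using Lj(2)[OF that] that by (simp add: columns_def multi_idx_def)
    fix i assume "i < length (columns d (M + k) (A e) j)"
    then show "columns d (M + k) (A e) j ! i = L ! j ! i"
      using that by (simp add: columns_def A_def append_columns_def cat_def T_def table_of_def)
  qed
  have cole: "columns d (M + k) (A e) (M + b) = map (\<lambda>i. e i b) [0..<d]" if "b < k" for e b
    using that by (simp add: columns_def A_def append_columns_def cat_def)
  have col0: "columns d (M + k) (A e0) (M + b) = replicate d b" if "b < k" for b
    using that unfolding cole[OF that] by (intro nth_equalityI) (simp_all add: e0_def)
  have new: "replicate d b \<noteq> L ! j" if "j < M" for b j
    using Lj(1)[OF that] unfolding L(3) by (metis (mono_tags, lifting) mem_Collect_eq)
  have "inj_on (columns d (M + k) (A e0)) {..<M + k}"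
  proof (rule linorder_inj_onI)
    fix j j' assume "j < j'" and jj: "j \<in> {..<M + k}" "j' \<in> {..<M + k}"
    show "columns d (M + k) (A e0) j \<noteq> columns d (M + k) (A e0) j'"
    proof (cases "j' < M")
      case True
      then show ?thesis using \<open>j < j'\<close> L(1,2) by (simp add: colL nth_eq_iff_index_eq)
    next
      case False
      then obtain b' where b': "j' = M + b'" "b' < k"
        using jj by (metis add_less_cancel_left le_add_diff_inverse lessThan_iff not_less)
      show ?thesis
      proof (cases "j < M")
        case True
        then show ?thesis using new[OF True] by (simp add: colL b' col0) metis
      next
        case False
        then obtain b where b: "j = M + b" "b < k"
          using jj by (metis add_less_cancel_left le_add_diff_inverse lessThan_iff not_less)
        then show ?thesis using \<open>j < j'\<close> b' d0 by (simp add: col0 replicate_eq_replicate)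
      qed
    qed
  qed (simp add: linorder_class.linear)
  then have v0: "v (A e0) \<noteq> 0"
    unfolding v_def using col_sgn_nonzero[of code k d "A e0"] code A_in[OF e0] by (simp add: K)
  have summand_eq: "summand e = v (A e0)" if e: "e \<in> Tables d k k" and nz: "summand e \<noteq> 0" for e
  proof -
    define x where "x = e 0"
    have "map_sgn k (e i) \<noteq> 0" if "i < d" for i using nz that by (auto simp: summand_def)
    then have x: "map_sgn k x \<noteq> 0" using d0 by (simp add: x_def)
    then have bij: "bij_betw x {..<k} {..<k}" by (simp add: map_sgn_nonzero_iff)
    have inj: "inj_on (columns d (M + k) (A e)) {..<M + k}"
      using nz by (intro col_sgn_nonzero_imp_inj[of _ _ code]) (simp add: summand_def v_def)
    \<comment> \<open>L already contains every nonconstant column, so distinctness forces the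
      appended columns to be constant. All rows of e then agree with row 0.\<close>
    have const: "e i b = x b" if i: "i < d" and b: "b < k" for i b
    proof -
      let ?c = "columns d (M + k) (A e) (M + b)"
      have "?c \<in> multi_idx k d"
        using PiE_mem[OF columns_in[OF A_in[OF e]], of "M + b"] b by simp
      moreover have "?c \<notin> set L"
      proof
        assume "?c \<in> set L"
        then obtain j where j: "j < M" "L ! j = ?c" using L(1) by (metis in_set_conv_nth)
        then have "columns d (M + k) (A e) j = ?c" by (simp add: colL)
        then have "j = M + b" using inj_onD[OF inj] j(1) b by simp
        with j(1) show False by simp
      qed
      ultimately obtain a where "?c = replicate d a" using L(3) by blast
      then have eq: "map (\<lambda>i. e i b) [0..<d] = replicate d a" by (simp only: cole[OF b])
      have "e i b = a" if "i < d" for i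
        using arg_cong[OF eq, of "\<lambda>l. l ! i"] that by simp
      then show ?thesis using i d0 by (simp add: x_def)
    qed
    have sgn_e: "map_sgn k (e i) = map_sgn k x" if "i < d" for i
      using const[OF that] by (rule map_sgn_cong)
    let ?\<pi> = "\<lambda>j. if M \<le> j \<and> j < M + k then M + x (j - M) else j"
    have \<pi>: "?\<pi> permutes {..<M + k}" by (rule map_sgn_shift(1)[OF bij])
    have "A e = permute_columns d ?\<pi> (A e0)"
    proof (rule Tables_eqI[OF A_in[OF e] permute_columns_in[OF \<pi> A_in[OF e0]]])
      fix i j assume i: "i < d" and j: "j < M + k"
      show "A e i j = permute_columns d ?\<pi> (A e0) i j"
      proof (cases "j < M")
        case True
        then show ?thesis using i by (simp add: A_def permute_columns_def append_columns_def cat_def)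
      next
        case False
        then obtain b where b: "j = M + b" "b < k"
          using j by (metis add_less_cancel_left le_add_diff_inverse not_less)
        have "x b < k" using bij_betwE[OF bij] b by simp
        then show ?thesis
          using i b const[OF i] by (simp add: A_def permute_columns_def append_columns_def cat_def e0_def)
      qed
    qed
    then have "v (A e) = map_sgn k x * v (A e0)"
      unfolding v_def using col_sgn_permute_columns[OF \<pi>] map_sgn_shift(2)[OF bij, of M] by simp
    \<comment> \<open>The sign of x occurs d times in the row determinants and once more from
      reordering the appended columns, an even number of times in total.\<close>
    then have "summand e = map_sgn k x ^ d * map_sgn k x * v (A e0)"
      using sgn_e by (simp add: summand_def)
    moreover obtain q where "d = 2 * q + 1" using d by (rule oddE)
    moreover have "map_sgn k x * map_sgn k x = 1" by (rule map_sgn_square[OF x])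
    ultimately show ?thesis by (simp add: power_mult power2_eq_square)
  qed
  have "map_sgn k (e0 i) \<noteq> 0" if "i < d" for i
  proof -
    have "map_sgn k (e0 i) = map_sgn k id" using that by (intro map_sgn_cong) (simp add: e0_def)
    then show ?thesis by (simp add: map_sgn_permutes[OF permutes_id])
  qed
  then have "summand e0 \<noteq> 0" using v0 by (simp add: summand_def)
  then have ne: "{e \<in> Tables d k k. summand e \<noteq> 0} \<noteq> {}" using e0 by blast
  have "contract k d M v T = (\<Sum>e\<in>Tables d k k. summand e)"
    by (simp only: contract_def summand_def A_def)
  also have "\<dots> = (\<Sum>e\<in>{e \<in> Tables d k k. summand e \<noteq> 0}. summand e)"
    by (rule sum.mono_neutral_right) auto
  also have "\<dots> = (\<Sum>e\<in>{e \<in> Tables d k k. summand e \<noteq> 0}. v (A e0))"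
    by (rule sum.cong[OF refl], rule summand_eq) blast+
  also have "\<dots> \<noteq> 0"
    using ne v0 finite_Tables[of d k k] by (simp add: card_eq_0_iff del: finite_Tables)
  finally show ?thesis by (simp add: v_def T_def)
qed

section \<open>The full and the reduced table\<close>

lemma card_multi_idx_fixed_entry:
  assumes i: "i < d" and b: "b < k"
  shows "card {c \<in> multi_idx k d. c ! i = b} = k ^ (d - 1)"
proof -
  have "bij_betw (delete_nth i) {c \<in> multi_idx k d. c ! i = b} (multi_idx k (d - 1))"
    unfolding bij_betw_def
  proof
    show "inj_on (delete_nth i) {c \<in> multi_idx k d. c ! i = b}"
    proof (rule inj_onI)
      fix c c' assume c: "c \<in> {c \<in> multi_idx k d. c ! i = b}" "c' \<in> {c \<in> multi_idx k d. c ! i = b}"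
        and eq: "delete_nth i c = delete_nth i c'"
      then have "length c = d" "length c' = d" "c ! i = c' ! i" by (auto simp: multi_idx_def)
      then show "c = c'" using delete_nth_eq_imp i eq by metis
    qed
    show "delete_nth i ` {c \<in> multi_idx k d. c ! i = b} = multi_idx k (d - 1)"
    proof
      show "delete_nth i ` {c \<in> multi_idx k d. c ! i = b} \<subseteq> multi_idx k (d - 1)"
        using delete_nth_in[OF _ i] by blast
      show "multi_idx k (d - 1) \<subseteq> delete_nth i ` {c \<in> multi_idx k d. c ! i = b}"
      proof
        fix l assume l: "l \<in> multi_idx k (d - 1)"
        let ?c = "take i l @ b # drop i l"
        have len: "length l = d - 1" "set l \<subseteq> {..<k}" using l by (auto simp: multi_idx_def)
        then have ti: "length (take i l) = i" using i by simp
        have "set ?c \<subseteq> {..<k}"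
          using len(2) set_take_subset[of i l] set_drop_subset[of i l] b by auto
        then have "?c \<in> multi_idx k d" using len i by (simp add: multi_idx_def)
        moreover have "?c ! i = b" using nth_append_length[of "take i l" b "drop i l"] ti by simp
        moreover have "delete_nth i ?c = l" using ti by (simp add: delete_nth_def)
        ultimately show "l \<in> delete_nth i ` {c \<in> multi_idx k d. c ! i = b}" by (intro image_eqI[of _ _ ?c]) auto
      qed
    qed
  qed
  from bij_betw_same_card[OF this] show ?thesis by (simp add: card_multi_idx)
qed

lemma card_positions_eq:
  assumes "distinct L"
  shows "card {j. j < length L \<and> L ! j ! i = b} = card {c \<in> set L. c ! i = b}"
proof -
  have "bij_betw ((!) L) {j \<in> {..<length L}. L ! j ! i = b} {c \<in> set L. c ! i = b}"
    using bij_betw_nth[OF assms refl refl] by (auto simp: bij_betw_def inj_on_def in_set_conv_nth)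
  then show ?thesis using bij_betw_same_card by fastforce
qed

section \<open>Size and distinctness of the two lists of columns\<close>

lemma length_product_lists_replicate: "length (product_lists (replicate d [0..<k])) = k ^ d"
  by (induction d) (simp_all add: length_concat sum_list_triv o_def)

lemma length_full_table: "length (full_table d k) = k ^ d"
  by (simp add: full_table_def length_product_lists_replicate)

lemma distinct_full_table: "distinct (full_table d k)"
  by (rule card_distinct) (simp add: set_full_table card_multi_idx length_full_table)

lemma set_reduced_table: "set (reduced_table d k) = {c \<in> multi_idx k d. \<forall>a. c \<noteq> replicate d a}"
  by (simp add: reduced_table_def set_full_table)

lemma distinct_reduced_table: "distinct (reduced_table d k)"
  by (simp add: reduced_table_def distinct_full_table)

lemma length_reduced_table:
  assumes "d > 0"
  shows "length (reduced_table d k) = k ^ d - k"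
proof -
  have "set (reduced_table d k) = multi_idx k d - replicate d ` {..<k}"
  proof -
    have "a < k" if "replicate d a \<in> multi_idx k d" for a
      using multi_idx_nth[OF that assms] assms by simp
    then show ?thesis unfolding set_reduced_table by blast
  qed
  moreover have "replicate d ` {..<k} \<subseteq> multi_idx k d" by (auto simp: multi_idx_def)
  moreover have "card (replicate d ` {..<k}) = k"
    using assms by (subst card_image) (auto simp: inj_on_def replicate_eq_replicate)
  ultimately have "card (set (reduced_table d k)) = k ^ d - k"
    by (simp add: card_Diff_subset finite_subset[OF _ finite_multi_idx] card_multi_idx)
  then show ?thesis by (simp add: distinct_card[OF distinct_reduced_table])
qed

lemma card_reduced_table_fixed_entry:
  assumes i: "i < d" and b: "b < k"
  shows "card {c \<in> set (reduced_table d k). c ! i = b} = k ^ (d - 1) - 1"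
proof -
  have "{c \<in> set (reduced_table d k). c ! i = b} = {c \<in> multi_idx k d. c ! i = b} - {replicate d b}"
    unfolding set_reduced_table using i by auto
  moreover have "replicate d b \<in> {c \<in> multi_idx k d. c ! i = b}"
    using i b by (auto simp: multi_idx_def)
  ultimately show ?thesis by (simp add: card_multi_idx_fixed_entry[OF i b])
qed

lemma table_of_nth_in:
  assumes "\<And>j. j < M \<Longrightarrow> L ! j \<in> multi_idx k d"
  shows "table_of d M ((!) L) \<in> Tables d M k"
  unfolding table_of_def by (rule TablesI) (rule multi_idx_nth[OF assms])

text \<open>It suffices to match every column of T with some column of T0 after relabelling:
  distinct columns make the matching injective, hence a permutation of the positions.\<close>

lemma canonical_tableI:
  assumes T0: "T0 \<in> Tables d (n * k) k"
    and ex: "\<And>T. T \<in> Tables d (n * k) k \<Longrightarrow>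
      (\<And>i b. i < d \<Longrightarrow> b < k \<Longrightarrow> card {j. j < n * k \<and> T i j = b} = n) \<Longrightarrow>
      inj_on (columns d (n * k) T) {..<n * k} \<Longrightarrow>
      \<exists>p. (\<forall>i<d. p i permutes {..<k}) \<and> (\<forall>j<n * k. \<exists>j'<n * k. \<forall>i<d. T i j = p i (T0 i j'))"
  shows "canonical_table n k d T0"
  unfolding canonical_table_def
proof (intro conjI ballI impI T0)
  let ?M = "n * k"
  fix T assume T: "T \<in> Tables d ?M k"
    and bal: "\<forall>i<d. \<forall>b<k. card {j. j < ?M \<and> T i j = b} = n" and inj: "inj_on (columns d ?M T) {..<?M}"
  obtain p where p: "\<forall>i<d. p i permutes {..<k}"
    and "\<forall>j<?M. \<exists>j'<?M. \<forall>i<d. T i j = p i (T0 i j')"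
    using ex[OF T _ inj] bal by blast
  then obtain f where f: "\<And>j. j < ?M \<Longrightarrow> f j < ?M \<and> (\<forall>i<d. T i j = p i (T0 i (f j)))"
    by metis
  let ?\<pi> = "\<lambda>j. if j < ?M then f j else j"
  have "inj_on f {..<?M}"
  proof (rule inj_onI)
    fix j j' assume j: "j \<in> {..<?M}" "j' \<in> {..<?M}" and "f j = f j'"
    then have "T i j = T i j'" if "i < d" for i using f[of j] f[of j'] that by simp
    then have "columns d ?M T j = columns d ?M T j'" using j by (simp add: columns_def)
    then show "j = j'" using inj_onD[OF inj] j by blast
  qed
  moreover have "f ` {..<?M} \<subseteq> {..<?M}" using f by blast
  ultimately have "bij_betw f {..<?M} {..<?M}" by (simp add: bij_betw_def endo_inj_surj)
  then have "?\<pi> permutes {..<?M}" by (rule extend_permutes)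
  moreover have "\<forall>i<d. \<forall>j<?M. T i j = p i (T0 i (?\<pi> j))" using f by simp
  ultimately show "\<exists>p \<pi>. (\<forall>i<d. p i permutes {..<k}) \<and> \<pi> permutes {..<?M} \<and>
           (\<forall>i<d. \<forall>j<?M. T i j = p i (T0 i (\<pi> j)))"
    using p by blast
qed

text \<open>A table of k ^ d columns over [k] has all its columns in the full list, so the
  relabellings can be taken to be the identity.\<close>

lemma canonical_full_table:
  assumes d: "d > 0" and n: "n = k ^ (d - 1)"
  shows "canonical_table n k d (table_of d (n * k) ((!) (full_table d k)))"
proof -
  let ?L = "full_table d k"
  have M: "n * k = k ^ d" unfolding n by (rule power_minus_mult[OF d])
  show ?thesis
  proof (rule canonical_tableI)
    show "table_of d (n * k) ((!) ?L) \<in> Tables d (n * k) k"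
      using nth_mem[of _ ?L] by (intro table_of_nth_in) (simp add: set_full_table length_full_table M)
  next
    fix T assume T: "T \<in> Tables d (n * k) k"
    have "\<exists>j'<n * k. \<forall>i<d. T i j = id (table_of d (n * k) ((!) ?L) i j')" if j: "j < n * k" for j
    proof -
      have "columns d (n * k) T j \<in> set ?L"
        using PiE_mem[OF columns_in[OF T], of j] j by (simp add: set_full_table)
      then obtain j' where j': "j' < n * k" "?L ! j' = columns d (n * k) T j"
        unfolding in_set_conv_nth length_full_table M[symmetric] by blast
      then have "T i j = table_of d (n * k) ((!) ?L) i j'" if "i < d" for i
        using that j by (simp add: table_of_def columns_def)
      with j'(1) show ?thesis by auto
    qed
    then show "\<exists>p. (\<forall>i<d. p i permutes {..<k}) \<and>
        (\<forall>j<n * k. \<exists>j'<n * k. \<forall>i<d. T i j = p i (table_of d (n * k) ((!) ?L) i j'))"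
      using permutes_id by (intro exI[of _ "\<lambda>_. id"]) blast
  qed
qed

text \<open>
  The \<open>k\<close> columns missing from a balanced table with distinct columns contain each symbol once in
  every row; relabelling turns them into the constant columns.
\<close>

lemma canonical_reduced_table:
  assumes d: "d > 0" and n: "n = k ^ (d - 1) - 1" and k: "k > 0"
  shows "canonical_table n k d (table_of d (n * k) ((!) (reduced_table d k)))"
proof -
  let ?L = "reduced_table d k" and ?M = "n * k"
  have Kd: "k ^ (d - 1) * k = k ^ d" by (rule power_minus_mult[OF d])
  then have M: "?M = k ^ d - k" by (simp add: n diff_mult_distrib)
  have lenL: "length ?L = ?M" using length_reduced_table[OF d] by (simp add: M)
  show ?thesis
  proof (rule canonical_tableI)
    show "table_of d ?M ((!) ?L) \<in> Tables d ?M k"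
      using nth_mem[of _ ?L] by (intro table_of_nth_in) (simp add: set_reduced_table lenL)
  next
    fix T assume T: "T \<in> Tables d ?M k"
      and bal: "\<And>i b. i < d \<Longrightarrow> b < k \<Longrightarrow> card {j. j < ?M \<and> T i j = b} = n"
      and inj: "inj_on (columns d ?M T) {..<?M}"
    define C where "C = columns d ?M T ` {..<?M}"
    define E where "E = multi_idx k d - C"
    have C: "C \<subseteq> multi_idx k d" using PiE_mem[OF columns_in[OF T]] by (auto simp: C_def)
    have col_nth: "columns d ?M T j ! i = T i j" if "i < d" "j < ?M" for i j
      using that by (simp add: columns_def)
    \<comment> \<open>In row i the symbol b occurs k ^ (d - 1) times among all columns and n times
      in T, and the difference is 1.\<close>
    have one: "card {c \<in> E. c ! i = b} = 1" if i: "i < d" and b: "b < k" for i b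
    proof -
      have "{c \<in> C. c ! i = b} = columns d ?M T ` {j. j < ?M \<and> T i j = b}"
        using col_nth[OF i] by (auto simp: C_def)
      moreover have "inj_on (columns d ?M T) {j. j < ?M \<and> T i j = b}"
        by (rule inj_on_subset[OF inj]) auto
      ultimately have "card {c \<in> C. c ! i = b} = n" using bal[OF i b] by (simp add: card_image)
      moreover have "{c \<in> E. c ! i = b} = {c \<in> multi_idx k d. c ! i = b} - {c \<in> C. c ! i = b}"
        by (auto simp: E_def)
      moreover have "card ({c \<in> multi_idx k d. c ! i = b} - {c \<in> C. c ! i = b})
          = card {c \<in> multi_idx k d. c ! i = b} - card {c \<in> C. c ! i = b}"
      proof (rule card_Diff_subset)
        have "finite C" by (simp add: C_def)
        then show "finite {c \<in> C. c ! i = b}" by simp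
      qed (use C in blast)
      ultimately have "card {c \<in> E. c ! i = b} = k ^ (d - 1) - n"
        by (simp only: card_multi_idx_fixed_entry[OF i b])
      then show ?thesis using k by (simp add: n Suc_le_eq)
    qed
    have uniq: "\<exists>!c. c \<in> E \<and> c ! i = b" if "i < d" "b < k" for i b
    proof -
      from one[OF that] obtain c where "{c \<in> E. c ! i = b} = {c}" by (rule card_1_singletonE)
      then show ?thesis by (intro ex1I[of _ c]) blast+
    qed
    \<comment> \<open>q b is the missing column that starts with b. The relabelling p i sends b to
      its i-th entry, so it turns the constant column b into q b.\<close>
    define q where "q b = (THE c. c \<in> E \<and> c ! 0 = b)" for b
    have q: "q b \<in> E" "q b ! 0 = b" if "b < k" for b
      using theI'[OF uniq[OF d that]] by (simp_all add: q_def)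
    define p where "p i b = (if b < k then q b ! i else b)" for i b
    have p: "p i permutes {..<k}" if i: "i < d" for i
    proof -
      have qi: "q b ! i < k" if "b < k" for b
        using q(1)[OF that] i by (auto simp: E_def multi_idx_nth)
      have "inj_on (\<lambda>b. q b ! i) {..<k}"
      proof (rule inj_onI)
        fix b b' assume b: "b \<in> {..<k}" "b' \<in> {..<k}" and eq: "q b ! i = q b' ! i"
        then have "q b = q b'" using uniq[OF i qi] q(1) by blast
        then show "b = b'" using q(2) b by (metis lessThan_iff)
      qed
      moreover have "(\<lambda>b. q b ! i) ` {..<k} \<subseteq> {..<k}" using qi by auto
      ultimately have "bij_betw (\<lambda>b. q b ! i) {..<k} {..<k}" by (simp add: bij_betw_def endo_inj_surj)
      from extend_permutes[OF this] show ?thesis by (simp add: p_def[abs_def])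
    qed
    have "\<exists>j'<?M. \<forall>i<d. T i j = p i (table_of d ?M ((!) ?L) i j')" if j: "j < ?M" for j
    proof -
      have "\<exists>b<k. p i b = T i j" if i: "i < d" for i
        using permutes_image[OF p[OF i]] TablesD(2)[OF T i j] by (metis image_iff lessThan_iff)
      then obtain r where r: "\<And>i. i < d \<Longrightarrow> r i < k \<and> p i (r i) = T i j" by metis
      let ?c = "map r [0..<d]"
      have "?c \<in> multi_idx k d" using r by (auto simp: multi_idx_def)
      \<comment> \<open>If the preimage of a column of T were constant, that column would be one of
        the missing ones.\<close>
      moreover have "?c \<noteq> replicate d a" for a
      proof
        assume eq: "?c = replicate d a"
        have ra: "r i = a" if "i < d" for i using arg_cong[OF eq, of "\<lambda>l. l ! i"] that by simp
        have a: "a < k" using r[OF d] ra[OF d] by simp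
        have "columns d ?M T j = q a"
        proof (rule nth_equalityI)
          show "length (columns d ?M T j) = length (q a)"
            using q(1)[OF a] j by (simp add: E_def multi_idx_def columns_def)
          fix i assume "i < length (columns d ?M T j)"
          then have i: "i < d" using j by (simp add: columns_def)
          show "columns d ?M T j ! i = q a ! i" using r[OF i] ra[OF i] a col_nth[OF i j] by (simp add: p_def)
        qed
        moreover have "columns d ?M T j \<in> C" using j by (auto simp: C_def)
        ultimately have "q a \<in> C" by simp
        then show False using q(1)[OF a] by (simp add: E_def)
      qed
      ultimately have "?c \<in> set ?L" by (simp add: set_reduced_table)
      then obtain j' where j': "j' < ?M" "?L ! j' = ?c"
        unfolding in_set_conv_nth lenL by blast
      then have "T i j = p i (table_of d ?M ((!) ?L) i j')" if "i < d" for i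
        using that r by (simp add: table_of_def)
      with j'(1) show ?thesis by blast
    qed
    then show "\<exists>p. (\<forall>i<d. p i permutes {..<k}) \<and>
        (\<forall>j<?M. \<exists>j'<?M. \<forall>i<d. T i j = p i (table_of d ?M ((!) ?L) i j'))"
      using p by blast
  qed
qed

text \<open>Excludes k' < k in the reduced case: the gap of 2 leaves (k - 1) ^ (d - 1) strictly
  below k ^ (d - 1) - 1.\<close>

lemma power_Suc_ge_add_two:
  fixes j e :: nat
  assumes "j > 0" "e \<ge> 2"
  shows "j ^ e + 2 \<le> Suc j ^ e"
proof -
  obtain e' where e: "e = Suc e'" "e' > 0" using assms by (cases e) auto
  have "j ^ e' < Suc j ^ e'" using e by (intro power_strict_mono) auto
  then have "Suc j * (j ^ e' + 1) \<le> Suc j * Suc j ^ e'" by (intro mult_left_mono) auto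
  moreover have "j ^ e' \<ge> 1" using assms by simp
  ultimately show ?thesis using e by simp
qed

theorem theorem6p1:
  fixes d k :: nat
  assumes "d \<ge> 3" and "odd d" and "k \<ge> 1"
  shows "(min_degree d (k ^ (d - 1)) = k ^ d \<and>
          F_full d k \<noteq> 0 \<and>
          poly_space.dim (invariants (k ^ (d - 1)) d (k ^ d)) = 1 \<and>
          invariants (k ^ (d - 1)) d (k ^ d) = poly_space.span {F_full d k}) \<and>
         (k \<ge> 2 \<longrightarrow>
          min_degree d (k ^ (d - 1) - 1) = k ^ d - k \<and>
          F_reduced d k \<noteq> 0 \<and>
          poly_space.dim (invariants (k ^ (d - 1) - 1) d (k ^ d - k)) = 1 \<and>
          invariants (k ^ (d - 1) - 1) d (k ^ d - k) = poly_space.span {F_reduced d k})"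
proof (intro conjI impI)
  have d0: "d > 0" and k0: "k > 0" using assms by auto
  obtain code where code: "bij_betw code (multi_idx k d) {..<k ^ d}" using ex_code by blast
  have Kd: "k ^ (d - 1) * k = k ^ d" by (rule power_minus_mult[OF d0])
  {
    let ?n = "k ^ (d - 1)"
    let ?T = "table_of d (k ^ d) ((!) (full_table d k))"
    have n0: "?n > 0" using k0 by simp
    note can = canonical_full_table[OF d0 refl, of k]
    have T: "?T \<in> Tables d (k ^ d) k"
      using can by (simp only: canonical_table_def Kd)
    have in_idx: "full_table d k ! j \<in> multi_idx k d" if "j < k ^ d" for j
      using nth_mem[of j "full_table d k"] that by (simp add: set_full_table length_full_table)
    have bal: "card {j. j < k ^ d \<and> full_table d k ! j ! i = b} = ?n" if "i < d" "b < k" for i b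
      using card_positions_eq[OF distinct_full_table, of d k i b] card_multi_idx_fixed_entry[OF that]
      by (simp only: length_full_table set_full_table)
    have "inj_on (columns d (k ^ d) ?T) {..<k ^ d}"
    proof -
      have "columns d (k ^ d) ?T j = full_table d k ! j" if "j < k ^ d" for j
        using in_idx[OF that] that
        by (intro nth_equalityI) (simp_all add: columns_def table_of_def multi_idx_def)
      then show ?thesis
        using distinct_full_table[of d k] by (simp add: inj_on_def nth_eq_iff_index_eq length_full_table)
    qed
    \<comment> \<open>The full table lists each basis tensor once, so the volume form is nonzero
      there.\<close>
    then have v: "col_sgn d (k ^ d) code ?T \<noteq> 0" by (rule col_sgn_nonzero[OF code T])
    have nz: "form ?n d (k ^ d) (\<lambda>s. \<Prod>i<d. eps ?n (k ^ d) (s i) (?T i)) \<noteq> 0"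
      using form_canonical_nonzero[OF n0 k0 assms(2) can, of "col_sgn d (k ^ d) code" ?T]
        slotwise_invariant_col_sgn[OF k0 code] col_sgn_permute_columns[of _ "k ^ d" d code] T v
      unfolding Kd by blast
    note main = invariants_canonical[OF n0 assms(2), of "full_table d k" k, unfolded Kd,
        OF length_full_table in_idx bal can[unfolded Kd] nz]
    show F: "F_full d k \<noteq> 0" unfolding F_full_def by (rule main(1))
    show inv: "invariants ?n d (k ^ d) = poly_space.span {F_full d k}"
      unfolding F_full_def by (rule main(2))
    show "poly_space.dim (invariants ?n d (k ^ d)) = 1"
      unfolding inv by (rule dim_span_singleton[OF F])
    show "min_degree d ?n = k ^ d"
    proof (rule min_degree_eqI)
      show "F_full d k \<in> invariants ?n d (k ^ d)"
        unfolding inv by (rule poly_space.span_base) simp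
      fix f m assume "f \<in> invariants ?n d m" "f \<noteq> 0" "m > 0"
      then obtain k' where k': "m = ?n * k'" "?n \<le> k' ^ (d - 1)"
        using invariant_degree_bound[OF n0 assms(2)] by metis
      \<comment> \<open>The bound k ^ (d - 1) <= k' ^ (d - 1) has a positive exponent and can be
        compared at the bases.\<close>
      have "k \<le> k'"
        using k'(2) assms(1) by (simp add: power_mono_iff)
      then have "?n * k \<le> m" unfolding k' by (rule mult_le_mono2)
      then show "k ^ d \<le> m" by (simp only: Kd)
    qed (use k0 F in simp_all)
  }
  {
    assume k2: "k \<ge> 2"
    let ?n = "k ^ (d - 1) - 1"
    let ?M = "k ^ d - k"
    let ?L = "reduced_table d k"
    let ?T = "table_of d ?M ((!) ?L)"
    have M: "?n * k = ?M" by (simp only: diff_mult_distrib Kd mult_1)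
    have "k ^ 1 \<le> k ^ (d - 1)" using k0 assms(1) by (intro power_increasing) auto
    then have n0: "?n > 0" using k2 by simp
    have K: "?M + k = k ^ d"
    proof -
      have "1 * k \<le> k ^ (d - 1) * k" using k0 by (intro mult_le_mono1) simp
      then show ?thesis by (simp only: Kd mult_1 le_add_diff_inverse2)
    qed
    note can = canonical_reduced_table[OF d0 refl k0]
    have len: "length ?L = ?M" by (rule length_reduced_table[OF d0])
    have T: "?T \<in> Tables d ?M k"
      using can by (simp only: canonical_table_def M)
    have in_idx: "?L ! j \<in> multi_idx k d" if "j < ?M" for j
      using nth_mem[of j ?L] that by (simp add: set_reduced_table len)
    have bal: "card {j. j < ?M \<and> ?L ! j ! i = b} = ?n" if "i < d" "b < k" for i b
      using card_positions_eq[OF distinct_reduced_table, of d k i b] card_reduced_table_fixed_entry[OF that]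
      by (simp only: len)
    have code': "bij_betw code (multi_idx k d) {..<?M + k}" using code by (simp only: K)
    \<comment> \<open>Contracting the volume form on k ^ d columns by k columns leaves an
      alternating invariant on exactly as many columns as the reduced table has.\<close>
    define u where "u = contract k d ?M (col_sgn d (?M + k) code)"
    have u: "slotwise_invariant k d ?M u"
      unfolding u_def using slotwise_invariant_col_sgn[OF k0 code]
      by (intro slotwise_invariant_contract[OF k0]) (simp only: K)
    have anti: "u (permute_columns d \<pi> T) = of_int (sign \<pi>) * u T"
      if "\<pi> permutes {..<?M}" "T \<in> Tables d ?M k" for \<pi> T
      unfolding u_def using col_sgn_permute_columns that by (rule contract_permute_columns)
    have "u ?T \<noteq> 0"
      unfolding u_def using len distinct_reduced_table set_reduced_table
      by (rule contract_nonzero[OF assms(2) K code'])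
    then have nz: "form ?n d ?M (\<lambda>s. \<Prod>i<d. eps ?n ?M (s i) (?T i)) \<noteq> 0"
      using form_canonical_nonzero[OF n0 k0 assms(2) can, of u ?T] u anti T
      unfolding M by blast
    note main = invariants_canonical[OF n0 assms(2), of ?L k, unfolded M,
        OF len in_idx bal can[unfolded M] nz]
    show F: "F_reduced d k \<noteq> 0" unfolding F_reduced_def by (rule main(1))
    show inv: "invariants ?n d ?M = poly_space.span {F_reduced d k}"
      unfolding F_reduced_def by (rule main(2))
    show "poly_space.dim (invariants ?n d ?M) = 1"
      unfolding inv by (rule dim_span_singleton[OF F])
    show "min_degree d ?n = ?M"
    proof (rule min_degree_eqI)
      show "F_reduced d k \<in> invariants ?n d ?M"
        unfolding inv by (rule poly_space.span_base) simp
      show "?M > 0" using n0 k0 unfolding M[symmetric] by simp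
      fix f m assume "f \<in> invariants ?n d m" "f \<noteq> 0" "m > 0"
      then obtain k' where k': "m = ?n * k'" "?n \<le> k' ^ (d - 1)"
        using invariant_degree_bound[OF n0 assms(2)] by metis
      obtain j where j: "k = Suc j" "j > 0" using k2 by (cases k) auto
      have "k \<le> k'"
      proof (rule ccontr)
        assume "\<not> k \<le> k'"
        then have "k' ^ (d - 1) \<le> j ^ (d - 1)" using j by (intro power_mono) auto
        moreover have "j ^ (d - 1) + 2 \<le> k ^ (d - 1)"
          unfolding j(1) using j(2) assms(1) by (intro power_Suc_ge_add_two) auto
        ultimately show False using k'(2) by simp
      qed
      then have "?n * k \<le> m" unfolding k' by (rule mult_le_mono2)
      then show "?M \<le> m" by (simp only: M)
    qed (rule F)
  }
qed

end
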